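(* Let $X$ be a smooth manifold and let $M\to X$ be the bundle of pseudo-Riemannian metrics of a fixed signature. If $k\geq2$, any divergence-free, natural tensor $T\colon J^2M\to S^{2k}TX$ is a constant multiple of $$S_{2k}:=\mathrm{sym}(g^*\otimes\stackrel{k}{\ldots}\otimes g^* ),$$ where $g^*$ is the dual (contravariant) metric and $\mathrm{sym}$ denotes symmetrization in all indices.
   Context: $X$ is a smooth manifold; $M\to X$ is the bundle of pseudo-Riemannian metrics of a fixed signature; $J^2M$ is the bundle of 2-jets of sections of $M$. A tensor $T\colon J^2M\to S^{2k}TX\subset\otimes^{2k}TX$ here is a smooth morphism of bundles over the identity of $X$; for a metric $g$, $T(g)$ is the tensor field $x\mapsto T(j^2_xg)$. It is natural if $T(\tau\cdot j^2_xg)=\tau_*T(j^2_xg)$ for every diffeomorphism $\tau\colon U\to V$ between open sets of $X$ and every metric $g$ (of the fixed signature) near $x\in U$, where $\tau\cdot j^2_xg:=j^2_{\tau(x)}(\tau_*g)$. Divergence: $(\mathrm{div}\,T)(g)^{j_1\ldots j_{2k-1}}=\nabla_lT(g)^{j_1\ldots j_{2k-1}l}$, with $\nabla$ the Levi-Civita connection of $g$. $T$ is divergence-free if $(\mathrm{div}\,T)(g)=0$ for every metric $g$ (of the fixed signature, on any open set). $S_{2k}$ is regarded as the natural tensor $j^2_xg\mapsto \mathrm{sym}(g_x^*\otimes\cdots\otimes g_x^* )$, and "constant multiple" means $T=\lambda S_{2k}$ for some $\lambda\in\mathbb{R}$. *)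

theory Defs
  imports "HOL-Analysis.Analysis" "HOL-Combinatorics.Permutations"
begin

section \<open>Smooth functions between normed spaces\<close>

text \<open>Meant for open \<open>S\<close> and a finite-dimensional domain, where it is the usual notion of a
  \<open>C\<^sup>k\<close> function: all iterated directional derivatives up to order \<open>k\<close> exist and are continuous.\<close>

primrec Ck_on :: "nat \<Rightarrow> 'a::real_normed_vector set \<Rightarrow> ('a \<Rightarrow> 'b::real_normed_vector) \<Rightarrow> bool" where
  "Ck_on 0 S f \<longleftrightarrow> continuous_on S f"
| "Ck_on (Suc k) S f \<longleftrightarrow> (\<forall>x\<in>S. f differentiable (at x)) \<and>
     (\<forall>v. Ck_on k S (\<lambda>x. frechet_derivative f (at x) v))"

definition smooth_on :: "'a::real_normed_vector set \<Rightarrow> ('a \<Rightarrow> 'b::real_normed_vector) \<Rightarrow> bool" where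
  "smooth_on S f \<longleftrightarrow> (\<forall>k. Ck_on k S f)"

definition partial :: "'n \<Rightarrow> (real^'n \<Rightarrow> 'b::real_normed_vector) \<Rightarrow> real^'n \<Rightarrow> 'b" where
  "partial k f y = frechet_derivative f (at y) (axis k 1)"


section \<open>Smooth manifolds\<close>

text \<open>A chart is a pair of its domain and its coordinate map; the values of the coordinate map
  outside the domain are irrelevant. The underlying space of a manifold is a whole type, and
  \<open>CARD('n)\<close> is its dimension.\<close>

type_synonym ('x, 'n) chart = "'x set \<times> ('x \<Rightarrow> real^'n)"

abbreviation chart_dom :: "('x, 'n) chart \<Rightarrow> 'x set" where
  "chart_dom c \<equiv> fst c"

abbreviation coord :: "('x, 'n) chart \<Rightarrow> 'x \<Rightarrow> real^'n" where
  "coord c \<equiv> snd c"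

abbreviation chart_inv :: "('x, 'n) chart \<Rightarrow> real^'n \<Rightarrow> 'x" where
  "chart_inv c \<equiv> inv_into (chart_dom c) (coord c)"

definition local_rep ::
  "('x, 'n) chart \<Rightarrow> ('x, 'n) chart \<Rightarrow> ('x \<Rightarrow> 'x) \<Rightarrow> real^'n \<Rightarrow> real^'n" where
  "local_rep c d f = (\<lambda>y. coord d (f (chart_inv c y)))"

text \<open>The matrix of the differential of \<open>f\<close> at \<open>x\<close>, with respect to the chart \<open>c\<close> around \<open>x\<close> and
  the chart \<open>d\<close> around \<open>f x\<close>; for \<open>f = id\<close> it is the Jacobian matrix of a change of charts.\<close>

definition diff_matrix ::
  "('x, 'n::finite) chart \<Rightarrow> ('x, 'n) chart \<Rightarrow> ('x \<Rightarrow> 'x) \<Rightarrow> 'x \<Rightarrow> real^'n^'n" where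
  "diff_matrix c d f x = jacobian (local_rep c d f) (at (coord c x))"

definition smooth_manifold ::
  "('x::{t2_space, second_countable_topology}, 'n::finite) chart set \<Rightarrow> bool" where
  "smooth_manifold A \<longleftrightarrow>
     (\<Union>c\<in>A. chart_dom c) = UNIV \<and>
     (\<forall>c\<in>A. open (chart_dom c) \<and> open (coord c ` chart_dom c) \<and>
        homeomorphism (chart_dom c) (coord c ` chart_dom c) (coord c) (chart_inv c)) \<and>
     (\<forall>c\<in>A. \<forall>d\<in>A. smooth_on (coord c ` (chart_dom c \<inter> chart_dom d)) (local_rep c d id))"

definition smooth_map_on ::
  "('x::topological_space, 'n::finite) chart set \<Rightarrow> 'x set \<Rightarrow> ('x \<Rightarrow> 'x) \<Rightarrow> bool" where
  "smooth_map_on A U f \<longleftrightarrow> continuous_on U f \<and>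
     (\<forall>c\<in>A. \<forall>d\<in>A. smooth_on (coord c ` (U \<inter> chart_dom c \<inter> f -` chart_dom d)) (local_rep c d f))"

definition diffeo ::
  "('x::topological_space, 'n::finite) chart set \<Rightarrow> 'x set \<Rightarrow> 'x set \<Rightarrow> ('x \<Rightarrow> 'x) \<Rightarrow> bool" where
  "diffeo A U V f \<longleftrightarrow> open U \<and> open V \<and> bij_betw f U V \<and>
     smooth_map_on A U f \<and> smooth_map_on A V (inv_into U f)"

definition chart_at :: "('x, 'n) chart set \<Rightarrow> 'x \<Rightarrow> ('x, 'n) chart" where
  "chart_at A x = (SOME c. c \<in> A \<and> x \<in> chart_dom c)"


section \<open>Pseudo-Riemannian metrics\<close>

text \<open>There is a basis (the columns of \<open>P\<close>) that is orthonormal for the bilinear form \<open>B\<close>, with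
  \<open>p\<close> vectors of square \<open>1\<close> and \<open>q\<close> vectors of square \<open>-1\<close>.\<close>

definition has_signature :: "nat \<Rightarrow> nat \<Rightarrow> real^'n^'n \<Rightarrow> bool" where
  "has_signature p q B \<longleftrightarrow> (\<exists>(P::real^'n^'n) e. invertible P \<and>
     transpose P ** B ** P = (\<chi> i j. if i = j then e i else 0) \<and>
     (\<forall>i. e i = 1 \<or> e i = -1) \<and> card {i. e i = 1} = p \<and> card {i. e i = -1} = q)"

text \<open>A covariant 2-tensor field is given by its component matrix in each chart \<open>c\<close>, at each point of
  \<open>chart_dom c\<close>; values for other arguments are irrelevant.\<close>

type_synonym ('x, 'n) metric = "('x, 'n) chart \<Rightarrow> 'x \<Rightarrow> real^'n^'n"

definition metric_comp :: "('x, 'n) chart \<Rightarrow> ('x, 'n) metric \<Rightarrow> real^'n \<Rightarrow> real^'n^'n" where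
  "metric_comp c g = (\<lambda>y. g c (chart_inv c y))"

definition metric_on ::
  "('x::topological_space, 'n::finite) chart set \<Rightarrow> nat \<Rightarrow> nat \<Rightarrow> 'x set \<Rightarrow> ('x, 'n) metric \<Rightarrow> bool" where
  "metric_on A p q U g \<longleftrightarrow> open U \<and>
     (\<forall>c\<in>A. smooth_on (coord c ` (U \<inter> chart_dom c)) (metric_comp c g)) \<and>
     (\<forall>c\<in>A. \<forall>x\<in>U \<inter> chart_dom c. transpose (g c x) = g c x \<and> has_signature p q (g c x)) \<and>
     (\<forall>c\<in>A. \<forall>d\<in>A. \<forall>x\<in>U \<inter> chart_dom c \<inter> chart_dom d.
        g c x = transpose (diff_matrix c d id x) ** g d x ** diff_matrix c d id x)"

text \<open>The direct image of a metric along an injection \<open>\<tau>\<close> of \<open>U\<close>: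
  \<open>(\<tau>\<^sub>*g)(v, w) = g(d\<tau>\<inverse> v, d\<tau>\<inverse> w)\<close>. It does not depend on the chosen chart around
  the preimage of the point.\<close>

definition push_metric ::
  "('x, 'n::finite) chart set \<Rightarrow> 'x set \<Rightarrow> ('x \<Rightarrow> 'x) \<Rightarrow> ('x, 'n) metric \<Rightarrow> ('x, 'n) metric" where
  "push_metric A U \<tau> g = (\<lambda>d y.
     let x = inv_into U \<tau> y; c = chart_at A x; S = diff_matrix d c (inv_into U \<tau>) y
     in transpose S ** g c x ** S)"


section \<open>2-jets of metrics\<close>

type_synonym 'n jet_coords =
  "(real^'n) \<times> (real^'n^'n) \<times> (real^'n^'n^'n) \<times> (real^'n^'n^'n^'n)"

text \<open>Coordinates of \<open>j\<^sup>2\<^sub>x g\<close>: those of \<open>x\<close>, the components \<open>g\<^sub>i\<^sub>j\<close>, and their first and second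
  partial derivatives.\<close>

definition jet_coords ::
  "('x, 'n::finite) chart \<Rightarrow> 'x \<Rightarrow> ('x, 'n) metric \<Rightarrow> 'n jet_coords" where
  "jet_coords c x g =
     (coord c x,
      metric_comp c g (coord c x),
      (\<chi> k. partial k (metric_comp c g) (coord c x)),
      (\<chi> k l. partial k (partial l (metric_comp c g)) (coord c x)))"

text \<open>A 2-jet of a metric is its base point together with the class of all metrics near that point
  which agree there up to second order.\<close>

type_synonym ('x, 'n) jet = "'x \<times> ('x, 'n) metric set"

definition jet2 ::
  "('x::topological_space, 'n::finite) chart set \<Rightarrow> nat \<Rightarrow> nat \<Rightarrow> 'x \<Rightarrow> ('x, 'n) metric \<Rightarrow> ('x, 'n) jet" where
  "jet2 A p q x g = (x, {h. (\<exists>W. x \<in> W \<and> metric_on A p q W h) \<and>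
     (\<forall>c\<in>A. x \<in> chart_dom c \<longrightarrow> jet_coords c x h = jet_coords c x g)})"

definition J2M ::
  "('x::topological_space, 'n::finite) chart set \<Rightarrow> nat \<Rightarrow> nat \<Rightarrow> ('x, 'n) jet set" where
  "J2M A p q = {jet2 A p q x g | x g. \<exists>W. x \<in> W \<and> metric_on A p q W g}"


section \<open>Contravariant tensors\<close>

text \<open>A contravariant tensor of order \<open>m\<close> at a point is given by its components in each chart around
  that point; the indices form a list of length \<open>m\<close>. Components for other charts and other lists are
  fixed to be \<open>0\<close>, so that equality of tensors is equality of functions.\<close>

type_synonym ('x, 'n) tensor = "('x, 'n) chart \<Rightarrow> 'n list \<Rightarrow> real"

definition transform_comps :: "nat \<Rightarrow> real^'n^'n \<Rightarrow> ('n list \<Rightarrow> real) \<Rightarrow> 'n list \<Rightarrow> real" where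
  "transform_comps m J t I =
     (\<Sum>K | length K = m. (\<Prod>a<m. J $ (I ! a) $ (K ! a)) * t K)"

text \<open>The elements of the fibre of \<open>S\<^sup>mTX\<close> over \<open>x\<close>.\<close>

definition sym_tensors :: "('x, 'n::finite) chart set \<Rightarrow> nat \<Rightarrow> 'x \<Rightarrow> ('x, 'n) tensor set" where
  "sym_tensors A m x = {t.
     (\<forall>c I. \<not> (c \<in> A \<and> x \<in> chart_dom c \<and> length I = m) \<longrightarrow> t c I = 0) \<and>
     (\<forall>c\<in>A. \<forall>d\<in>A. \<forall>I. x \<in> chart_dom c \<and> x \<in> chart_dom d \<and> length I = m \<longrightarrow>
        t d I = transform_comps m (diff_matrix c d id x) (t c) I) \<and>
     (\<forall>c I I'. mset I = mset I' \<longrightarrow> t c I = t c I')}"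

text \<open>The image under \<open>\<tau>\<^sub>*\<close> of a tensor at \<open>x\<close>, a tensor at \<open>\<tau> x\<close>. It does not depend on the chosen
  chart around \<open>x\<close>.\<close>

definition push_tensor ::
  "('x, 'n::finite) chart set \<Rightarrow> nat \<Rightarrow> ('x \<Rightarrow> 'x) \<Rightarrow> 'x \<Rightarrow> ('x, 'n) tensor \<Rightarrow> ('x, 'n) tensor" where
  "push_tensor A m \<tau> x t = (\<lambda>d I.
     if d \<in> A \<and> \<tau> x \<in> chart_dom d \<and> length I = m
     then let c = chart_at A x in transform_comps m (diff_matrix c d \<tau> x) (t c) I
     else 0)"

definition symmetrize :: "nat \<Rightarrow> ('n list \<Rightarrow> real) \<Rightarrow> 'n list \<Rightarrow> real" where
  "symmetrize m t I = (\<Sum>\<sigma> | \<sigma> permutes {..<m}. t (permute_list \<sigma> I)) / fact m"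

text \<open>Components of the \<open>k\<close>-fold tensor power of a contravariant 2-tensor.\<close>

definition tensor_power :: "nat \<Rightarrow> real^'n^'n \<Rightarrow> 'n list \<Rightarrow> real" where
  "tensor_power k B I = (\<Prod>a<k. B $ (I ! (2 * a)) $ (I ! (2 * a + 1)))"

text \<open>The tensor \<open>S\<^bsub>2k\<^esub>\<close> of a metric \<open>g\<close> at \<open>x\<close>; the components of the dual metric are
  those of the inverse matrix.\<close>

definition S_tensor ::
  "('x, 'n::finite) chart set \<Rightarrow> nat \<Rightarrow> ('x, 'n) metric \<Rightarrow> 'x \<Rightarrow> ('x, 'n) tensor" where
  "S_tensor A k g x = (\<lambda>c I.
     if c \<in> A \<and> x \<in> chart_dom c \<and> length I = 2 * k
     then symmetrize (2 * k) (tensor_power k (matrix_inv (g c x))) I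
     else 0)"


section \<open>Natural tensors\<close>

text \<open>A smooth morphism \<open>J\<^sup>2M \<rightarrow> S\<^sup>mTX\<close> of bundles over the identity. The coordinates of the jets over a
  chart form an open subset of a linear subspace of \<^typ>\<open>'n jet_coords\<close> (given by the symmetries of
  the components and of the second derivatives); smoothness on this subset is expressed by a smooth
  extension to an open subset of the whole space. This is no restriction, since one can compose with
  a linear projection onto the subspace.\<close>

definition smooth_tensor_morphism ::
  "('x::topological_space, 'n::finite) chart set \<Rightarrow> nat \<Rightarrow> nat \<Rightarrow> nat \<Rightarrow>
     (('x, 'n) jet \<Rightarrow> ('x, 'n) tensor) \<Rightarrow> bool" where
  "smooth_tensor_morphism A p q m T \<longleftrightarrow>
     (\<forall>j\<in>J2M A p q. T j \<in> sym_tensors A m (fst j)) \<and>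
     (\<forall>c\<in>A. \<forall>I. length I = m \<longrightarrow>
        (\<exists>W F. open W \<and> smooth_on W F \<and>
          (\<forall>U g. metric_on A p q U g \<longrightarrow> (\<forall>x\<in>U \<inter> chart_dom c.
             jet_coords c x g \<in> W \<and> T (jet2 A p q x g) c I = F (jet_coords c x g)))))"

definition natural_tensor ::
  "('x::topological_space, 'n::finite) chart set \<Rightarrow> nat \<Rightarrow> nat \<Rightarrow> nat \<Rightarrow>
     (('x, 'n) jet \<Rightarrow> ('x, 'n) tensor) \<Rightarrow> bool" where
  "natural_tensor A p q m T \<longleftrightarrow>
     (\<forall>U V \<tau> W g x. diffeo A U V \<tau> \<and> metric_on A p q W g \<and> x \<in> U \<inter> W \<longrightarrow>
        T (jet2 A p q (\<tau> x) (push_metric A U \<tau> g)) =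
        push_tensor A m \<tau> x (T (jet2 A p q x g)))"


section \<open>Divergence\<close>

text \<open>Christoffel symbols of the Levi-Civita connection, from the components \<open>G\<close> of the metric and their
  partial derivatives \<open>D $ k = \<partial>\<^sub>k G\<close>; \<open>christoffel G D $ i $ j $ k\<close> has upper index \<open>i\<close>.\<close>

definition christoffel :: "real^'n^'n \<Rightarrow> real^'n^'n^'n \<Rightarrow> real^'n^'n^'n" where
  "christoffel G D = (\<chi> i j k. (\<Sum>m\<in>UNIV.
     matrix_inv G $ i $ m * (D $ j $ m $ k + D $ k $ m $ j - D $ m $ j $ k)) / 2)"

text \<open>These are the unique coefficients of a torsion-free connection with parallel metric.\<close>

lemma christoffel_iff:
  fixes G :: "real^'n^'n" and D \<Gamma> :: "real^'n^'n^'n"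
  assumes G: "invertible G" "transpose G = G" and D: "\<And>k. transpose (D $ k) = D $ k"
  shows "\<Gamma> = christoffel G D \<longleftrightarrow>
    (\<forall>i j k. \<Gamma> $ i $ j $ k = \<Gamma> $ i $ k $ j) \<and>
    (\<forall>i j k. D $ k $ i $ j =
       (\<Sum>m\<in>UNIV. \<Gamma> $ m $ k $ i * G $ m $ j) + (\<Sum>m\<in>UNIV. \<Gamma> $ m $ k $ j * G $ i $ m))"
proof -
  have Gs: "G $ i $ j = G $ j $ i" for i j
    using arg_cong[OF G(2), of "\<lambda>M. M $ j $ i"] by (simp add: transpose_def)
  have Ds: "D $ k $ i $ j = D $ k $ j $ i" for i j k
    using arg_cong[OF D[of k], of "\<lambda>M. M $ j $ i"] by (simp add: transpose_def)
  define L where "L \<Gamma> j k = G *v (\<chi> m. \<Gamma> $ m $ j $ k)" for \<Gamma> :: "real^'n^'n^'n" and j k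
  define R where "R j k = (\<chi> m. (D $ j $ m $ k + D $ k $ m $ j - D $ m $ j $ k) / 2)" for j k
  have inv: "matrix_inv G ** G = mat 1" "G ** matrix_inv G = mat 1"
    using someI_ex[OF G(1)[unfolded invertible_def]] by (simp_all add: matrix_inv_def)
  have inj: "v = w \<longleftrightarrow> G *v v = G *v w" for v w :: "real^'n"
  proof
    assume "G *v v = G *v w"
    then have "matrix_inv G *v (G *v v) = matrix_inv G *v (G *v w)" by simp
    then show "v = w" by (simp add: matrix_vector_mul_assoc inv)
  qed simp
  have solve: "v = matrix_inv G *v w \<longleftrightarrow> G *v v = w" for v w :: "real^'n"
    by (subst inj) (simp add: matrix_vector_mul_assoc inv)
  have "\<Gamma> = christoffel G D \<longleftrightarrow> (\<forall>j k. (\<chi> i. \<Gamma> $ i $ j $ k) = matrix_inv G *v R j k)"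
    by (auto simp: christoffel_def R_def vec_eq_iff matrix_vector_mult_def sum_divide_distrib)
  also have "\<dots> \<longleftrightarrow> (\<forall>j k. L \<Gamma> j k = R j k)"
    using solve by (simp add: L_def)
  also have "\<dots> \<longleftrightarrow> (\<forall>i j k. L \<Gamma> j k $ i = (D $ j $ i $ k + D $ k $ i $ j - D $ i $ j $ k) / 2)"
    by (auto simp: vec_eq_iff R_def)
  also have "\<dots> \<longleftrightarrow> (\<forall>i j k. L \<Gamma> j k $ i = L \<Gamma> k j $ i) \<and>
      (\<forall>i j k. D $ k $ i $ j = L \<Gamma> k i $ j + L \<Gamma> k j $ i)" (is "?l \<longleftrightarrow> ?r1 \<and> ?r2")
  proof
    assume ?l
    then have l: "L \<Gamma> j k $ i = (D $ j $ i $ k + D $ k $ i $ j - D $ i $ j $ k) / 2" for i j k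
      by blast
    show "?r1 \<and> ?r2"
    proof (intro conjI allI)
      fix i j k
      show "L \<Gamma> j k $ i = L \<Gamma> k j $ i"
        using Ds[of i j k] by (simp add: l)
      show "D $ k $ i $ j = L \<Gamma> k i $ j + L \<Gamma> k j $ i"
        using Ds[of k i j] Ds[of i k j] Ds[of j i k] by (simp add: l field_simps)
    qed
  next
    assume r: "?r1 \<and> ?r2"
    show ?l
    proof (intro allI)
      fix i j k
      show "L \<Gamma> j k $ i = (D $ j $ i $ k + D $ k $ i $ j - D $ i $ j $ k) / 2"
        using r[THEN conjunct2, rule_format, of j i k] r[THEN conjunct2, rule_format, of k i j]
          r[THEN conjunct2, rule_format, of i j k] r[THEN conjunct1, rule_format, of j k i]
          r[THEN conjunct1, rule_format, of j i k] r[THEN conjunct1, rule_format, of k i j]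
        by simp
    qed
  qed
  also have "?r1 \<longleftrightarrow> (\<forall>i j k. \<Gamma> $ i $ j $ k = \<Gamma> $ i $ k $ j)"
  proof -
    have "?r1 \<longleftrightarrow> (\<forall>j k. L \<Gamma> j k = L \<Gamma> k j)" by (auto simp: vec_eq_iff)
    also have "\<dots> \<longleftrightarrow> (\<forall>j k. (\<chi> m. \<Gamma> $ m $ j $ k) = (\<chi> m. \<Gamma> $ m $ k $ j))"
      by (simp add: L_def flip: inj)
    also have "\<dots> \<longleftrightarrow> (\<forall>i j k. \<Gamma> $ i $ j $ k = \<Gamma> $ i $ k $ j)"
      by (auto simp: vec_eq_iff)
    finally show ?thesis .
  qed
  finally show ?thesis
    by (simp add: L_def matrix_vector_mult_def mult.commute Gs)
qed

text \<open>\<open>tensor_comp A p q T g c I\<close> is the component of the tensor field \<open>T(g)\<close> with indices \<open>I\<close>, in the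
  coordinates of \<open>c\<close>, and \<open>cov_deriv \<dots> l I\<close> is \<open>\<nabla>\<^sub>l T(g)\<^sup>I\<close>.\<close>

definition tensor_comp ::
  "('x::topological_space, 'n::finite) chart set \<Rightarrow> nat \<Rightarrow> nat \<Rightarrow>
     (('x, 'n) jet \<Rightarrow> ('x, 'n) tensor) \<Rightarrow> ('x, 'n) metric \<Rightarrow> ('x, 'n) chart \<Rightarrow> 'n list \<Rightarrow>
     real^'n \<Rightarrow> real" where
  "tensor_comp A p q T g c I = (\<lambda>y. T (jet2 A p q (chart_inv c y) g) c I)"

definition cov_deriv ::
  "('x::topological_space, 'n::finite) chart set \<Rightarrow> nat \<Rightarrow> nat \<Rightarrow>
     (('x, 'n) jet \<Rightarrow> ('x, 'n) tensor) \<Rightarrow> ('x, 'n) metric \<Rightarrow> ('x, 'n) chart \<Rightarrow>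
     'n \<Rightarrow> 'n list \<Rightarrow> real^'n \<Rightarrow> real" where
  "cov_deriv A p q T g c l I y =
     (let \<Gamma> = christoffel (metric_comp c g y) (\<chi> k. partial k (metric_comp c g) y)
      in partial l (tensor_comp A p q T g c I) y +
         (\<Sum>a<length I. \<Sum>m\<in>UNIV. \<Gamma> $ (I ! a) $ l $ m * tensor_comp A p q T g c (I[a := m]) y))"

definition divergence ::
  "('x::topological_space, 'n::finite) chart set \<Rightarrow> nat \<Rightarrow> nat \<Rightarrow>
     (('x, 'n) jet \<Rightarrow> ('x, 'n) tensor) \<Rightarrow> ('x, 'n) metric \<Rightarrow> ('x, 'n) chart \<Rightarrow>
     'n list \<Rightarrow> real^'n \<Rightarrow> real" where
  "divergence A p q T g c J y = (\<Sum>l\<in>UNIV. cov_deriv A p q T g c l (J @ [l]) y)"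

definition divergence_free ::
  "('x::topological_space, 'n::finite) chart set \<Rightarrow> nat \<Rightarrow> nat \<Rightarrow> nat \<Rightarrow>
     (('x, 'n) jet \<Rightarrow> ('x, 'n) tensor) \<Rightarrow> bool" where
  "divergence_free A p q m T \<longleftrightarrow>
     (\<forall>U g. metric_on A p q U g \<longrightarrow> (\<forall>c\<in>A. \<forall>x\<in>U \<inter> chart_dom c. \<forall>J. length J = m - 1 \<longrightarrow>
        divergence A p q T g c J (coord c x) = 0))"

end

theory Submission
  imports Defs
begin

text \<open>In the coordinates of a chart, a component of \<open>T(g)\<close> is a function \<open>F\<^sub>I\<close> of the 2-jet of the matrix \<open>G\<close>
  of \<open>g\<close>, and every symmetric polynomial perturbation of \<open>G\<close> vanishing at a point is again a metric
  near that point. Adding a cubic polynomial to \<open>G\<close> changes only the third derivatives, hence the vanishing of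
  the divergence forces \<open>f(J a; b c) + f(J b; a c) + f(J c; a b) = 0\<close>, where \<open>f(I; b c)\<close> is the derivative of
  \<open>F\<^sub>I\<close> along \<open>\<partial>\<^sub>b \<partial>\<^sub>c G\<close>. As \<open>f\<close> is symmetric in \<open>I\<close> and \<open>I\<close> has at least three indices, \<open>f = 0\<close>, so
  \<open>F\<^sub>I\<close> does not depend on the second derivatives. Adding a quadratic polynomial then gives
  \<open>f(J a; b) + f(J b; a) = 0\<close> for the derivatives along \<open>\<partial>\<^sub>b G\<close>, so \<open>F\<^sub>I\<close> does not depend on the first derivatives
  either. Therefore \<open>T(g)\<close> at a point is determined by the value of \<open>g\<close> there. By naturality under
  local diffeomorphisms that are affine in charts, this value is a symmetric tensor invariant under the
  orthogonal group of \<open>g\<close>, i.e. a multiple of \<open>S\<^bsub>2k\<^esub>\<close>, and the factor is the same at all points.\<close>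

section \<open>Calculus of smooth functions\<close>

text \<open>Order three is where the argument starts to work, and \<open>k \<ge> 2\<close> enters as
  \<open>2 * k \<ge> 3\<close>: for order two the first linear system has nonzero solutions, and in
  dimension at least 3 the Einstein tensor realises one. The obstacle throughout is that
  \<open>F I\<close> is controlled only at jets of genuine metrics; its extension off them is
  arbitrary and its domain \<open>W I\<close> need not be convex. Derivatives are therefore usable
  only along lines of jets each of which is realised by a metric. Perturbations vanishing at the
  point provide such lines for every real parameter, because the matrix at the point, hence its
  signature, stays fixed. For the same reason second derivatives cannot just be dropped from the
  argument of \<open>F I\<close>: they are set to 0, which is the jet of a metric affine in the
  chart. Once only the value matters, a metric may be replaced by one with constant matrix in a
  chart. Such metrics are carried to each other by affine maps between charts, and symmetric tensors
  are compared as polynomials in a covector.\<close>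

lemma Ck_on_has_derivative:
  "Ck_on (Suc k) S f \<Longrightarrow> x \<in> S \<Longrightarrow> (f has_derivative frechet_derivative f (at x)) (at x)"
  by (simp add: frechet_derivative_works)

lemma Ck_on_imp_continuous_on: "Ck_on k S f \<Longrightarrow> continuous_on S f"
  by (cases k) (auto intro!: continuous_at_imp_continuous_on differentiable_imp_continuous_within)

lemma Ck_on_SucD: "Ck_on (Suc k) S f \<Longrightarrow> Ck_on k S f"
proof (induction k arbitrary: f)
  case 0
  then show ?case unfolding Ck_on.simps(1) by (rule Ck_on_imp_continuous_on)
next
  case (Suc k)
  have "Ck_on k S (\<lambda>x. frechet_derivative f (at x) v)" for v
    using Suc.prems by (intro Suc.IH) simp
  with Suc.prems show ?case by simp
qed

lemma Ck_on_subset: "Ck_on k S f \<Longrightarrow> S' \<subseteq> S \<Longrightarrow> Ck_on k S' f"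
  by (induction k arbitrary: f) (auto intro: continuous_on_subset)

text \<open>\<open>frechet_derivative\<close> at a point sees a whole neighbourhood, so openness of
  \<open>S\<close> is what makes the values on \<open>S\<close> decide.\<close>

lemma Ck_on_cong:
  assumes "open S" "\<And>x. x \<in> S \<Longrightarrow> f x = g x" "Ck_on k S f"
  shows "Ck_on k S g"
  using assms(2,3)
proof (induction k arbitrary: f g)
  case 0
  then show ?case by (simp cong: continuous_on_cong)
next
  case (Suc k)
  have d: "(g has_derivative frechet_derivative f (at x)) (at x)" if "x \<in> S" for x
    using has_derivative_transform_within_open[OF Ck_on_has_derivative[OF Suc.prems(2) that] \<open>open S\<close> that] Suc.prems(1)
    by blast
  then have e: "frechet_derivative g (at x) = frechet_derivative f (at x)" if "x \<in> S" for x
    using frechet_derivative_at[OF d[OF that]] by simp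
  have "Ck_on k S (\<lambda>x. frechet_derivative g (at x) v)" for v
    by (rule Suc.IH[of "\<lambda>x. frechet_derivative f (at x) v"]) (use Suc.prems(2) in \<open>simp_all add: e\<close>)
  with d show ?case by (auto simp: differentiable_def)
qed

text \<open>\<open>Ck_on\<close> speaks of the chosen \<open>frechet_derivative\<close>; uniqueness
  of derivatives lets an explicit formula take its place.\<close>

lemma Ck_on_SucI:
  assumes "open S" "\<And>x. x \<in> S \<Longrightarrow> (f has_derivative f' x) (at x)" "\<And>v. Ck_on k S (\<lambda>x. f' x v)"
  shows "Ck_on (Suc k) S f"
proof -
  have "f' x = frechet_derivative f (at x)" if "x \<in> S" for x
    using assms(2)[OF that] by (rule frechet_derivative_at)
  then have "Ck_on k S (\<lambda>x. frechet_derivative f (at x) v)" for v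
    using Ck_on_cong[OF assms(1) _ assms(3)[of v]] by simp
  with assms(2) show ?thesis by (auto simp: differentiable_def)
qed

lemma Ck_on_const: "open S \<Longrightarrow> Ck_on k S (\<lambda>x. c)"
proof (induction k arbitrary: c)
  case (Suc k)
  show ?case
    by (rule Ck_on_SucI[where f' = "\<lambda>_ _. 0"]) (use Suc in simp_all)
qed simp

lemma Ck_on_bounded_linear:
  assumes "open S" "bounded_linear L" "Ck_on k S f"
  shows "Ck_on k S (\<lambda>x. L (f x))"
  using assms(3)
proof (induction k arbitrary: f)
  case 0
  then show ?case using bounded_linear.continuous_on[OF assms(2)] by auto
next
  case (Suc k)
  then show ?case
    by (intro Ck_on_SucI[where f' = "\<lambda>x v. L (frechet_derivative f (at x) v)", OF assms(1)])
      (auto intro: bounded_linear.has_derivative[OF assms(2)] simp: frechet_derivative_works)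
qed

lemma Ck_on_ident: "open S \<Longrightarrow> Ck_on k S (\<lambda>x. x)"
proof (cases k)
  case (Suc n)
  assume "open S"
  then show ?thesis unfolding Suc
    by (rule Ck_on_SucI[where f' = "\<lambda>_ v. v"]) (simp_all add: Ck_on_const \<open>open S\<close>)
qed simp

lemma Ck_on_add:
  assumes "open S" "Ck_on k S f" "Ck_on k S g"
  shows "Ck_on k S (\<lambda>x. f x + g x)"
  using assms(2,3)
proof (induction k arbitrary: f g)
  case 0
  then show ?case by (auto intro: continuous_intros)
next
  case (Suc k)
  have 1: "Ck_on k S (\<lambda>x. frechet_derivative f (at x) v + frechet_derivative g (at x) v)" for v
    using Suc.prems by (intro Suc.IH) auto
  show ?case
    by (rule Ck_on_SucI[OF assms(1), where
          f' = "\<lambda>x v. frechet_derivative f (at x) v + frechet_derivative g (at x) v", OF _ 1])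
      (intro has_derivative_add Ck_on_has_derivative[OF Suc.prems(1)]
        Ck_on_has_derivative[OF Suc.prems(2)])
qed

lemma Ck_on_sum:
  assumes "open S" "\<And>i. i \<in> I \<Longrightarrow> Ck_on k S (f i)"
  shows "Ck_on k S (\<lambda>x. \<Sum>i\<in>I. f i x)"
  using assms(2) by (induction I rule: infinite_finite_induct)
    (auto intro: Ck_on_const Ck_on_add assms(1))

lemma Ck_on_bilinear:
  assumes "open S" "bounded_bilinear h" "Ck_on k S f" "Ck_on k S g"
  shows "Ck_on k S (\<lambda>x. h (f x) (g x))"
  using assms(3,4)
proof (induction k arbitrary: f g)
  case 0
  then show ?case using bounded_bilinear.continuous_on[OF assms(2)] by auto
next
  case (Suc k)
  have 1: "Ck_on k S (\<lambda>x. h (f x) (frechet_derivative g (at x) v) +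
    h (frechet_derivative f (at x) v) (g x))" for v
    using Suc.prems Suc.prems[THEN Ck_on_SucD] by (intro Ck_on_add[OF assms(1)] Suc.IH) auto
  show ?case
    by (rule Ck_on_SucI[OF assms(1), where
          f' = "\<lambda>x v. h (f x) (frechet_derivative g (at x) v) +
            h (frechet_derivative f (at x) v) (g x)", OF _ 1])
      (intro bounded_bilinear.FDERIV[OF assms(2)] Ck_on_has_derivative[OF Suc.prems(1)]
        Ck_on_has_derivative[OF Suc.prems(2)])
qed

text \<open>The induction hypothesis handles derivatives of \<open>f\<close> in fixed directions,
  but the chain rule feeds the moving vector Dg(x)v into Df. Expanding that vector in
  \<open>Basis\<close> gives a sum of products with fixed directions, whence the Euclidean space in
  the middle.\<close>

lemma Ck_on_compose:
  fixes g :: "'a::real_normed_vector \<Rightarrow> 'b::euclidean_space" and f :: "'b \<Rightarrow> 'c::real_normed_vector"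
  assumes "open S" "g ` S \<subseteq> T" "Ck_on k S g" "Ck_on k T f"
  shows "Ck_on k S (\<lambda>x. f (g x))"
  using assms(3,4)
proof (induction k arbitrary: f)
  case 0
  then show ?case using continuous_on_compose2[of T f S g] assms(2) by auto
next
  case (Suc k)
  have 1: "Ck_on k S (\<lambda>x. \<Sum>b\<in>Basis. (frechet_derivative g (at x) v \<bullet> b) *\<^sub>R
      frechet_derivative f (at (g x)) b)" for v
    using Suc.prems Suc.prems(1)[THEN Ck_on_SucD]
    by (intro Ck_on_sum[OF assms(1)] Ck_on_bilinear[OF assms(1) bounded_bilinear_scaleR]
        Ck_on_bounded_linear[OF assms(1) bounded_linear_inner_left] Suc.IH) auto
  show ?case
  proof (rule Ck_on_SucI[OF assms(1) _ 1])
    fix x assume x: "x \<in> S"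
    then have f: "(f has_derivative frechet_derivative f (at (g x))) (at (g x))"
      using Ck_on_has_derivative[OF Suc.prems(2)] assms(2) by blast
    then interpret linear "frechet_derivative f (at (g x))"
      by (rule has_derivative_linear)
    have "(\<lambda>v. \<Sum>b\<in>Basis. (frechet_derivative g (at x) v \<bullet> b) *\<^sub>R frechet_derivative f (at (g x)) b) =
      (\<lambda>v. frechet_derivative f (at (g x)) (frechet_derivative g (at x) v))"
      by (subst (3) euclidean_representation[symmetric]) (simp add: sum scale)
    with has_derivative_compose[OF Ck_on_has_derivative[OF Suc.prems(1) x] f]
    show "((\<lambda>x. f (g x)) has_derivative (\<lambda>v. \<Sum>b\<in>Basis. (frechet_derivative g (at x) v \<bullet> b) *\<^sub>R
      frechet_derivative f (at (g x)) b)) (at x)" by simp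
  qed
qed

lemma smooth_on_has_derivative:
  "smooth_on S f \<Longrightarrow> x \<in> S \<Longrightarrow> (f has_derivative frechet_derivative f (at x)) (at x)"
  unfolding smooth_on_def using Ck_on_has_derivative by blast

lemma smooth_on_continuous_on: "smooth_on S f \<Longrightarrow> continuous_on S f"
  unfolding smooth_on_def using Ck_on_imp_continuous_on by blast

lemma smooth_on_frechet_derivative:
  "smooth_on S f \<Longrightarrow> smooth_on S (\<lambda>x. frechet_derivative f (at x) v)"
  unfolding smooth_on_def by (metis Ck_on.simps(2))

lemma smooth_on_partial: "smooth_on S f \<Longrightarrow> smooth_on S (partial k f)"
  using smooth_on_frechet_derivative[of S f "axis k 1"] by (simp add: partial_def[abs_def])

lemma smooth_on_subset: "smooth_on S f \<Longrightarrow> S' \<subseteq> S \<Longrightarrow> smooth_on S' f"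
  unfolding smooth_on_def using Ck_on_subset by blast

lemma smooth_on_cong:
  "smooth_on S f \<Longrightarrow> open S \<Longrightarrow> (\<And>x. x \<in> S \<Longrightarrow> f x = g x) \<Longrightarrow> smooth_on S g"
  unfolding smooth_on_def using Ck_on_cong by blast

lemma smooth_on_const: "open S \<Longrightarrow> smooth_on S (\<lambda>x. c)"
  by (simp add: smooth_on_def Ck_on_const)

lemma smooth_on_ident: "open S \<Longrightarrow> smooth_on S (\<lambda>x. x)"
  by (simp add: smooth_on_def Ck_on_ident)

lemma smooth_on_bounded_linear:
  "open S \<Longrightarrow> bounded_linear L \<Longrightarrow> smooth_on S f \<Longrightarrow> smooth_on S (\<lambda>x. L (f x))"
  by (simp add: smooth_on_def Ck_on_bounded_linear)

lemma smooth_on_add: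
  "open S \<Longrightarrow> smooth_on S f \<Longrightarrow> smooth_on S g \<Longrightarrow> smooth_on S (\<lambda>x. f x + g x)"
  by (simp add: smooth_on_def Ck_on_add)

lemma smooth_on_sum:
  "open S \<Longrightarrow> (\<And>i. i \<in> I \<Longrightarrow> smooth_on S (f i)) \<Longrightarrow> smooth_on S (\<lambda>x. \<Sum>i\<in>I. f i x)"
  by (simp add: smooth_on_def Ck_on_sum)

lemma smooth_on_bilinear:
  "open S \<Longrightarrow> bounded_bilinear h \<Longrightarrow> smooth_on S f \<Longrightarrow> smooth_on S g \<Longrightarrow>
    smooth_on S (\<lambda>x. h (f x) (g x))"
  by (simp add: smooth_on_def Ck_on_bilinear)

lemma smooth_on_compose:
  fixes g :: "'a::real_normed_vector \<Rightarrow> 'b::euclidean_space" and f :: "'b \<Rightarrow> 'c::real_normed_vector"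
  shows "open S \<Longrightarrow> g ` S \<subseteq> T \<Longrightarrow> smooth_on S g \<Longrightarrow> smooth_on T f \<Longrightarrow>
    smooth_on S (\<lambda>x. f (g x))"
  by (simp add: smooth_on_def Ck_on_compose)

lemma smooth_on_scaleR:
  "open S \<Longrightarrow> smooth_on S f \<Longrightarrow> smooth_on S g \<Longrightarrow> smooth_on S (\<lambda>x. f x *\<^sub>R g x)"
  by (rule smooth_on_bilinear[OF _ bounded_bilinear_scaleR])

lemma smooth_on_mult:
  fixes f g :: "_ \<Rightarrow> real"
  shows "open S \<Longrightarrow> smooth_on S f \<Longrightarrow> smooth_on S g \<Longrightarrow> smooth_on S (\<lambda>x. f x * g x)"
  by (rule smooth_on_bilinear[OF _ bounded_bilinear_mult])

lemma smooth_on_vec_nth: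
  "open S \<Longrightarrow> smooth_on S f \<Longrightarrow> smooth_on S (\<lambda>x. f x $ i)"
  by (rule smooth_on_bounded_linear[OF _ bounded_linear_vec_nth])

lemma bounded_linear_axis: "bounded_linear (axis i :: 'b::euclidean_space \<Rightarrow> 'b^'n::finite)"
  by (rule linear_conv_bounded_linear[THEN iffD1])
    (auto intro!: linearI simp: vec_eq_iff axis_def)

lemma smooth_on_vec_lambda:
  fixes f :: "'a::real_normed_vector \<Rightarrow> 'b::euclidean_space^'n::finite"
  assumes "open S" "\<And>i. smooth_on S (\<lambda>x. f x $ i)"
  shows "smooth_on S f"
proof -
  have "smooth_on S (\<lambda>x. \<Sum>i\<in>UNIV. axis i (f x $ i))"
    by (intro smooth_on_sum smooth_on_bounded_linear[OF _ bounded_linear_axis] assms)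
  also have "(\<lambda>x. \<Sum>i\<in>UNIV. axis i (f x $ i)) = f"
    by (auto simp: vec_eq_iff axis_def if_distrib cong: if_cong)
  finally show ?thesis .
qed

lemma smooth_on_jacobian:
  fixes f :: "real^'n::finite \<Rightarrow> real^'m::finite"
  assumes "open S" "smooth_on S f"
  shows "smooth_on S (\<lambda>y. jacobian f (at y))"
  by (intro smooth_on_vec_lambda assms(1))
    (simp add: jacobian_def matrix_def smooth_on_vec_nth[OF assms(1)] smooth_on_frechet_derivative[OF assms(2)])

lemma bounded_bilinear_matrix_mult:
  "bounded_bilinear ((**) :: real^'n::finite^'m::finite \<Rightarrow> real^'k::finite^'n \<Rightarrow> real^'k^'m)"
  unfolding bilinear_conv_bounded_bilinear[symmetric] bilinear_def
  by (auto intro!: linearI simp: matrix_matrix_mult_def vec_eq_iff algebra_simps sum.distrib sum_distrib_left)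

lemma linear_transpose: "linear (transpose :: real^'n::finite^'m::finite \<Rightarrow> real^'m^'n)"
  by (auto intro!: linearI simp: transpose_def vec_eq_iff)

lemma bounded_linear_transpose: "bounded_linear (transpose :: real^'n::finite^'m::finite \<Rightarrow> real^'m^'n)"
  using linear_transpose by (simp add: linear_conv_bounded_linear)

section \<open>Symmetry of second derivatives\<close>

text \<open>The mean value theorem is applied twice: to the difference along \<open>v\<close> as a
  function of the step along \<open>u\<close>, then to the resulting derivative along
  \<open>v\<close>. The second difference is symmetric in \<open>u\<close> and \<open>v\<close>, the
  right-hand side is not visibly so.\<close>

lemma second_difference_mvt:
  fixes f :: "'a::real_normed_vector \<Rightarrow> real"
  assumes f: "smooth_on S f" and s: "s > 0"
    and S: "\<And>a b. 0 \<le> a \<Longrightarrow> a \<le> s \<Longrightarrow> 0 \<le> b \<Longrightarrow> b \<le> s \<Longrightarrow> x + a *\<^sub>R u + b *\<^sub>R v \<in> S"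
  obtains a b where "0 < a" "a < s" "0 < b" "b < s"
    "f (x + s *\<^sub>R u + s *\<^sub>R v) - f (x + s *\<^sub>R u) - f (x + s *\<^sub>R v) + f x =
      s * s * frechet_derivative (\<lambda>y. frechet_derivative f (at y) u) (at (x + a *\<^sub>R u + b *\<^sub>R v)) v"
proof -
  have line: "((\<lambda>a. h (y + a *\<^sub>R w)) has_real_derivative frechet_derivative h (at (y + a *\<^sub>R w)) w) (at a)"
    if "smooth_on S h" "y + a *\<^sub>R w \<in> S" for h :: "'a \<Rightarrow> real" and y w a
  proof -
    have h: "(h has_derivative frechet_derivative h (at (y + a *\<^sub>R w))) (at (y + a *\<^sub>R w))"
      using smooth_on_has_derivative[OF that] .
    have "((\<lambda>a. y + a *\<^sub>R w) has_derivative (\<lambda>t. t *\<^sub>R w)) (at a)"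
      by (auto intro!: derivative_eq_intros)
    from has_derivative_compose[OF this h]
    show ?thesis
      using linear_scale[OF has_derivative_linear[OF h]]
      by (simp add: has_field_derivative_def mult.commute mult_commute_abs)
  qed
  define D where "D = (\<lambda>y. frechet_derivative f (at y) u)"
  have D: "smooth_on S D"
    unfolding D_def by (rule smooth_on_frechet_derivative[OF f])
  have "((\<lambda>a. f ((x + s *\<^sub>R v) + a *\<^sub>R u) - f (x + a *\<^sub>R u)) has_real_derivative
      D ((x + s *\<^sub>R v) + a *\<^sub>R u) - D (x + a *\<^sub>R u)) (at a)" if "0 \<le> a" "a \<le> s" for a
    unfolding D_def using S[OF that, of s] S[OF that, of 0] s
    by (intro DERIV_diff line[OF f]) (auto simp: algebra_simps)
  from MVT2[OF s this] obtain a where a: "0 < a" "a < s"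
    "(f ((x + s *\<^sub>R v) + s *\<^sub>R u) - f (x + s *\<^sub>R u)) - (f ((x + s *\<^sub>R v) + 0 *\<^sub>R u) - f (x + 0 *\<^sub>R u)) =
      (s - 0) * (D ((x + s *\<^sub>R v) + a *\<^sub>R u) - D (x + a *\<^sub>R u))" by blast
  have "((\<lambda>b. D ((x + a *\<^sub>R u) + b *\<^sub>R v)) has_real_derivative
      frechet_derivative D (at ((x + a *\<^sub>R u) + b *\<^sub>R v)) v) (at b)" if "0 \<le> b" "b \<le> s" for b
    using S[of a b] that a by (intro line[OF D]) auto
  from MVT2[OF s this] obtain b where b: "0 < b" "b < s"
    "D ((x + a *\<^sub>R u) + s *\<^sub>R v) - D ((x + a *\<^sub>R u) + 0 *\<^sub>R v) =
      (s - 0) * frechet_derivative D (at ((x + a *\<^sub>R u) + b *\<^sub>R v)) v" by blast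
  show ?thesis
  proof (rule that[OF a(1,2) b(1,2)])
    have "f (x + s *\<^sub>R u + s *\<^sub>R v) - f (x + s *\<^sub>R u) - f (x + s *\<^sub>R v) + f x =
      s * (D ((x + a *\<^sub>R u) + s *\<^sub>R v) - D (x + a *\<^sub>R u))"
      using a(3) by (simp add: algebra_simps)
    then show "f (x + s *\<^sub>R u + s *\<^sub>R v) - f (x + s *\<^sub>R u) - f (x + s *\<^sub>R v) + f x =
      s * s * frechet_derivative (\<lambda>y. frechet_derivative f (at y) u) (at (x + a *\<^sub>R u + b *\<^sub>R v)) v"
      using b(3) by (simp add: D_def)
  qed
qed

text \<open>The two mixed derivatives, taken at two points of a small parallelogram, equal the same
  second difference divided by \<open>s * s\<close>; continuity rules out different values at
  \<open>x\<close>.\<close>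

lemma smooth_on_second_derivative_sym_real:
  fixes f :: "'a::real_normed_vector \<Rightarrow> real"
  assumes f: "smooth_on S f" and S: "open S" "x \<in> S"
  shows "frechet_derivative (\<lambda>y. frechet_derivative f (at y) u) (at x) v =
    frechet_derivative (\<lambda>y. frechet_derivative f (at y) v) (at x) u"
    (is "?A x = ?B x")
proof (rule ccontr)
  assume ne: "?A x \<noteq> ?B x"
  define e where "e = \<bar>?A x - ?B x\<bar> / 2"
  have e: "e > 0" using ne by (simp add: e_def)
  have cont: "continuous_on S ?A" "continuous_on S ?B"
    by (intro smooth_on_continuous_on smooth_on_frechet_derivative f)+
  obtain r0 where r0: "r0 > 0" "ball x r0 \<subseteq> S"
    using S openE by blast
  obtain r1 where r1: "r1 > 0" "\<And>y. y \<in> S \<Longrightarrow> dist y x < r1 \<Longrightarrow> dist (?A y) (?A x) < e"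
    using cont(1) S(2) e unfolding continuous_on_iff by meson
  obtain r2 where r2: "r2 > 0" "\<And>y. y \<in> S \<Longrightarrow> dist y x < r2 \<Longrightarrow> dist (?B y) (?B x) < e"
    using cont(2) S(2) e unfolding continuous_on_iff by meson
  define r where "r = min r0 (min r1 r2)"
  \<comment> \<open>This size keeps the parallelogram within distance \<open>r\<close> of
    \<open>x\<close>; the summand 1 covers \<open>u = v = 0\<close>.\<close>
  define s where "s = r / (norm u + norm v + 1)"
  have r: "r > 0" using r0 r1 r2 by (simp add: r_def)
  have s: "s > 0" using r by (simp add: s_def add_nonneg_pos)
  have near: "dist (x + a *\<^sub>R u + b *\<^sub>R v) x < r" if "0 \<le> a" "a \<le> s" "0 \<le> b" "b \<le> s" for a b
  proof -
    have "dist (x + a *\<^sub>R u + b *\<^sub>R v) x = norm (a *\<^sub>R u + b *\<^sub>R v)" by (simp add: dist_norm add.assoc)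
    also have "\<dots> \<le> a * norm u + b * norm v"
      using norm_triangle_ineq[of "a *\<^sub>R u" "b *\<^sub>R v"] that by simp
    also have "\<dots> \<le> s * norm u + s * norm v"
      using that by (intro add_mono mult_right_mono) auto
    also have "\<dots> < s * (norm u + norm v + 1)" using s by (simp add: algebra_simps)
    also have "\<dots> = r"
      unfolding s_def using add_nonneg_pos[of "norm u + norm v" 1] by simp
    finally show ?thesis .
  qed
  then have inS: "x + a *\<^sub>R u + b *\<^sub>R v \<in> S" if "0 \<le> a" "a \<le> s" "0 \<le> b" "b \<le> s" for a b
    using r0 that by (force simp: r_def dist_commute)
  obtain a b where ab: "0 < a" "a < s" "0 < b" "b < s"
    "f (x + s *\<^sub>R u + s *\<^sub>R v) - f (x + s *\<^sub>R u) - f (x + s *\<^sub>R v) + f x =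
      s * s * ?A (x + a *\<^sub>R u + b *\<^sub>R v)"
    using second_difference_mvt[OF f s inS] by blast
  have inS': "x + a *\<^sub>R v + b *\<^sub>R u \<in> S" if "0 \<le> a" "a \<le> s" "0 \<le> b" "b \<le> s" for a b
    using inS[OF that(3,4,1,2)] by (simp add: algebra_simps)
  obtain a' b' where ab': "0 < a'" "a' < s" "0 < b'" "b' < s"
    "f (x + s *\<^sub>R v + s *\<^sub>R u) - f (x + s *\<^sub>R v) - f (x + s *\<^sub>R u) + f x =
      s * s * ?B (x + a' *\<^sub>R v + b' *\<^sub>R u)"
    using second_difference_mvt[OF f s inS'] by blast
  have swap: "x + a' *\<^sub>R v + b' *\<^sub>R u = x + b' *\<^sub>R u + a' *\<^sub>R v"
    "x + s *\<^sub>R v + s *\<^sub>R u = x + s *\<^sub>R u + s *\<^sub>R v" by (simp_all add: algebra_simps)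
  have "s * s * ?A (x + a *\<^sub>R u + b *\<^sub>R v) = s * s * ?B (x + b' *\<^sub>R u + a' *\<^sub>R v)"
    using ab(5) ab'(5) unfolding swap by linarith
  then have "?A (x + a *\<^sub>R u + b *\<^sub>R v) = ?B (x + b' *\<^sub>R u + a' *\<^sub>R v)"
    using s by simp
  moreover have "dist (?A (x + a *\<^sub>R u + b *\<^sub>R v)) (?A x) < e"
    using ab near[of a b] by (intro r1(2) inS) (auto simp: r_def)
  moreover have "dist (?B (x + b' *\<^sub>R u + a' *\<^sub>R v)) (?B x) < e"
    using ab' near[of b' a'] by (intro r2(2) inS) (auto simp: r_def)
  ultimately show False
    by (simp add: e_def dist_real_def field_simps abs_if split: if_splits)
qed

lemma frechet_derivative_bounded_linear:
  assumes "bounded_linear L" "f differentiable (at x)"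
  shows "frechet_derivative (\<lambda>y. L (f y)) (at x) v = L (frechet_derivative f (at x) v)"
  using frechet_derivative_at[OF bounded_linear.has_derivative[OF assms(1)
      assms(2)[unfolded frechet_derivative_works]]] by metis

lemma partial_bounded_linear:
  assumes "bounded_linear L" "f differentiable (at x)"
  shows "partial k (\<lambda>y. L (f y)) x = L (partial k f x)"
  unfolding partial_def by (rule frechet_derivative_bounded_linear[OF assms])

lemma smooth_on_differentiable: "smooth_on S f \<Longrightarrow> x \<in> S \<Longrightarrow> f differentiable (at x)"
  using smooth_on_has_derivative differentiable_def by blast

lemma partial_cong_open:
  assumes "open S" "x \<in> S" "\<And>y. y \<in> S \<Longrightarrow> f y = g y"
  shows "partial k f x = partial k g x"
proof -
  have "(f has_derivative D) (at x) \<longleftrightarrow> (g has_derivative D) (at x)" for D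
    using has_derivative_transform_within_open[OF _ assms(1,2)] assms(3) by metis
  then show ?thesis by (simp add: partial_def frechet_derivative_def)
qed

lemma partial_partial_bounded_linear:
  assumes "bounded_linear L" "open S" "smooth_on S f" "x \<in> S"
  shows "partial k (partial l (\<lambda>y. L (f y))) x = L (partial k (partial l f) x)"
proof -
  have "partial k (partial l (\<lambda>y. L (f y))) x = partial k (\<lambda>y. L (partial l f y)) x"
    by (intro partial_cong_open[OF assms(2,4)]
        partial_bounded_linear[OF assms(1)] smooth_on_differentiable[OF assms(3)])
  also have "\<dots> = L (partial k (partial l f) x)"
    by (intro partial_bounded_linear assms(1) smooth_on_differentiable[OF smooth_on_partial[OF assms(3)] assms(4)])
  finally show ?thesis .
qed

lemma partial_commute:
  fixes f :: "real^'n::finite \<Rightarrow> 'b::euclidean_space"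
  assumes "open S" "smooth_on S f" "x \<in> S"
  shows "partial k (partial l f) x = partial l (partial k f) x"
proof (rule euclidean_eqI)
  fix b :: 'b
  have i: "bounded_linear (\<lambda>y::'b. y \<bullet> b)" by (rule bounded_linear_inner_left)
  have s: "smooth_on S (\<lambda>y. f y \<bullet> b)"
    by (rule smooth_on_bounded_linear[OF assms(1) i assms(2)])
  have "partial k (partial l (\<lambda>y. f y \<bullet> b)) x = partial l (partial k (\<lambda>y. f y \<bullet> b)) x"
    unfolding partial_def using smooth_on_second_derivative_sym_real[OF s assms(1,3)] .
  then show "partial k (partial l f) x \<bullet> b = partial l (partial k f) x \<bullet> b"
    unfolding partial_partial_bounded_linear[OF i assms] .
qed

section \<open>Openness of the signature\<close>

lemma matrix_inv_mult:
  fixes G :: "real^'n::finite^'n"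
  assumes "invertible G"
  shows "matrix_inv G ** G = mat 1" "G ** matrix_inv G = mat 1"
  using someI_ex[OF assms[unfolded invertible_def]] by (simp_all add: matrix_inv_def)

lemma invertible_matrix_inv: "invertible G \<Longrightarrow> invertible (matrix_inv (G :: real^'n::finite^'n))"
  using matrix_inv_mult invertible_def by blast

lemma matrix_inv_unique:
  fixes G :: "real^'n::finite^'n"
  assumes "G ** K = mat 1"
  shows "matrix_inv G = K"
  by (metis assms invertible_right_inverse matrix_inv_mult(1) matrix_mul_assoc matrix_mul_lid matrix_mul_rid)

lemma invertible_transpose: "invertible (G :: real^'n::finite^'n) \<Longrightarrow> invertible (transpose G)"
  by (simp add: invertible_det_nz)

lemma transpose_matrix_inv:
  fixes G :: "real^'n::finite^'n"
  assumes "invertible G"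
  shows "transpose (matrix_inv G) = matrix_inv (transpose G)"
  by (metis assms matrix_inv_mult(1) matrix_inv_unique matrix_transpose_mul transpose_mat)

text \<open>The orthonormal basis is carried along by \<open>matrix_inv Q\<close>, with the same
  signs \<open>e\<close>.\<close>

lemma has_signature_congruent:
  assumes "has_signature p q (G :: real^'n::finite^'n)" "invertible (Q :: real^'n^'n)"
  shows "has_signature p q (transpose Q ** G ** Q)"
proof -
  obtain P :: "real^'n^'n" and e where P: "invertible P"
    "transpose P ** G ** P = (\<chi> i j. if i = j then e i else 0)"
    "\<forall>i. e i = 1 \<or> e i = -1" "card {i. e i = 1} = p" "card {i. e i = -1} = q"
    using assms(1) unfolding has_signature_def by blast
  let ?R = "matrix_inv Q ** P"
  have Q: "Q ** matrix_inv Q = mat 1" using matrix_inv_mult[OF assms(2)] by simp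
  have "transpose ?R ** (transpose Q ** G ** Q) ** ?R =
    transpose (Q ** matrix_inv Q ** P) ** G ** (Q ** matrix_inv Q ** P)"
    by (simp add: matrix_transpose_mul matrix_mul_assoc)
  also have "\<dots> = (\<chi> i j. if i = j then e i else 0)" by (simp add: Q P(2))
  finally show ?thesis
    unfolding has_signature_def
    using P invertible_mult[OF invertible_matrix_inv[OF assms(2)] P(1)]
    by (intro exI[of _ ?R] exI[of _ e]) simp
qed

text \<open>Both properties are inherited from the diagonal matrix with entries 1 and -1, which is
  its own inverse and of which \<open>G\<close> is a congruent copy.\<close>

lemma has_signature_imp:
  assumes "has_signature p q (G :: real^'n::finite^'n)"
  shows "invertible G" "transpose G = G"
proof -
  obtain P :: "real^'n^'n" and e where P: "invertible P"
    "transpose P ** G ** P = (\<chi> i j. if i = j then e i else 0)"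
    "\<forall>i. e i = 1 \<or> e i = -1"
    using assms(1) unfolding has_signature_def by blast
  let ?D = "(\<chi> i j. if i = j then e i else 0) :: real^'n^'n"
  let ?R = "matrix_inv P"
  have R: "P ** ?R = mat 1" using matrix_inv_mult[OF P(1)] by simp
  have G: "G = transpose ?R ** ?D ** ?R"
  proof -
    have "transpose ?R ** (transpose P ** G ** P) ** ?R = transpose (P ** ?R) ** G ** (P ** ?R)"
      by (simp add: matrix_transpose_mul matrix_mul_assoc)
    then show ?thesis by (simp add: R P(2))
  qed
  have "?D ** ?D = mat 1"
  proof -
    have "e i * e i = 1" for i using P(3)[rule_format, of i] by auto
    then show ?thesis
      by (simp add: matrix_matrix_mult_def vec_eq_iff mat_def if_distrib[of "\<lambda>x. _ * x"] cong: if_cong)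
  qed
  then have "invertible ?D" unfolding invertible_def by blast
  then show "invertible G"
    unfolding G by (intro invertible_mult invertible_transpose invertible_matrix_inv P(1))
  have "transpose ?D = ?D" by (auto simp: transpose_def vec_eq_iff)
  then show "transpose G = G"
    by (subst (1 2) G) (simp add: matrix_transpose_mul matrix_mul_assoc)
qed

text \<open>A symmetric matrix close to \<open>G\<^sub>0\<close> is \<open>Q\<^sup>T G\<^sub>0 Q\<close> with \<open>Q = 1 + G\<^sub>0\<inverse> S / 2\<close> and \<open>S\<close> symmetric,
  because \<open>S \<mapsto> Q\<^sup>T G\<^sub>0 Q - G\<^sub>0 = S + S G\<^sub>0\<inverse> S / 4\<close> is open and injective near \<open>0\<close>.\<close>

lemma has_signature_open:
  fixes G0 :: "real^'n::finite^'n"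
  assumes sig: "has_signature p q G0"
  obtains e where "e > 0"
    "\<And>G. transpose G = G \<Longrightarrow> dist G0 G < e \<Longrightarrow> has_signature p q G"
proof -
  note G0 = has_signature_imp[OF sig]
  define K where "K = matrix_inv G0"
  have K: "K ** G0 = mat 1" "G0 ** K = mat 1" using matrix_inv_mult[OF G0(1)] by (simp_all add: K_def)
  have Ks: "transpose K = K" using transpose_matrix_inv[OF G0(1)] by (simp add: K_def G0(2))
  interpret mm: bounded_bilinear "(**) :: real^'n^'n \<Rightarrow> real^'n^'n \<Rightarrow> real^'n^'n"
    by (rule bounded_bilinear_matrix_mult)
  define h :: "real^'n^'n \<Rightarrow> real^'n^'n \<Rightarrow> real^'n^'n" where "h X Y = X ** K ** Y" for X Y
  interpret h: bounded_bilinear h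
    unfolding h_def by (rule mm.comp1[OF mm.bounded_linear_left])
  obtain C where C: "C > 0" "\<And>X Y. norm (h X Y) \<le> norm X * norm Y * C"
    using h.pos_bounded by blast
  define f where "f S = S + (1/4) *\<^sub>R h S S" for S
  \<comment> \<open>Below this radius the quadratic part of \<open>f\<close> shrinks distances by a
    factor of at most 1/2, so \<open>f\<close> is injective on the ball.\<close>
  define r where "r = 1 / C"
  have r: "r > 0" using C by (simp add: r_def)
  have inj: "X = Y" if "norm X < r" "norm Y < r" "f X = f Y" for X Y
  proof (rule ccontr)
    assume "X \<noteq> Y"
    have "h X X - h Y Y = h (X - Y) X + h Y (X - Y)" by (simp add: h.diff_left h.diff_right)
    moreover have "X - Y = - ((1/4) *\<^sub>R (h X X - h Y Y))"
      using that(3) by (simp add: f_def algebra_simps)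
    ultimately have "norm (X - Y) = (1/4) * norm (h (X - Y) X + h Y (X - Y))"
      by (metis abs_divide abs_numeral abs_one norm_minus_cancel norm_scaleR)
    also have "\<dots> \<le> (1/4) * (norm (X - Y) * norm X * C + norm Y * norm (X - Y) * C)"
      by (intro mult_left_mono order.trans[OF norm_triangle_ineq] add_mono C) auto
    also have "\<dots> = (norm (X - Y) * ((norm X + norm Y) * C)) / 4" by (simp add: algebra_simps)
    also have "\<dots> \<le> (norm (X - Y) * (2 * r * C)) / 4"
      using that C by (intro divide_right_mono mult_left_mono mult_right_mono) auto
    also have "\<dots> < norm (X - Y)" using \<open>X \<noteq> Y\<close> C by (simp add: r_def)
    finally show False by simp
  qed
  define Q where "Q S = mat 1 + (1/2) *\<^sub>R (K ** S)" for S :: "real^'n^'n"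
  \<comment> \<open>\<open>transpose S\<close> is kept in the ball because injectivity is later
    applied to the pair \<open>S\<close>, \<open>transpose S\<close>; the determinant makes
    \<open>Q S\<close> invertible.\<close>
  define T where "T = {S \<in> ball 0 r. transpose S \<in> ball 0 r \<and> det (Q S) \<noteq> 0}"
  have contT: "continuous_on UNIV (transpose :: real^'n^'n \<Rightarrow> _)"
    by (rule linear_continuous_on[OF bounded_linear_transpose])
  have contQ: "continuous_on UNIV (\<lambda>S. det (Q S))"
    unfolding Q_def det_def matrix_matrix_mult_def
    by (intro continuous_intros)
  have "open T"
  proof -
    have "T = ball 0 r \<inter> (UNIV \<inter> transpose -` ball 0 r) \<inter> (UNIV \<inter> (\<lambda>S. det (Q S)) -` (- {0}))"
      by (auto simp: T_def)
    then show ?thesis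
      using continuous_open_preimage[OF contT, of "ball 0 r"]
        continuous_open_preimage[OF contQ, of "- {0}"]
        open_Compl[OF closed_singleton[of "0::real"]]
      by (simp add: open_Int)
  qed
  have Q0: "Q 0 = mat 1" by (simp add: Q_def)
  have t0: "transpose (0 :: real^'n^'n) = 0" by (simp add: transpose_def vec_eq_iff)
  have "0 \<in> T" using r by (simp add: T_def Q0 t0)
  have "(f has_derivative (\<lambda>V. V)) (at 0)"
    unfolding f_def
    by (rule derivative_eq_intros h.FDERIV refl)+ (simp add: h.zero_left h.zero_right)
  moreover have "continuous_on UNIV f"
    unfolding f_def by (intro continuous_intros h.continuous_on)
  \<comment> \<open>An open mapping theorem at a single point: the derivative of \<open>f\<close> at
    0 is the identity.\<close>
  ultimately have "f 0 \<in> interior (f ` T)"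
    using \<open>open T\<close> \<open>0 \<in> T\<close>
    by (intro sussmann_open_mapping[of UNIV f 0 "\<lambda>V. V" "\<lambda>V. V"]) (auto simp: interior_open fun_eq_iff)
  then obtain e where e: "e > 0" "ball 0 e \<subseteq> f ` T"
    by (auto simp: f_def h.zero_left mem_interior)
  show ?thesis
  proof (rule that[OF e(1)])
    fix G :: "real^'n^'n" assume G: "transpose G = G" "dist G0 G < e"
    then have "G - G0 \<in> ball 0 e" by (simp add: dist_norm norm_minus_commute)
    then obtain S where S: "S \<in> T" "G - G0 = f S" using e(2) by blast
    \<comment> \<open>The open mapping yields just some preimage \<open>S\<close>. Since
      \<open>f\<close> commutes with transposition, \<open>transpose S\<close> is another one, and
      injectivity makes \<open>S\<close> symmetric.\<close>
    have "f (transpose S) = transpose (f S)"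
      unfolding f_def h_def
      by (simp add: linear_add[OF linear_transpose] linear_scale[OF linear_transpose] matrix_transpose_mul Ks matrix_mul_assoc)
    also have "\<dots> = f S"
      by (simp add: S(2)[symmetric] linear_diff[OF linear_transpose] G G0)
    finally have Ss: "transpose S = S"
      by (rule inj[rotated 2]) (use S(1) in \<open>auto simp: T_def\<close>)
    have "transpose (Q S) ** G0 ** Q S = G0 + f S"
    proof -
      have tQ: "transpose (Q S) = mat 1 + (1/2) *\<^sub>R (S ** K)"
        unfolding Q_def
        by (simp add: linear_add[OF linear_transpose] linear_scale[OF linear_transpose] matrix_transpose_mul Ks Ss transpose_mat)
      have "transpose (Q S) ** G0 = G0 + (1/2) *\<^sub>R S"
        unfolding tQ
        by (simp add: mm.add_left mm.scaleR_left K flip: matrix_mul_assoc)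
      then have "transpose (Q S) ** G0 ** Q S = (G0 + (1/2) *\<^sub>R S) ** Q S" by simp
      also have "\<dots> = G0 + ((1/2) *\<^sub>R S + ((1/2) *\<^sub>R S + (1/4) *\<^sub>R h S S))"
        unfolding Q_def h_def
        by (simp add: mm.add_left mm.add_right mm.scaleR_left mm.scaleR_right matrix_mul_assoc K
            add.assoc scaleR_add_right)
      also have "\<dots> = G0 + (S + (1/4) *\<^sub>R h S S)"
        by (metis add.assoc scaleR_half_double scaleR_add_right)
      finally show ?thesis by (simp add: f_def)
    qed
    also have "\<dots> = G" using S(2) by (metis add.commute diff_add_cancel)
    finally have "G = transpose (Q S) ** G0 ** Q S" by simp
    moreover have "invertible (Q S)" using S(1) by (simp add: T_def invertible_det_nz)
    ultimately show "has_signature p q G"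
      using has_signature_congruent[OF sig] by simp
  qed
qed

section \<open>Charts and metrics\<close>

lemma jacobian_eqI:
  fixes M :: "real^'n::finite^'m::finite"
  shows "(f has_derivative ((*v) M)) (at y) \<Longrightarrow> jacobian f (at y) = M"
  unfolding jacobian_def by (drule frechet_derivative_at) (metis matrix_of_matrix_vector_mul)

lemma jacobian_compose:
  fixes f :: "real^'m::finite \<Rightarrow> real^'n::finite" and g :: "real^'n \<Rightarrow> real^'k::finite"
  assumes "open S" "y \<in> S" "\<And>z. z \<in> S \<Longrightarrow> h z = g (f z)"
    "f differentiable (at y)" "g differentiable (at (f y))"
  shows "jacobian h (at y) = jacobian g (at (f y)) ** jacobian f (at y)"
proof (rule jacobian_eqI)
  have "((\<lambda>z. g (f z)) has_derivative (\<lambda>v. jacobian g (at (f y)) *v (jacobian f (at y) *v v))) (at y)"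
    using assms(4,5)[unfolded jacobian_works] by (rule has_derivative_compose)
  then have "(h has_derivative (\<lambda>v. jacobian g (at (f y)) *v (jacobian f (at y) *v v))) (at y)"
    by (rule has_derivative_transform_within_open[OF _ assms(1,2)]) (simp add: assms(3))
  then show "(h has_derivative (*v) (jacobian g (at (f y)) ** jacobian f (at y))) (at y)"
    by (simp add: matrix_vector_mul_assoc)
qed

text \<open>Hypotheses on metrics quantify over all charts; this makes a matrix field in one chart,
  such as a polynomial or a constant, available to them. It is meaningful over
  \<open>chart_dom c\<close> only.\<close>

definition metric_from_chart ::
  "('x, 'n::finite) chart \<Rightarrow> (real^'n \<Rightarrow> real^'n^'n) \<Rightarrow> ('x, 'n) metric" where
  "metric_from_chart c G = (\<lambda>d x.
     transpose (diff_matrix d c id x) ** G (coord c x) ** diff_matrix d c id x)"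

locale atlas =
  fixes A :: "('x::{t2_space, second_countable_topology}, 'n::finite) chart set"
  assumes manifold: "smooth_manifold A"
begin

lemma chart:
  assumes "c \<in> A"
  shows "open (chart_dom c)" "open (coord c ` chart_dom c)"
    "homeomorphism (chart_dom c) (coord c ` chart_dom c) (coord c) (chart_inv c)"
  using manifold assms unfolding smooth_manifold_def by blast+

lemma chart_inv_coord [simp]: "c \<in> A \<Longrightarrow> x \<in> chart_dom c \<Longrightarrow> chart_inv c (coord c x) = x"
  using homeomorphism_apply1[OF chart(3)] .

lemma coord_chart_inv [simp]:
  "c \<in> A \<Longrightarrow> y \<in> coord c ` chart_dom c \<Longrightarrow> coord c (chart_inv c y) = y"
  by (rule f_inv_into_f)

lemma chart_inv_in: "y \<in> coord c ` chart_dom c \<Longrightarrow> chart_inv c y \<in> chart_dom c"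
  by (rule inv_into_into)

lemma open_coord_image: "c \<in> A \<Longrightarrow> open U \<Longrightarrow> open (coord c ` (U \<inter> chart_dom c))"
  using homeomorphism_imp_open_map[OF chart(3), of c "U \<inter> chart_dom c"] chart[of c]
  by (metis inf_commute openin_open_Int openin_open_trans)

lemma open_chart_preimage:
  assumes "c \<in> A" "open S" shows "open (chart_dom c \<inter> coord c -` S)"
  using continuous_open_preimage[OF homeomorphism_cont1[OF chart(3)[OF assms(1)]] chart(1)[OF assms(1)] assms(2)] .

lemma chart_at: "chart_at A x \<in> A" "x \<in> chart_dom (chart_at A x)"
proof -
  have "\<exists>c. c \<in> A \<and> x \<in> chart_dom c"
    using manifold unfolding smooth_manifold_def by blast
  then have "chart_at A x \<in> A \<and> x \<in> chart_dom (chart_at A x)"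
    unfolding chart_at_def by (rule someI_ex)
  then show "chart_at A x \<in> A" "x \<in> chart_dom (chart_at A x)" by auto
qed

lemma smooth_transition:
  "c \<in> A \<Longrightarrow> d \<in> A \<Longrightarrow> smooth_on (coord c ` (chart_dom c \<inter> chart_dom d)) (local_rep c d id)"
  using manifold unfolding smooth_manifold_def by blast

lemma open_overlap: "c \<in> A \<Longrightarrow> d \<in> A \<Longrightarrow> open (coord c ` (chart_dom c \<inter> chart_dom d))"
  using open_coord_image[of c "chart_dom d"] chart(1)[of d] by (simp add: inf_commute)

lemma transition_differentiable:
  assumes "c \<in> A" "d \<in> A" "x \<in> chart_dom c" "x \<in> chart_dom d"
  shows "local_rep c d id differentiable (at (coord c x))"
  using smooth_on_differentiable[OF smooth_transition[OF assms(1,2)]] assms(3,4) by blast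

text \<open>The factorisation through the middle chart \<open>d\<close> holds only where
  \<open>f\<close> lands in \<open>chart_dom d\<close>; the neighbourhood \<open>S\<close> secures
  this, since a Jacobian depends on the values near the point.\<close>

lemma diff_matrix_comp:
  assumes "c \<in> A" "d \<in> A" "x \<in> chart_dom c"
    and S: "open S" "coord c x \<in> S" "\<And>y. y \<in> S \<Longrightarrow> f (chart_inv c y) \<in> chart_dom d"
    and "local_rep c d f differentiable (at (coord c x))"
    and "local_rep d e g differentiable (at (coord d (f x)))"
  shows "diff_matrix c e (g \<circ> f) x = diff_matrix d e g (f x) ** diff_matrix c d f x"
proof -
  have x: "local_rep c d f (coord c x) = coord d (f x)"
    using assms by (simp add: local_rep_def)
  have e: "local_rep c e (g \<circ> f) y = local_rep d e g (local_rep c d f y)" if "y \<in> S" for y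
    using S(3)[OF that] assms(2) by (simp add: local_rep_def)
  show ?thesis
    unfolding diff_matrix_def
    using jacobian_compose[OF S(1,2), of "local_rep c e (g \<circ> f)" "local_rep d e g" "local_rep c d f"]
      e assms(7,8) by (simp add: x)
qed

lemma diff_matrix_cocycle:
  assumes "c \<in> A" "d \<in> A" "e \<in> A" "x \<in> chart_dom c" "x \<in> chart_dom d" "x \<in> chart_dom e"
  shows "diff_matrix c e id x = diff_matrix d e id x ** diff_matrix c d id x"
proof -
  have "diff_matrix c e (id \<circ> id) x = diff_matrix d e id (id x) ** diff_matrix c d id x"
  proof (rule diff_matrix_comp[OF assms(1,2,4) open_overlap[OF assms(1,2)]])
    show "coord c x \<in> coord c ` (chart_dom c \<inter> chart_dom d)" using assms by blast
    show "id (chart_inv c y) \<in> chart_dom d" if "y \<in> coord c ` (chart_dom c \<inter> chart_dom d)" for y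
      using that assms(1) by auto
    show "local_rep c d id differentiable (at (coord c x))"
      "local_rep d e id differentiable (at (coord d (id x)))"
      using transition_differentiable assms by auto
  qed
  then show ?thesis by simp
qed

lemma diff_matrix_refl:
  assumes "c \<in> A" "x \<in> chart_dom c"
  shows "diff_matrix c c id x = mat 1"
  unfolding diff_matrix_def
proof (rule jacobian_eqI)
  have "((\<lambda>y. y) has_derivative (\<lambda>v. v)) (at (coord c x))" by simp
  then have "(local_rep c c id has_derivative (\<lambda>v. v)) (at (coord c x))"
    by (rule has_derivative_transform_within_open[OF _ chart(2)[OF assms(1)]])
      (use assms in \<open>auto simp: local_rep_def\<close>)
  moreover have "(*v) (mat 1) = (\<lambda>v. v :: real^'n)" by (rule ext) simp
  ultimately show "(local_rep c c id has_derivative (*v) (mat 1)) (at (coord c x))" by simp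
qed

lemma diff_matrix_inverse:
  assumes "c \<in> A" "d \<in> A" "x \<in> chart_dom c" "x \<in> chart_dom d"
  shows "diff_matrix c d id x ** diff_matrix d c id x = mat 1"
  using diff_matrix_cocycle[of d c d x] diff_matrix_refl[of d x] assms by simp

lemma diff_matrix_invertible:
  assumes "c \<in> A" "d \<in> A" "x \<in> chart_dom c" "x \<in> chart_dom d"
  shows "invertible (diff_matrix c d id x)"
  unfolding invertible_def using diff_matrix_inverse[OF assms] diff_matrix_inverse[OF assms(2,1,4,3)] by blast

section \<open>Metrics prescribed in one chart\<close>

lemma metric_from_chart_apply:
  assumes "c \<in> A" "x \<in> chart_dom c"
  shows "metric_from_chart c G c x = G (coord c x)"
  using diff_matrix_refl[OF assms] by (simp add: metric_from_chart_def transpose_mat)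

lemma metric_comp_metric_from_chart:
  assumes "c \<in> A" "y \<in> coord c ` chart_dom c"
  shows "metric_comp c (metric_from_chart c G) y = G y"
  using metric_from_chart_apply[OF assms(1) chart_inv_in[OF assms(2)]] assms
  by (simp add: metric_comp_def)

lemma metric_on_from_chart:
  assumes c: "c \<in> A" and S: "open S" "smooth_on S G" "\<And>y. y \<in> S \<Longrightarrow> has_signature p q (G y)"
  shows "metric_on A p q (chart_dom c \<inter> coord c -` S) (metric_from_chart c G)"
    (is "metric_on A p q ?U ?g")
  unfolding metric_on_def
proof (intro conjI ballI)
  show U: "open ?U" using open_chart_preimage[OF c S(1)] .
  fix d assume d: "d \<in> A"
  show "smooth_on (coord d ` (?U \<inter> chart_dom d)) (metric_comp d ?g)"
  proof -
    let ?V = "coord d ` (?U \<inter> chart_dom d)" and ?\<phi> = "local_rep d c id"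
    let ?J = "\<lambda>y. jacobian ?\<phi> (at y)"
    have V: "open ?V" by (rule open_coord_image[OF d U])
    have \<phi>: "smooth_on ?V ?\<phi>"
      by (rule smooth_on_subset[OF smooth_transition[OF d c]]) auto
    note J = smooth_on_jacobian[OF V \<phi>]
    have "?\<phi> ` ?V \<subseteq> S" using d by (auto simp: local_rep_def)
    note G = smooth_on_compose[OF V this \<phi> S(2)]
    have "smooth_on ?V (\<lambda>y. transpose (?J y) ** G (?\<phi> y) ** ?J y)"
      by (intro smooth_on_bilinear[OF V bounded_bilinear_matrix_mult]
          smooth_on_bounded_linear[OF V bounded_linear_transpose] J G)
    then show ?thesis
      by (rule smooth_on_cong[OF _ V])
        (use d in \<open>auto simp: metric_comp_def metric_from_chart_def diff_matrix_def local_rep_def\<close>)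
  qed
  fix x assume x: "x \<in> ?U \<inter> chart_dom d"
  have "has_signature p q (?g d x)"
    unfolding metric_from_chart_def
    by (rule has_signature_congruent) (use x c d S(3) diff_matrix_invertible in auto)
  then show "transpose (?g d x) = ?g d x" "has_signature p q (?g d x)"
    using has_signature_imp(2) by auto
next
  fix d e x assume de: "d \<in> A" "e \<in> A" and x: "x \<in> ?U \<inter> chart_dom d \<inter> chart_dom e"
  have "diff_matrix d c id x = diff_matrix e c id x ** diff_matrix d e id x"
    using x c de by (intro diff_matrix_cocycle) auto
  then show "?g d x = transpose (diff_matrix d e id x) ** ?g e x ** diff_matrix d e id x"
    by (simp add: metric_from_chart_def matrix_transpose_mul matrix_mul_assoc)
qed

lemma metric_comp_smooth:
  assumes "metric_on A p q U g" "c \<in> A"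
  shows "open (coord c ` (U \<inter> chart_dom c))" "smooth_on (coord c ` (U \<inter> chart_dom c)) (metric_comp c g)"
  using assms open_coord_image[OF assms(2), of U] unfolding metric_on_def by blast+

lemma metric_comp_signature:
  assumes "metric_on A p q U g" "c \<in> A" "y \<in> coord c ` (U \<inter> chart_dom c)"
  shows "has_signature p q (metric_comp c g y)"
proof -
  obtain x where x: "x \<in> U \<inter> chart_dom c" "y = coord c x" using assms(3) by blast
  have "has_signature p q (g c x)"
    using assms(1,2) x(1) unfolding metric_on_def by blast
  with x assms(2) show ?thesis by (simp add: metric_comp_def)
qed

end

section \<open>Jets of matrix-valued functions\<close>

lemma smooth_on_diff:
  assumes "open S" "smooth_on S f" "smooth_on S g"
  shows "smooth_on S (\<lambda>x. f x - g x)"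
proof -
  have "smooth_on S (\<lambda>x. f x + (-1) *\<^sub>R g x)"
    by (intro smooth_on_add smooth_on_scaleR smooth_on_const assms)
  then show ?thesis by simp
qed

lemma partial_eqI: "(f has_derivative f') (at y) \<Longrightarrow> partial k f y = f' (axis k 1)"
  unfolding partial_def by (metis frechet_derivative_at)

lemma partial_add:
  assumes "f differentiable (at y)" "g differentiable (at y)"
  shows "partial k (\<lambda>y. f y + g y) y = partial k f y + partial k g y"
  using partial_eqI[OF has_derivative_add[OF assms[unfolded frechet_derivative_works]]]
  by (simp add: partial_def)

lemma partial_partial_add:
  assumes "open S" "smooth_on S f" "smooth_on S g" "y \<in> S"
  shows "partial k (partial l (\<lambda>y. f y + g y)) y = partial k (partial l f) y + partial k (partial l g) y"
proof -
  have "partial k (partial l (\<lambda>y. f y + g y)) y = partial k (\<lambda>y. partial l f y + partial l g y) y"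
    by (rule partial_cong_open[OF assms(1,4)])
      (simp add: partial_add smooth_on_differentiable[OF assms(2)] smooth_on_differentiable[OF assms(3)])
  also have "\<dots> = partial k (partial l f) y + partial k (partial l g) y"
    by (rule partial_add[OF smooth_on_differentiable[OF smooth_on_partial[OF assms(2)] assms(4)]
          smooth_on_differentiable[OF smooth_on_partial[OF assms(3)] assms(4)]])
  finally show ?thesis .
qed

lemma partial_partial_partial_add:
  assumes "open S" "smooth_on S f" "smooth_on S g" "y \<in> S"
  shows "partial n (partial k (partial l (\<lambda>y. f y + g y))) y =
    partial n (partial k (partial l f)) y + partial n (partial k (partial l g)) y"
proof -
  have "partial n (partial k (partial l (\<lambda>y. f y + g y))) y =
      partial n (\<lambda>y. partial k (partial l f) y + partial k (partial l g) y) y"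
    by (rule partial_cong_open[OF assms(1,4)])
      (simp add: partial_partial_add[OF assms(1-3)])
  also have "\<dots> = partial n (partial k (partial l f)) y + partial n (partial k (partial l g)) y"
    by (rule partial_add[OF
          smooth_on_differentiable[OF smooth_on_partial[OF smooth_on_partial[OF assms(2)]] assms(4)]
          smooth_on_differentiable[OF smooth_on_partial[OF smooth_on_partial[OF assms(3)]] assms(4)]])
  finally show ?thesis .
qed

lemma transpose_partial:
  fixes f :: "real^'n::finite \<Rightarrow> real^'m::finite^'m"
  assumes "open S" "smooth_on S f" "\<And>y. y \<in> S \<Longrightarrow> transpose (f y) = f y" "y \<in> S"
  shows "transpose (partial k f y) = partial k f y"
proof -
  have "partial k f y = partial k (\<lambda>y. transpose (f y)) y"
    by (rule partial_cong_open[OF assms(1,4)])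
      (simp add: assms(3))
  also have "\<dots> = transpose (partial k f y)"
    by (rule partial_bounded_linear[OF bounded_linear_transpose smooth_on_differentiable[OF assms(2,4)]])
  finally show ?thesis by simp
qed

lemma has_derivative_vec_lambda:
  fixes f :: "'i::finite \<Rightarrow> 'a::real_normed_vector \<Rightarrow> 'b::euclidean_space"
  assumes "\<And>i. (f i has_derivative f' i) F"
  shows "((\<lambda>x. \<chi> i. f i x) has_derivative (\<lambda>v. \<chi> i. f' i v)) F"
proof -
  have e: "(\<chi> i. h i) = (\<Sum>i\<in>UNIV. axis i (h i))" for h :: "'i \<Rightarrow> 'b"
    by (auto simp: vec_eq_iff axis_def if_distrib cong: if_cong)
  show ?thesis
    unfolding e by (intro has_derivative_sum bounded_linear.has_derivative[OF bounded_linear_axis] assms)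
qed

definition jet_at :: "(real^'n::finite \<Rightarrow> real^'n^'n) \<Rightarrow> real^'n \<Rightarrow> 'n jet_coords" where
  "jet_at G y = (y, G y, (\<chi> k. partial k G y), (\<chi> k l. partial k (partial l G) y))"

lemma jet_coords_eq: "jet_coords c x g = jet_at (metric_comp c g) (coord c x)"
  by (simp add: jet_coords_def jet_at_def)

lemma jet_at_add:
  assumes "open S" "smooth_on S G" "smooth_on S P" "y \<in> S"
  shows "jet_at (\<lambda>y. G y + P y) y =
    jet_at G y + (0, P y, (\<chi> k. partial k P y), (\<chi> k l. partial k (partial l P) y))"
  unfolding jet_at_def
  by (simp add: vec_eq_iff partial_add partial_partial_add[OF assms(1-3)] assms(4)
      smooth_on_differentiable[OF assms(2)] smooth_on_differentiable[OF assms(3)])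

lemma jet_at_cong:
  assumes "open S" "\<And>y. y \<in> S \<Longrightarrow> G y = G' y" "y \<in> S"
  shows "jet_at G y = jet_at G' y"
proof -
  have 1: "partial k G y = partial k G' y" if "y \<in> S" for k y
    by (rule partial_cong_open[OF assms(1) that assms(2)])
  have "partial k (partial l G) y = partial k (partial l G') y" for k l
    by (rule partial_cong_open[OF assms(1,3) 1])
  with 1[OF assms(3)] show ?thesis by (simp add: jet_at_def assms(2,3))
qed

lemma has_derivative_jet_at:
  fixes G :: "real^'n::finite \<Rightarrow> real^'n^'n"
  assumes "smooth_on S G" "y \<in> S"
  shows "(jet_at G has_derivative (\<lambda>v. (v, frechet_derivative G (at y) v,
    (\<chi> k. frechet_derivative (partial k G) (at y) v),
    (\<chi> k l. frechet_derivative (partial k (partial l G)) (at y) v)))) (at y)"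
  unfolding jet_at_def[abs_def]
  by (intro has_derivative_Pair has_derivative_vec_lambda has_derivative_ident
      smooth_on_has_derivative[OF _ assms(2)] smooth_on_partial assms(1))

lemma has_derivative_first_jet:
  fixes G :: "real^'n::finite \<Rightarrow> real^'n^'n"
  assumes "smooth_on S G" "y \<in> S"
  shows "((\<lambda>y. (y, G y, (\<chi> k. partial k G y), (0::real^'n^'n^'n^'n))) has_derivative
    (\<lambda>v. (v, frechet_derivative G (at y) v, (\<chi> k. frechet_derivative (partial k G) (at y) v), 0))) (at y)"
  by (intro has_derivative_Pair has_derivative_vec_lambda has_derivative_ident has_derivative_const
      smooth_on_has_derivative[OF _ assms(2)] smooth_on_partial assms(1))

section \<open>Derivatives of monomials centred at a point\<close>

definition delta :: "'a \<Rightarrow> 'a \<Rightarrow> real" where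
  "delta k a = (if k = a then 1 else 0)"

lemma sum_delta_mult [simp]:
  "(\<Sum>k\<in>UNIV. delta (k::'n::finite) a * h k) = h a" "(\<Sum>k\<in>UNIV. delta a (k::'n::finite) * h k) = h a"
  by (auto simp: delta_def if_distrib[of "\<lambda>x. x * _"] cong: if_cong)

lemma axis_nth_delta: "axis k (1::real) $ a = delta k a"
  by (auto simp: axis_def delta_def)

context
  fixes y0 :: "real^'n::finite" and H :: "real^'m::finite^'m"
begin

lemma has_derivative_shifted_nth:
  "((\<lambda>y. (y $ a - y0 $ a)) has_derivative (\<lambda>v. v $ a)) (at y)"
  by (rule derivative_eq_intros bounded_linear.has_derivative[OF bounded_linear_vec_nth] refl)+ simp

lemma smooth_shifted_nth: "open S \<Longrightarrow> smooth_on S (\<lambda>y. (y $ a - y0 $ a))"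
  by (intro smooth_on_diff smooth_on_vec_nth smooth_on_ident smooth_on_const)

lemma partial_linear_poly:
  "partial k (\<lambda>y. (y $ a - y0 $ a) *\<^sub>R H) = (\<lambda>y. delta k a *\<^sub>R H)"
  by (rule ext, rule partial_eqI[THEN trans])
    (rule derivative_eq_intros has_derivative_shifted_nth refl | simp add: axis_nth_delta)+

lemma partial_const: "partial k (\<lambda>y. H) = (\<lambda>y::real^'n. 0)"
  by (simp add: partial_def[abs_def])

lemma partial_quad_poly:
  "partial l (\<lambda>y. ((y $ a - y0 $ a) * (y $ b - y0 $ b)) *\<^sub>R H) =
    (\<lambda>y. (delta l a * (y $ b - y0 $ b) + delta l b * (y $ a - y0 $ a)) *\<^sub>R H)"
  by (rule ext, rule partial_eqI[THEN trans])
    (rule derivative_eq_intros has_derivative_shifted_nth refl | simp add: axis_nth_delta algebra_simps)+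

lemma partial_partial_quad_poly:
  "partial k (partial l (\<lambda>y. ((y $ a - y0 $ a) * (y $ b - y0 $ b)) *\<^sub>R H)) =
    (\<lambda>y. (delta k a * delta l b + delta k b * delta l a) *\<^sub>R H)"
  unfolding partial_quad_poly
  by (rule ext, rule partial_eqI[THEN trans])
    (rule derivative_eq_intros has_derivative_shifted_nth refl | simp add: axis_nth_delta algebra_simps)+

lemma partial_cubic_poly:
  "partial l (\<lambda>y. ((y $ a - y0 $ a) * (y $ b - y0 $ b) * (y $ c - y0 $ c)) *\<^sub>R H) =
    (\<lambda>y. (delta l a * ((y $ b - y0 $ b) * (y $ c - y0 $ c)) + delta l b * ((y $ a - y0 $ a) * (y $ c - y0 $ c)) +
      delta l c * ((y $ a - y0 $ a) * (y $ b - y0 $ b))) *\<^sub>R H)"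
  by (rule ext, rule partial_eqI[THEN trans])
    (rule derivative_eq_intros has_derivative_shifted_nth refl | simp add: axis_nth_delta algebra_simps)+

lemma partial_partial_cubic_poly:
  "partial k (partial l (\<lambda>y. ((y $ a - y0 $ a) * (y $ b - y0 $ b) * (y $ c - y0 $ c)) *\<^sub>R H)) =
    (\<lambda>y. ((delta k a * delta l b + delta k b * delta l a) * (y $ c - y0 $ c) +
          (delta k a * delta l c + delta k c * delta l a) * (y $ b - y0 $ b) +
          (delta k b * delta l c + delta k c * delta l b) * (y $ a - y0 $ a)) *\<^sub>R H)"
  unfolding partial_cubic_poly
  by (rule ext, rule partial_eqI[THEN trans])
    (rule derivative_eq_intros has_derivative_shifted_nth refl | simp add: axis_nth_delta algebra_simps)+

text \<open>The six products of deltas match \<open>n, k, l\<close> with \<open>a, b, c\<close> in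
  all ways. Grouped by the partner of \<open>n\<close>, they become the three terms of the relation
  between the derivatives of the components.\<close>

lemma partial_partial_partial_cubic_poly:
  "partial n (partial k (partial l (\<lambda>y. ((y $ a - y0 $ a) * (y $ b - y0 $ b) * (y $ c - y0 $ c)) *\<^sub>R H))) =
    (\<lambda>y. ((delta k a * delta l b + delta k b * delta l a) * delta n c +
          (delta k a * delta l c + delta k c * delta l a) * delta n b +
          (delta k b * delta l c + delta k c * delta l b) * delta n a) *\<^sub>R H)"
  unfolding partial_partial_cubic_poly
  by (rule ext, rule partial_eqI[THEN trans])
    (rule derivative_eq_intros has_derivative_shifted_nth refl | simp add: axis_nth_delta algebra_simps)+

end

section \<open>Linear algebra of the divergence condition\<close>

lemma split_last2:
  assumes "length I \<ge> 2"
  obtains R i j where "I = R @ [i, j]"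
  using assms by (cases I rule: rev_cases; cases "butlast I" rule: rev_cases) auto

lemma split_last3:
  assumes "length I \<ge> 3"
  obtains R i j k where "I = R @ [i, j, k]"
proof -
  obtain R i j where "I = R @ [i, j]" using split_last2[of I] assms by auto
  with assms show ?thesis using that by (cases R rule: rev_cases) auto
qed

text \<open>Symmetry exchanges the last two entries of \<open>I\<close>; the relation exchanges the
  last entry with \<open>b\<close> up to sign. Six such exchanges in alternation restore the
  arrangement and reverse the sign, as in the uniqueness of the Levi-Civita connection.\<close>

lemma symmetric_antisymmetric_eq_0:
  fixes f :: "'i list \<Rightarrow> 'i \<Rightarrow> real"
  assumes "m \<ge> 2" "length I = m"
    and sym: "\<And>I I' b. length I = m \<Longrightarrow> mset I = mset I' \<Longrightarrow> f I b = f I' b"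
    and rel: "\<And>J a b. length J = m - 1 \<Longrightarrow> f (J @ [a]) b + f (J @ [b]) a = 0"
  shows "f I b = 0"
proof -
  obtain R i j where I: "I = R @ [i, j]" using assms(1,2) split_last2[of I] by auto
  have R: "length R = m - 2" using assms(2) I by auto
  have rel': "f (R @ [x, y]) z + f (R @ [x, z]) y = 0" for x y z
    using rel[of "R @ [x]" y z] R assms(1) by simp
  have sym': "f (R @ [x, y]) z = f (R @ [y, x]) z" for x y z
    using R assms(1) by (intro sym) auto
  show ?thesis
    using rel'[of i j b] sym'[of i b j] rel'[of b i j] sym'[of b j i] rel'[of j b i] sym'[of i j b]
    unfolding I by linarith
qed

text \<open>For five fixed indices, the values of \<open>f\<close> are indexed by the 2-subsets of a set with five elements,
  and the relations say that their sum over each triangle is \<open>0\<close>. The incidence matrix of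
  2-subsets and 3-subsets of a 5-set is invertible.\<close>

lemma triangle_sums_eq_0:
  fixes f :: "'i list \<Rightarrow> 'i \<Rightarrow> 'i \<Rightarrow> real"
  assumes "m \<ge> 3" "length I = m"
    and sym: "\<And>I I' b c. length I = m \<Longrightarrow> mset I = mset I' \<Longrightarrow> f I b c = f I' b c"
    and sym2: "\<And>I b c. f I b c = f I c b"
    and rel: "\<And>J a b c. length J = m - 1 \<Longrightarrow>
      f (J @ [a]) b c + f (J @ [b]) a c + f (J @ [c]) a b = 0"
  shows "f I b c = 0"
proof -
  obtain R i j k where I: "I = R @ [i, j, k]" using assms(1,2) split_last3[of I] by blast
  have R: "length R = m - 3" using assms(2) I by auto
  define g where "g x y z u v = f (R @ [x, y, z]) u v" for x y z u v
  have rel': "g x y u v w + g x y v u w + g x y w u v = 0" for x y u v w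
    using rel[of "R @ [x, y]" u v w] R assms(1) by (simp add: g_def)
  have s1: "g x y z u v = g y x z u v" for x y z u v
    unfolding g_def using R assms(1) by (intro sym) auto
  have s2: "g x y z u v = g x z y u v" for x y z u v
    unfolding g_def using R assms(1) by (intro sym) auto
  have s3: "g x y z u v = g x y z v u" for x y z u v
    unfolding g_def by (rule sym2)
  have s4: "g x y z u v = g y z x u v" for x y z u v using s1 s2 by metis
  have s5: "g x y z u v = g z x y u v" for x y z u v using s1 s2 by metis
  \<comment> \<open>The ten triangles in \<open>i, j, k, b, c\<close>. The last two arguments of
    \<open>g\<close> are the edge; the symmetries bring the first three to a common order.\<close>
  have r: "g i j k b c + g i j b k c + g i j c k b = 0"
    "g i j k b c + g i k b j c + g i k c j b = 0"
    "g i j k b c + g j k b i c + g j k c i b = 0"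
    "g i j b k c + g i k b j c + g i b c j k = 0"
    "g i j b k c + g j k b i c + g j b c i k = 0"
    "g i k b j c + g j k b i c + g k b c i j = 0"
    "g i j c k b + g i k c j b + g i b c j k = 0"
    "g i j c k b + g j k c i b + g j b c i k = 0"
    "g i k c j b + g j k c i b + g k b c i j = 0"
    "g i b c j k + g j b c i k + g k b c i j = 0"
    using rel'[of i j k b c]
      rel'[of i k j b c] s2[of i k j b c]
      rel'[of j k i b c] s4[of i j k b c]
      rel'[of i b j k c] s2[of i j b k c] s2[of i k b j c] s2[of i b j k c] s2[of i b k j c] s2[of i b c k j] s3[of i b c k j]
      rel'[of j b i k c] s4[of i j b k c] s2[of j k b i c]
      rel'[of k b i j c] s4[of i k b j c] s4[of j k b i c]
      rel'[of i c j k b] s2[of i j c k b] s2[of i k c j b] s2[of i b c j k]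
      rel'[of j c i k b] s4[of i j c k b] s2[of j k c i b] s2[of j b c i k]
      rel'[of k c i j b] s4[of i k c j b] s4[of j k c i b] s2[of k b c i j]
      rel'[of b c i j k] s4[of i b c j k] s4[of j b c i k] s4[of k b c i j]
    by linarith+
  \<comment> \<open>Let T2, T1, T0 be the sums over the triangles that contain both, exactly one or
    none of \<open>b\<close>, \<open>c\<close>. In T2 - T1/2 + T0 the edge \<open>b c\<close> occurs
    three times and all other edges cancel.\<close>
  then show ?thesis unfolding I g_def by linarith
qed

section \<open>Divergence-free components\<close>

text \<open>\<open>F I\<close> expresses the component with indices \<open>I\<close> of a divergence-free tensor by the coordinates of a
  2-jet, over the image \<open>C\<close> of a chart.\<close>

locale divergence_free_components =
  fixes C :: "(real^'n::finite) set" and p q m :: nat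
    and W :: "'n list \<Rightarrow> 'n jet_coords set" and F :: "'n list \<Rightarrow> 'n jet_coords \<Rightarrow> real"
    and germ :: "(real^'n) set \<Rightarrow> (real^'n \<Rightarrow> real^'n^'n) \<Rightarrow> bool"
  defines "germ \<equiv> \<lambda>S G. open S \<and> S \<subseteq> C \<and> smooth_on S G \<and> (\<forall>y\<in>S. has_signature p q (G y))"
  assumes three_le: "m \<ge> 3"
    and open_W: "\<And>I. length I = m \<Longrightarrow> open (W I)"
    and F_differentiable: "\<And>I j. length I = m \<Longrightarrow> j \<in> W I \<Longrightarrow> F I differentiable (at j)"
    and jet_in_W: "\<And>S G y I. germ S G \<Longrightarrow> y \<in> S \<Longrightarrow> length I = m \<Longrightarrow> jet_at G y \<in> W I"
    and F_sym: "\<And>S G y I I'. germ S G \<Longrightarrow> y \<in> S \<Longrightarrow> length I = m \<Longrightarrow> mset I = mset I' \<Longrightarrow>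
      F I (jet_at G y) = F I' (jet_at G y)"
    and F_divergence: "\<And>S G y J. germ S G \<Longrightarrow> y \<in> S \<Longrightarrow> length J = m - 1 \<Longrightarrow>
      (\<Sum>l\<in>UNIV. partial l (\<lambda>y. F (J @ [l]) (jet_at G y)) y +
         (\<Sum>a<m. \<Sum>k\<in>UNIV. christoffel (G y) (\<chi> k. partial k G y) $ ((J @ [l]) ! a) $ l $ k *
            F ((J @ [l])[a := k]) (jet_at G y))) = 0"
begin

lemma germD:
  assumes "germ S G"
  shows "open S" "smooth_on S G" "\<And>y. y \<in> S \<Longrightarrow> has_signature p q (G y)"
    "\<And>y. y \<in> S \<Longrightarrow> transpose (G y) = G y" "S \<subseteq> C"
  using assms has_signature_imp(2) unfolding germ_def by blast+

lemma germ_shrink: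
  assumes "open S" "S \<subseteq> C" "smooth_on S G" "\<And>y. y \<in> S \<Longrightarrow> transpose (G y) = G y" "y0 \<in> S"
    and "has_signature p q (G y0)"
  obtains S' where "y0 \<in> S'" "S' \<subseteq> S" "germ S' G"
proof -
  obtain e where e: "e > 0" "\<And>M. transpose M = M \<Longrightarrow> dist (G y0) M < e \<Longrightarrow> has_signature p q M"
    using has_signature_open[OF assms(6)] by blast
  have cont: "continuous_on S G" by (rule smooth_on_continuous_on[OF assms(3)])
  define S' where "S' = S \<inter> G -` ball (G y0) e"
  have S': "open S'" "S' \<subseteq> S"
    using continuous_open_preimage[OF cont assms(1), of "ball (G y0) e"] by (auto simp: S'_def)
  show ?thesis
  proof (rule that[OF _ S'(2)])
    show "y0 \<in> S'" using assms(5) e by (simp add: S'_def)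
    show "germ S' G"
      unfolding germ_def using S' smooth_on_subset[OF assms(3) S'(2)] assms(2,4) e(2)
      by (auto simp: S'_def)
  qed
qed

lemma germ_perturb:
  assumes "germ S G" "smooth_on S P" "\<And>y. y \<in> S \<Longrightarrow> transpose (P y) = P y" "y0 \<in> S" "P y0 = 0"
  obtains S' where "y0 \<in> S'" "S' \<subseteq> S" "germ S' (\<lambda>y. G y + P y)"
proof (rule germ_shrink[of S "\<lambda>y. G y + P y" y0])
  show "smooth_on S (\<lambda>y. G y + P y)"
    by (rule smooth_on_add[OF germD(1,2)[OF assms(1)] assms(2)])
  show "transpose (G y + P y) = G y + P y" if "y \<in> S" for y
    using that by (simp add: linear_add[OF linear_transpose] germD(4)[OF assms(1)] assms(3))
qed (use germD[OF assms(1)] assms(4,5) that in auto)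

section \<open>Derivatives of the components along lines of jets\<close>

lemma F_has_derivative:
  assumes "length I = m" "j \<in> W I"
  shows "(F I has_derivative frechet_derivative (F I) (at j)) (at j)"
  using F_differentiable[OF assms] by (simp add: frechet_derivative_works)

lemma F_path_derivative:
  assumes "length I = m" "j + s *\<^sub>R v \<in> W I"
  shows "((\<lambda>s. F I (j + s *\<^sub>R v)) has_real_derivative frechet_derivative (F I) (at (j + s *\<^sub>R v)) v) (at s)"
proof -
  note d = F_has_derivative[OF assms]
  have "((\<lambda>s. j + s *\<^sub>R v) has_derivative (\<lambda>t. t *\<^sub>R v)) (at s)"
    by (auto intro!: derivative_eq_intros)
  from has_derivative_compose[OF this d] show ?thesis
    using linear_scale[OF has_derivative_linear[OF d]]
    by (simp add: has_field_derivative_def mult.commute mult_commute_abs)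
qed

lemma F_path_constant:
  assumes "length I = m" "\<And>s. j + s *\<^sub>R v \<in> W I"
    and "\<And>s. frechet_derivative (F I) (at (j + s *\<^sub>R v)) v = 0"
  shows "F I (j + v) = F I j"
proof -
  have "\<forall>s. ((\<lambda>s. F I (j + s *\<^sub>R v)) has_real_derivative 0) (at s)"
    using F_path_derivative[OF assms(1,2)] assms(3) by simp
  from DERIV_isconst_all[OF this, of 1 0] show ?thesis by simp
qed

text \<open>\<open>F I\<close> and \<open>F I'\<close> are known to agree at jets of metrics only,
  so their derivatives are compared along a line on which they agree.\<close>

lemma F_path_sym:
  assumes "length I = m" "mset I = mset I'" "\<And>s. j + s *\<^sub>R v \<in> W I \<inter> W I'"
    and "\<And>s. F I (j + s *\<^sub>R v) = F I' (j + s *\<^sub>R v)"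
  shows "frechet_derivative (F I) (at j) v = frechet_derivative (F I') (at j) v"
proof -
  have l: "length I' = m" using assms(1,2) by (metis mset_eq_length)
  have W: "j + s *\<^sub>R v \<in> W I" "j + s *\<^sub>R v \<in> W I'" for s
    using assms(3)[of s] by auto
  have "((\<lambda>s. F I (j + s *\<^sub>R v)) has_real_derivative frechet_derivative (F I) (at (j + 0 *\<^sub>R v)) v) (at 0)"
    by (rule F_path_derivative[OF assms(1) W(1)])
  moreover have "((\<lambda>s. F I' (j + s *\<^sub>R v)) has_real_derivative frechet_derivative (F I') (at (j + 0 *\<^sub>R v)) v) (at 0)"
    by (rule F_path_derivative[OF l W(2)])
  ultimately show ?thesis
    using DERIV_unique by (simp add: assms(4)) blast
qed

text \<open>The Christoffel terms involve the metric, its first derivatives and the values of the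
  components at \<open>y\<close>, all of which agree; of the two divergences only the derivative
  terms are left.\<close>

lemma divergence_difference:
  assumes G: "germ S G" "y \<in> S" and G': "germ S' G'" "y \<in> S'" and J: "length J = m - 1"
    and eq: "G' y = G y" "\<And>k. partial k G' y = partial k G y"
      "\<And>I. length I = m \<Longrightarrow> F I (jet_at G' y) = F I (jet_at G y)"
  shows "(\<Sum>l\<in>UNIV. partial l (\<lambda>y. F (J @ [l]) (jet_at G' y)) y - partial l (\<lambda>y. F (J @ [l]) (jet_at G y)) y) = 0"
proof -
  have "length ((J @ [l])[a := k]) = m" for l a k using J three_le by auto
  then show ?thesis
    using F_divergence[OF G J] F_divergence[OF G' J]
    by (simp add: eq sum.distrib sum_subtractf)
qed

section \<open>Independence of the second derivatives\<close>

text \<open>The change of the 2-jet at \<open>y0\<close> when \<open>H\<close> times the product of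
  the coordinates \<open>b\<close> and \<open>c\<close>, centred at \<open>y0\<close>, is added to
  the metric; for \<open>b = c\<close> it carries a factor 2.\<close>

definition dd :: "'n \<Rightarrow> 'n \<Rightarrow> real^'n^'n \<Rightarrow> 'n jet_coords" where
  "dd b c H = (0, 0, 0, \<chi> k l. (delta k b * delta l c + delta k c * delta l b) *\<^sub>R H)"

lemma jet_at_quad:
  assumes "germ S G" "y0 \<in> S"
  shows "jet_at (\<lambda>y. G y + ((y $ b - y0 $ b) * (y $ c - y0 $ c)) *\<^sub>R H) y0 = jet_at G y0 + dd b c H"
  using assms germD[OF assms(1)]
  by (subst jet_at_add[of S])
    (auto intro!: smooth_on_scaleR smooth_on_mult smooth_shifted_nth smooth_on_const
      simp: partial_partial_quad_poly[unfolded partial_quad_poly] partial_quad_poly dd_def vec_eq_iff)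

lemma dd_sym: "dd b c H = dd c b H"
  by (simp add: dd_def add.commute)

text \<open>The line in direction \<open>dd b c H\<close> consists of the jets of the quadratic
  perturbations with matrix \<open>s *\<^sub>R H\<close>, all of them metrics near
  \<open>y0\<close>.\<close>

lemma second_derivative_dd_sym:
  assumes G: "germ S G" "y0 \<in> S" and H: "transpose H = H" and I: "length I = m" "mset I = mset I'"
  shows "frechet_derivative (F I) (at (jet_at G y0)) (dd b c H) =
    frechet_derivative (F I') (at (jet_at G y0)) (dd b c H)"
proof (rule F_path_sym[OF I])
  fix s
  have l: "length I' = m" using I by (metis mset_eq_length)
  obtain S' where S': "y0 \<in> S'" "germ S' (\<lambda>y. G y + ((y $ b - y0 $ b) * (y $ c - y0 $ c)) *\<^sub>R (s *\<^sub>R H))"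
    by (rule germ_perturb[OF G(1) _ _ G(2), of "\<lambda>y. ((y $ b - y0 $ b) * (y $ c - y0 $ c)) *\<^sub>R (s *\<^sub>R H)"])
      (auto intro!: smooth_on_scaleR smooth_on_mult smooth_shifted_nth smooth_on_const
        germD(1)[OF G(1)] simp: linear_scale[OF linear_transpose] H)
  have dds: "dd b c (s *\<^sub>R H) = s *\<^sub>R dd b c H"
    by (simp add: dd_def vec_eq_iff)
  note jet = jet_at_quad[OF G, of b c "s *\<^sub>R H", unfolded dds]
  show "jet_at G y0 + s *\<^sub>R dd b c H \<in> W I \<inter> W I'"
    using jet_in_W[OF S'(2,1) I(1)] jet_in_W[OF S'(2,1) l] unfolding jet by blast
  show "F I (jet_at G y0 + s *\<^sub>R dd b c H) = F I' (jet_at G y0 + s *\<^sub>R dd b c H)"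
    using F_sym[OF S'(2,1) I] unfolding jet .
qed

text \<open>Third derivatives of \<open>G\<close> enter in the last slot and nowhere else, which is
  why a cubic perturbation can isolate them.\<close>

lemma partial_F_jet:
  assumes G: "germ S G" "y0 \<in> S" and I: "length I = m"
  shows "partial l (\<lambda>y. F I (jet_at G y)) y0 = frechet_derivative (F I) (at (jet_at G y0))
    (axis l 1, partial l G y0, (\<chi> k. partial l (partial k G) y0),
      (\<chi> k k'. partial l (partial k (partial k' G)) y0))"
  using partial_eqI[OF has_derivative_compose[OF has_derivative_jet_at[OF germD(2)[OF G(1)] G(2)]
        F_has_derivative[OF I jet_in_W[OF G I]]]]
  by (simp add: partial_def)

lemma second_derivative_dd_rel:
  assumes G: "germ S G" "y0 \<in> S" and H: "transpose H = H" and J: "length J = m - 1"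
  defines "f \<equiv> \<lambda>I b c. frechet_derivative (F I) (at (jet_at G y0)) (dd b c H)"
  shows "f (J @ [a]) b c + f (J @ [b]) a c + f (J @ [c]) a b = 0"
proof -
  let ?P = "\<lambda>y. ((y $ a - y0 $ a) * (y $ b - y0 $ b) * (y $ c - y0 $ c)) *\<^sub>R H"
  let ?G = "\<lambda>y. G y + ?P y"
  have P: "smooth_on S ?P"
    by (intro smooth_on_scaleR smooth_on_mult smooth_shifted_nth smooth_on_const germD(1)[OF G(1)])
  obtain S' where S': "y0 \<in> S'" "germ S' ?G"
    by (rule germ_perturb[OF G(1) P _ G(2)]) (auto simp: linear_scale[OF linear_transpose] H)
  have jet: "jet_at ?G y0 = jet_at G y0"
    by (subst jet_at_add[OF germD(1,2)[OF G(1)] P G(2)])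
      (simp add: partial_cubic_poly partial_partial_cubic_poly[unfolded partial_cubic_poly]
        vec_eq_iff zero_prod_def)
  then have eq: "?G y0 = G y0" "partial k ?G y0 = partial k G y0"
    "partial l (partial k ?G) y0 = partial l (partial k G) y0" for k l
    by (simp_all add: jet_at_def vec_eq_iff)
  have m: "m - 1 + 1 = m" using three_le by simp
  have "partial l (\<lambda>y. F (J @ [l]) (jet_at ?G y)) y0 - partial l (\<lambda>y. F (J @ [l]) (jet_at G y)) y0 =
      delta l a * f (J @ [l]) b c + delta l b * f (J @ [l]) a c + delta l c * f (J @ [l]) a b" for l
  proof -
    have I: "length (J @ [l]) = m" using J m by simp
    interpret D: linear "frechet_derivative (F (J @ [l])) (at (jet_at G y0))"
      using F_has_derivative[OF I jet_in_W[OF G I]] by (rule has_derivative_linear)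
    have "partial l (\<lambda>y. F (J @ [l]) (jet_at ?G y)) y0 - partial l (\<lambda>y. F (J @ [l]) (jet_at G y)) y0 =
      frechet_derivative (F (J @ [l])) (at (jet_at G y0))
        (delta l a *\<^sub>R dd b c H + delta l b *\<^sub>R dd a c H + delta l c *\<^sub>R dd a b H)"
      unfolding partial_F_jet[OF S'(2,1) I] partial_F_jet[OF G I] jet eq D.diff[symmetric]
      by (rule arg_cong[where f = "frechet_derivative (F (J @ [l])) (at (jet_at G y0))"])
        (simp add: partial_partial_partial_add[OF germD(1,2)[OF G(1)] P G(2)]
          partial_cubic_poly partial_partial_cubic_poly[unfolded partial_cubic_poly]
          partial_partial_partial_cubic_poly[unfolded partial_partial_cubic_poly]
          dd_def vec_eq_iff, simp add: algebra_simps)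
    then show ?thesis by (simp add: D.add D.scale f_def)
  qed
  \<comment> \<open>The 2-jets agree at \<open>y0\<close>, so only the derivative terms differ;
    summing over the contracted index puts \<open>a\<close>, \<open>b\<close>, \<open>c\<close> in
    turn at the end of \<open>J\<close>.\<close>
  then have "(\<Sum>l\<in>UNIV. delta l a * f (J @ [l]) b c + delta l b * f (J @ [l]) a c + delta l c * f (J @ [l]) a b) = 0"
    using divergence_difference[OF G S'(2,1) J eq(1,2)] jet by simp
  then show ?thesis by (simp add: sum.distrib)
qed

lemma second_derivative_dd_eq_0:
  assumes "germ S G" "y0 \<in> S" "transpose H = H" "length I = m"
  shows "frechet_derivative (F I) (at (jet_at G y0)) (dd b c H) = 0"
  by (rule triangle_sums_eq_0[of m I "\<lambda>I b c. frechet_derivative (F I) (at (jet_at G y0)) (dd b c H)"])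
    (use three_le assms second_derivative_dd_sym[OF assms(1-3)] second_derivative_dd_rel[OF assms(1-3)] in
      \<open>auto simp: dd_sym\<close>)

lemma second_derivative_eq_0:
  assumes G: "germ S G" "y0 \<in> S" and I: "length I = m"
    and X: "\<And>k l. X $ k $ l = X $ l $ k" "\<And>k l. transpose (X $ k $ l) = X $ k $ l"
  shows "frechet_derivative (F I) (at (jet_at G y0)) (0, 0, 0, X) = 0"
proof -
  interpret D: linear "frechet_derivative (F I) (at (jet_at G y0))"
    using F_has_derivative[OF I jet_in_W[OF G I]] by (rule has_derivative_linear)
  \<comment> \<open>Ordered pairs count every mixed direction twice, and \<open>dd a a\<close>
    carries a factor 2 itself, hence 1/2.\<close>
  have "X $ k $ l $ i $ j = (1/2) * (\<Sum>a\<in>UNIV. \<Sum>b\<in>UNIV.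
      (delta k a * delta l b + delta k b * delta l a) * X $ a $ b $ i $ j)" for k l i j
  proof -
    have "(\<Sum>a\<in>UNIV. \<Sum>b\<in>UNIV. (delta k a * delta l b + delta k b * delta l a) * X $ a $ b $ i $ j) =
      (\<Sum>a\<in>UNIV. delta k a * (\<Sum>b\<in>UNIV. delta l b * X $ a $ b $ i $ j)) +
      (\<Sum>a\<in>UNIV. delta l a * (\<Sum>b\<in>UNIV. delta k b * X $ a $ b $ i $ j))"
      by (simp add: distrib_right sum.distrib sum_distrib_left mult.assoc mult.left_commute del: sum_delta_mult)
    also have "\<dots> = 2 * X $ k $ l $ i $ j" using X(1)[of k l] by simp
    finally show ?thesis by simp
  qed
  then have "(0, 0, 0, X) = (1/2) *\<^sub>R (\<Sum>a\<in>UNIV. \<Sum>b\<in>UNIV. dd a b (X $ a $ b))"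
    by (simp add: prod_eq_iff fst_sum snd_sum dd_def vec_eq_iff)
  then show ?thesis
    by (simp add: D.scale D.sum second_derivative_dd_eq_0[OF G X(2) I])
qed

text \<open>The field \<open>G\<close> plus \<open>s\<close> times \<open>G' - G\<close> keeps the
  value \<open>G y0\<close> at \<open>y0\<close> for every real \<open>s\<close>, so it is a metric
  nearby, and its jet lies on the line through the two given jets.\<close>

lemma germ_path:
  assumes G: "germ S G" "y0 \<in> S" and G': "germ S' G'" "y0 \<in> S'" and eq: "G' y0 = G y0"
  obtains S'' H where "y0 \<in> S''" "germ S'' H"
    "jet_at H y0 = jet_at G y0 + s *\<^sub>R (jet_at G' y0 - jet_at G y0)"
proof -
  let ?S = "S \<inter> S'" and ?P = "\<lambda>y. G' y - G y"
  have S: "open ?S" "y0 \<in> ?S" using germD(1)[OF G(1)] germD(1)[OF G'(1)] G(2) G'(2) by auto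
  have sm: "smooth_on ?S G" "smooth_on ?S G'"
    using germD(2)[OF G(1)] germD(2)[OF G'(1)] by (auto intro: smooth_on_subset)
  have P: "smooth_on ?S ?P" by (rule smooth_on_diff[OF S(1) sm(2,1)])
  have sP: "smooth_on ?S (\<lambda>y. s *\<^sub>R ?P y)"
    by (rule smooth_on_bounded_linear[OF S(1) bounded_linear_scaleR_right P])
  have germ: "germ ?S G" using G germD[OF G(1)] sm S unfolding germ_def by auto
  obtain S'' where S'': "y0 \<in> S''" "germ S'' (\<lambda>y. G y + s *\<^sub>R ?P y)"
    by (rule germ_perturb[OF germ sP _ S(2)])
      (auto simp: eq linear_scale[OF linear_transpose] linear_diff[OF linear_transpose] germD(4)[OF G(1)] germD(4)[OF G'(1)])
  have "jet_at G' y0 = jet_at (\<lambda>y. G y + ?P y) y0" by simp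
  also have "\<dots> = jet_at G y0 + (0, ?P y0, (\<chi> k. partial k ?P y0), (\<chi> k l. partial k (partial l ?P) y0))"
    by (rule jet_at_add[OF S(1) sm(1) P S(2)])
  finally have d: "jet_at G' y0 - jet_at G y0 =
      (0, ?P y0, (\<chi> k. partial k ?P y0), (\<chi> k l. partial k (partial l ?P) y0))" by simp
  have "jet_at (\<lambda>y. G y + s *\<^sub>R ?P y) y0 = jet_at G y0 + s *\<^sub>R (jet_at G' y0 - jet_at G y0)"
    unfolding d
    by (subst jet_at_add[OF S(1) sm(1) sP S(2)])
      (simp add: vec_eq_iff partial_bounded_linear[OF bounded_linear_scaleR_right smooth_on_differentiable[OF P S(2)]]
        partial_partial_bounded_linear[OF bounded_linear_scaleR_right S(1) P S(2)])
  with S'' show ?thesis by (rule that)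
qed

lemma F_eq_if_first_jet_eq:
  assumes G: "germ S G" "y0 \<in> S" and G': "germ S' G'" "y0 \<in> S'" and I: "length I = m"
    and eq: "G' y0 = G y0" "\<And>k. partial k G' y0 = partial k G y0"
  shows "F I (jet_at G' y0) = F I (jet_at G y0)"
proof -
  define X where "X = (\<chi> k l. partial k (partial l G') y0 - partial k (partial l G) y0)"
  have d: "jet_at G' y0 - jet_at G y0 = (0, 0, 0, X)"
    by (simp add: jet_at_def eq X_def vec_eq_iff)
  \<comment> \<open>\<open>second_derivative_eq_0\<close> covers only directions with two
    symmetries: here the commuting of partial derivatives, below the symmetry of the
    matrices.\<close>
  have X1: "X $ k $ l = X $ l $ k" for k l
    using partial_commute[OF germD(1,2)[OF G(1)] G(2)] partial_commute[OF germD(1,2)[OF G'(1)] G'(2)]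
    by (simp add: X_def)
  have sym: "transpose (partial k (partial l G) y) = partial k (partial l G) y"
    if "germ S G" "y \<in> S" for S G y k l
    by (rule transpose_partial[OF germD(1)[OF that(1)] smooth_on_partial[OF germD(2)[OF that(1)]] _ that(2)])
      (rule transpose_partial[OF germD(1,2,4)[OF that(1)]])
  have X2: "transpose (X $ k $ l) = X $ k $ l" for k l
    by (simp add: X_def linear_diff[OF linear_transpose] sym[OF G] sym[OF G'])
  have "F I (jet_at G y0 + (0, 0, 0, X)) = F I (jet_at G y0)"
  proof (rule F_path_constant[OF I])
    fix s
    obtain S'' H where H: "y0 \<in> S''" "germ S'' H" "jet_at H y0 = jet_at G y0 + s *\<^sub>R (0, 0, 0, X)"
      using germ_path[OF G G' eq(1), of s] unfolding d by blast
    show "jet_at G y0 + s *\<^sub>R (0, 0, 0, X) \<in> W I"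
      using jet_in_W[OF H(2,1) I] unfolding H(3) .
    show "frechet_derivative (F I) (at (jet_at G y0 + s *\<^sub>R (0, 0, 0, X))) (0, 0, 0, X) = 0"
      using second_derivative_eq_0[OF H(2,1) I X1 X2] unfolding H(3) .
  qed
  then show ?thesis by (simp flip: d)
qed

section \<open>Independence of the first derivatives\<close>

definition first_jet :: "(real^'n \<Rightarrow> real^'n^'n) \<Rightarrow> real^'n \<Rightarrow> 'n jet_coords" where
  "first_jet G y = (y, G y, (\<chi> k. partial k G y), 0)"

text \<open>The first-order Taylor polynomial of \<open>G\<close> at \<open>y\<close> is a metric
  near \<open>y\<close> whose 2-jet there is exactly \<open>first_jet G y\<close>;
  \<open>F_eq_if_first_jet_eq\<close> compares it with \<open>G\<close>.\<close>

lemma F_first_jet: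
  assumes G: "germ S G" "y \<in> S" and I: "length I = m"
  shows "first_jet G y \<in> W I" "F I (jet_at G y) = F I (first_jet G y)"
proof -
  let ?P = "\<lambda>z. \<Sum>a\<in>UNIV. (z $ a - y $ a) *\<^sub>R partial a G y"
  let ?H = "\<lambda>z. G y + ?P z"
  have S: "open S" by (rule germD(1)[OF G(1)])
  have c: "germ S (\<lambda>_. G y)"
    unfolding germ_def using germD[OF G(1)] G(2) smooth_on_const[OF S] by auto
  have P: "smooth_on S ?P"
    by (intro smooth_on_sum smooth_on_scaleR smooth_shifted_nth smooth_on_const S)
  obtain S' where S': "y \<in> S'" "germ S' ?H"
    by (rule germ_perturb[OF c P _ G(2)])
      (auto simp: linear_sum[OF linear_transpose] linear_scale[OF linear_transpose] transpose_partial[OF germD(1,2,4)[OF G(1)] G(2)])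
  have dP: "partial k ?P = (\<lambda>z. partial k G y)" for k
  proof (rule ext)
    fix z
    have "(?P has_derivative (\<lambda>v. \<Sum>a\<in>UNIV. v $ a *\<^sub>R partial a G y)) (at z)"
      by (intro has_derivative_sum) (rule derivative_eq_intros has_derivative_shifted_nth refl | simp)+
    from partial_eqI[OF this, of k] show "partial k ?P z = partial k G y"
      by (simp add: axis_nth_delta delta_def if_distrib[of "\<lambda>x. x *\<^sub>R _"] cong: if_cong)
  qed
  have jet: "jet_at ?H y = first_jet G y"
    by (subst jet_at_add[OF S smooth_on_const[OF S] P G(2)])
      (simp add: jet_at_def first_jet_def dP partial_const vec_eq_iff)
  then have eq: "?H y = G y" "partial k ?H y = partial k G y" for k
    by (simp_all add: jet_at_def first_jet_def vec_eq_iff)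
  show "first_jet G y \<in> W I" using jet_in_W[OF S'(2,1) I] unfolding jet .
  show "F I (jet_at G y) = F I (first_jet G y)"
    using F_eq_if_first_jet_eq[OF G S'(2,1) I eq] unfolding jet by simp
qed

text \<open>Replacing the jet by \<open>first_jet\<close> on a neighbourhood before differentiating
  lowers the order: third derivatives of \<open>G\<close> disappear.\<close>

lemma partial_F_first_jet:
  assumes G: "germ S G" "y0 \<in> S" and I: "length I = m"
  shows "partial l (\<lambda>y. F I (jet_at G y)) y0 = frechet_derivative (F I) (at (first_jet G y0))
    (axis l 1, partial l G y0, (\<chi> k. partial l (partial k G) y0), 0)"
proof -
  have "((\<lambda>y. F I (first_jet G y)) has_derivative (\<lambda>v. frechet_derivative (F I) (at (first_jet G y0))
    (v, frechet_derivative G (at y0) v, (\<chi> k. frechet_derivative (partial k G) (at y0) v), 0))) (at y0)"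
    using has_derivative_compose[OF has_derivative_first_jet[OF germD(2)[OF G(1)] G(2)]
        F_has_derivative[OF I F_first_jet(1)[OF G I, unfolded first_jet_def]]]
    by (simp add: first_jet_def)
  then have "((\<lambda>y. F I (jet_at G y)) has_derivative (\<lambda>v. frechet_derivative (F I) (at (first_jet G y0))
    (v, frechet_derivative G (at y0) v, (\<chi> k. frechet_derivative (partial k G) (at y0) v), 0))) (at y0)"
    by (rule has_derivative_transform_within_open[OF _ germD(1)[OF G(1)] G(2)])
      (simp add: F_first_jet(2)[OF G(1) _ I])
  from partial_eqI[OF this] show ?thesis by (simp add: partial_def)
qed

definition d1 :: "'n \<Rightarrow> real^'n^'n \<Rightarrow> 'n jet_coords" where
  "d1 b H = (0, 0, \<chi> k. delta k b *\<^sub>R H, 0)"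

lemma first_derivative_d1_sym:
  assumes G: "germ S G" "y0 \<in> S" and H: "transpose H = H" and I: "length I = m" "mset I = mset I'"
  shows "frechet_derivative (F I) (at (first_jet G y0)) (d1 b H) =
    frechet_derivative (F I') (at (first_jet G y0)) (d1 b H)"
proof (rule F_path_sym[OF I])
  fix s
  let ?P = "\<lambda>y. (y $ b - y0 $ b) *\<^sub>R (s *\<^sub>R H)"
  let ?G = "\<lambda>y. G y + ?P y"
  have l: "length I' = m" using I by (metis mset_eq_length)
  have P: "smooth_on S ?P"
    by (intro smooth_on_scaleR smooth_shifted_nth smooth_on_const germD(1)[OF G(1)])
  obtain S' where S': "y0 \<in> S'" "germ S' ?G"
    by (rule germ_perturb[OF G(1) P _ G(2)]) (auto simp: linear_scale[OF linear_transpose] H)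
  have "partial k ?G y0 = partial k G y0 + delta k b *\<^sub>R (s *\<^sub>R H)" for k
    by (subst partial_add[OF smooth_on_differentiable[OF germD(2)[OF G(1)] G(2)] smooth_on_differentiable[OF P G(2)]])
      (simp only: partial_linear_poly)
  then have jet: "first_jet ?G y0 = first_jet G y0 + s *\<^sub>R d1 b H"
    by (simp add: first_jet_def d1_def vec_eq_iff)
  show "first_jet G y0 + s *\<^sub>R d1 b H \<in> W I \<inter> W I'"
    using F_first_jet(1)[OF S'(2,1) I(1)] F_first_jet(1)[OF S'(2,1) l] unfolding jet by blast
  show "F I (first_jet G y0 + s *\<^sub>R d1 b H) = F I' (first_jet G y0 + s *\<^sub>R d1 b H)"
    using F_sym[OF S'(2,1) I]
    unfolding F_first_jet(2)[OF S'(2,1) I(1)] F_first_jet(2)[OF S'(2,1) l] jet .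
qed

text \<open>A quadratic perturbation changes the 2-jet at \<open>y0\<close> but not the first jet,
  so the components keep their values there and the Christoffel terms still cancel. What changes is
  the second derivatives of \<open>G\<close>, which enter the derivative of a component through
  \<open>d1\<close>.\<close>

lemma first_derivative_d1_rel:
  assumes G: "germ S G" "y0 \<in> S" and H: "transpose H = H" and J: "length J = m - 1"
  defines "f \<equiv> \<lambda>I b. frechet_derivative (F I) (at (first_jet G y0)) (d1 b H)"
  shows "f (J @ [a]) b + f (J @ [b]) a = 0"
proof -
  let ?P = "\<lambda>y. ((y $ a - y0 $ a) * (y $ b - y0 $ b)) *\<^sub>R H"
  let ?G = "\<lambda>y. G y + ?P y"
  have P: "smooth_on S ?P"
    by (intro smooth_on_scaleR smooth_on_mult smooth_shifted_nth smooth_on_const germD(1)[OF G(1)])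
  obtain S' where S': "y0 \<in> S'" "germ S' ?G"
    by (rule germ_perturb[OF G(1) P _ G(2)]) (auto simp: linear_scale[OF linear_transpose] H)
  have eq: "?G y0 = G y0" "partial k ?G y0 = partial k G y0" for k
    by (simp_all add: partial_add[OF smooth_on_differentiable[OF germD(2)[OF G(1)] G(2)]
          smooth_on_differentiable[OF P G(2)]] partial_quad_poly)
  then have jet: "first_jet ?G y0 = first_jet G y0"
    by (simp add: first_jet_def)
  have "partial l (\<lambda>y. F (J @ [l]) (jet_at ?G y)) y0 - partial l (\<lambda>y. F (J @ [l]) (jet_at G y)) y0 =
      delta l a * f (J @ [l]) b + delta l b * f (J @ [l]) a" for l
  proof -
    have I: "length (J @ [l]) = m" using J three_le by simp
    interpret D: linear "frechet_derivative (F (J @ [l])) (at (first_jet G y0))"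
      using F_has_derivative[OF I F_first_jet(1)[OF G I]] by (rule has_derivative_linear)
    have "partial l (\<lambda>y. F (J @ [l]) (jet_at ?G y)) y0 - partial l (\<lambda>y. F (J @ [l]) (jet_at G y)) y0 =
      frechet_derivative (F (J @ [l])) (at (first_jet G y0)) (delta l a *\<^sub>R d1 b H + delta l b *\<^sub>R d1 a H)"
      unfolding partial_F_first_jet[OF S'(2,1) I] partial_F_first_jet[OF G I] jet eq D.diff[symmetric]
      by (rule arg_cong[where f = "frechet_derivative (F (J @ [l])) (at (first_jet G y0))"])
        (simp add: partial_partial_add[OF germD(1,2)[OF G(1)] P G(2)] partial_quad_poly
          partial_partial_quad_poly[unfolded partial_quad_poly] d1_def vec_eq_iff, simp add: algebra_simps)
    then show ?thesis by (simp add: D.add D.scale f_def)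
  qed
  then have "(\<Sum>l\<in>UNIV. delta l a * f (J @ [l]) b + delta l b * f (J @ [l]) a) = 0"
    using divergence_difference[OF G S'(2,1) J eq F_eq_if_first_jet_eq[OF G S'(2,1) _ eq]] by simp
  then show ?thesis by (simp add: sum.distrib)
qed

lemma first_derivative_eq_0:
  assumes G: "germ S G" "y0 \<in> S" and I: "length I = m"
    and Y: "\<And>k. transpose (Y $ k) = Y $ k"
  shows "frechet_derivative (F I) (at (first_jet G y0)) (0, 0, Y, 0) = 0"
proof -
  interpret D: linear "frechet_derivative (F I) (at (first_jet G y0))"
    using F_has_derivative[OF I F_first_jet(1)[OF G I]] by (rule has_derivative_linear)
  have d1: "frechet_derivative (F I) (at (first_jet G y0)) (d1 b H) = 0" if "transpose H = H" for b H
    by (rule symmetric_antisymmetric_eq_0[of m I "\<lambda>I b. frechet_derivative (F I) (at (first_jet G y0)) (d1 b H)"])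
      (use three_le I first_derivative_d1_sym[OF G that] first_derivative_d1_rel[OF G that] in auto)
  have "(0, 0, Y, 0) = (\<Sum>b\<in>UNIV. d1 b (Y $ b))"
    by (simp add: prod_eq_iff fst_sum snd_sum d1_def vec_eq_iff)
  then show ?thesis by (simp add: D.sum d1 Y)
qed

theorem F_eq_if_value_eq:
  assumes G: "germ S G" "y0 \<in> S" and G': "germ S' G'" "y0 \<in> S'" and I: "length I = m"
    and eq: "G' y0 = G y0"
  shows "F I (jet_at G' y0) = F I (jet_at G y0)"
proof -
  define Y where "Y = (\<chi> k. partial k G' y0 - partial k G y0)"
  have Y: "transpose (Y $ k) = Y $ k" for k
    by (simp add: Y_def linear_diff[OF linear_transpose] transpose_partial[OF germD(1,2,4)[OF G(1)] G(2)]
        transpose_partial[OF germD(1,2,4)[OF G'(1)] G'(2)])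
  have "F I (first_jet G y0 + (0, 0, Y, 0)) = F I (first_jet G y0)"
  proof (rule F_path_constant[OF I])
    fix s
    obtain S'' H where H: "y0 \<in> S''" "germ S'' H"
      "jet_at H y0 = jet_at G y0 + s *\<^sub>R (jet_at G' y0 - jet_at G y0)"
      using germ_path[OF G G' eq, of s] by blast
    \<comment> \<open>Setting second derivatives to 0 maps the line of 2-jets to the line joining
      the first jets.\<close>
    have jet: "first_jet H y0 = first_jet G y0 + s *\<^sub>R (0, 0, Y, 0)"
      using H(3) by (simp add: jet_at_def first_jet_def Y_def vec_eq_iff eq)
    show "first_jet G y0 + s *\<^sub>R (0, 0, Y, 0) \<in> W I"
      using F_first_jet(1)[OF H(2,1) I] unfolding jet .
    show "frechet_derivative (F I) (at (first_jet G y0 + s *\<^sub>R (0, 0, Y, 0))) (0, 0, Y, 0) = 0"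
      using first_derivative_eq_0[OF H(2,1) I Y] unfolding jet .
  qed
  moreover have "first_jet G y0 + (0, 0, Y, 0) = first_jet G' y0"
    by (simp add: first_jet_def Y_def vec_eq_iff eq)
  ultimately show ?thesis
    by (simp add: F_first_jet(2)[OF G I] F_first_jet(2)[OF G' I])
qed

end

section \<open>Components of tensors\<close>

lemma finite_lists_length [simp]: "finite {K :: 'i::finite list. length K = m}"
  by (rule finite_list_length)

lemma sum_lists_Suc:
  "(\<Sum>K | length K = Suc m. h K) = (\<Sum>k\<in>UNIV. \<Sum>K | length K = m. h ((k::'i::finite) # K))"
proof -
  have "{K. length K = Suc m} = (\<lambda>(k, K). (k::'i) # K) ` (UNIV \<times> {K. length K = m})"
    by (auto simp: image_iff length_Suc_conv)
  moreover have "inj_on (\<lambda>(k, K). (k::'i) # K) (UNIV \<times> {K. length K = m})"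
    by (auto simp: inj_on_def)
  ultimately show ?thesis
    by (simp add: sum.reindex sum.cartesian_product case_prod_unfold)
qed

lemma sum_lists_prod:
  fixes f :: "nat \<Rightarrow> 'i::finite \<Rightarrow> 'a::comm_semiring_1"
  shows "(\<Sum>K | length K = m. \<Prod>a<m. f a (K ! a)) = (\<Prod>a<m. \<Sum>k\<in>UNIV. f a k)"
proof (induction m arbitrary: f)
  case (Suc m)
  show ?case
    unfolding sum_lists_Suc prod.lessThan_Suc_shift nth_Cons_0 nth_Cons_Suc
    by (simp flip: Suc.IH sum_distrib_left add: sum_distrib_right)
qed simp

text \<open>After exchanging the sums, distributivity (\<open>sum_lists_prod\<close>) turns the sum
  over the middle lists into a product of entries of \<open>D ** E\<close>.\<close>

lemma transform_comps_mult:
  "transform_comps m D (transform_comps m E t) I = transform_comps m (D ** E) t I"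
proof -
  have "transform_comps m D (transform_comps m E t) I =
    (\<Sum>K | length K = m. \<Sum>N | length N = m. (\<Prod>a<m. D $ (I ! a) $ (K ! a) * E $ (K ! a) $ (N ! a)) * t N)"
    unfolding transform_comps_def
    by (intro sum.cong refl) (simp add: sum_distrib_left prod.distrib mult.assoc)
  also have "\<dots> = (\<Sum>N | length N = m. (\<Sum>K | length K = m. \<Prod>a<m. D $ (I ! a) $ (K ! a) * E $ (K ! a) $ (N ! a)) * t N)"
    by (subst sum.swap) (simp add: sum_distrib_right)
  also have "\<dots> = transform_comps m (D ** E) t I"
    unfolding transform_comps_def matrix_matrix_mult_def
    using sum_lists_prod[of "\<lambda>a k. D $ (I ! a) $ k * E $ k $ (N ! a)" m for N] by simp
  finally show ?thesis .
qed

lemma transform_comps_cong: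
  "(\<And>K. length K = m \<Longrightarrow> t K = t' K) \<Longrightarrow> transform_comps m D t I = transform_comps m D t' I"
  unfolding transform_comps_def by (intro sum.cong) auto

lemma sym_tensorsD:
  assumes "t \<in> sym_tensors A m x"
  shows "\<not> (c \<in> A \<and> x \<in> chart_dom c \<and> length I = m) \<Longrightarrow> t c I = 0"
    and "c \<in> A \<Longrightarrow> d \<in> A \<Longrightarrow> x \<in> chart_dom c \<Longrightarrow> x \<in> chart_dom d \<Longrightarrow> length I = m \<Longrightarrow>
      t d I = transform_comps m (diff_matrix c d id x) (t c) I"
    and "mset I = mset I' \<Longrightarrow> t c I = t c I'"
  using assms unfolding sym_tensors_def by blast+

context atlas
begin

lemma smooth_tensor_morphism_extension:
  assumes "smooth_tensor_morphism A p q m T" "c \<in> A"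
  obtains W F where
    "\<And>I. length I = m \<Longrightarrow> open (W I)" "\<And>I. length I = m \<Longrightarrow> smooth_on (W I) (F I)"
    "\<And>I U g x. length I = m \<Longrightarrow> metric_on A p q U g \<Longrightarrow> x \<in> U \<Longrightarrow> x \<in> chart_dom c \<Longrightarrow>
      jet_coords c x g \<in> W I \<and> T (jet2 A p q x g) c I = F I (jet_coords c x g)"
proof -
  define Q where "Q I W F \<longleftrightarrow> open W \<and> smooth_on W F \<and>
      (\<forall>U g. metric_on A p q U g \<longrightarrow> (\<forall>x\<in>U \<inter> chart_dom c.
         jet_coords c x g \<in> W \<and> T (jet2 A p q x g) c I = F (jet_coords c x g)))" for I W F
  have "\<exists>W F. Q I W F" if "length I = m" for I
    using assms(1)[unfolded smooth_tensor_morphism_def, THEN conjunct2, rule_format, OF assms(2) that]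
    unfolding Q_def .
  then obtain W F where "\<And>I. length I = m \<Longrightarrow> Q I (W I) (F I)"
    by metis
  then show ?thesis
    by (intro that[of W F]) (simp_all add: Q_def)
qed

lemma jet2_in_J2M: "metric_on A p q U g \<Longrightarrow> x \<in> U \<Longrightarrow> jet2 A p q x g \<in> J2M A p q"
  unfolding J2M_def by blast

lemma tensor_in_sym_tensors:
  assumes "smooth_tensor_morphism A p q m T" "metric_on A p q U g" "x \<in> U"
  shows "T (jet2 A p q x g) \<in> sym_tensors A m x"
  using assms(1) jet2_in_J2M[OF assms(2,3)] unfolding smooth_tensor_morphism_def
  by (auto simp: jet2_def)

text \<open>Matrix fields on the image of the chart become metrics on the manifold by
  \<open>metric_from_chart\<close>; in this way the hypotheses on \<open>T\<close> turn into the
  assumptions of \<open>divergence_free_components\<close>.\<close>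

theorem tensor_eq_if_value_eq:
  assumes T: "smooth_tensor_morphism A p q m T" "divergence_free A p q m T" and m: "m \<ge> 3"
    and c: "c \<in> A" "x \<in> chart_dom c"
    and g: "metric_on A p q U g" "x \<in> U" and g': "metric_on A p q U' g'" "x \<in> U'"
    and eq: "g' c x = g c x" and I: "length I = m"
  shows "T (jet2 A p q x g') c I = T (jet2 A p q x g) c I"
proof -
  obtain W F where W: "\<And>I. length I = m \<Longrightarrow> open (W I)"
    and F: "\<And>I. length I = m \<Longrightarrow> smooth_on (W I) (F I)"
    and TF: "\<And>I U g x. length I = m \<Longrightarrow> metric_on A p q U g \<Longrightarrow> x \<in> U \<Longrightarrow> x \<in> chart_dom c \<Longrightarrow>
      jet_coords c x g \<in> W I \<and> T (jet2 A p q x g) c I = F I (jet_coords c x g)"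
    using smooth_tensor_morphism_extension[OF T(1) c(1)] by blast
  define C where "C = coord c ` chart_dom c"
  define germ where "germ S G \<longleftrightarrow> open S \<and> S \<subseteq> C \<and> smooth_on S G \<and> (\<forall>y\<in>S. has_signature p q (G y))"
    for S and G :: "real^'n \<Rightarrow> real^'n^'n"
  have metric: "metric_on A p q (chart_dom c \<inter> coord c -` S) (metric_from_chart c G)" if "germ S G" for S G
    using that by (intro metric_on_from_chart c) (auto simp: germ_def)
  have pt: "chart_inv c y \<in> chart_dom c" "coord c (chart_inv c y) = y"
    "chart_inv c y \<in> chart_dom c \<inter> coord c -` S" if "germ S G" "y \<in> S" for S G y
    using that chart_inv_in[of y c] coord_chart_inv[OF c(1), of y] by (auto simp: germ_def C_def)
  have comp: "metric_comp c (metric_from_chart c G) y = G y" if "germ S G" "y \<in> S" for S G y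
    using that by (intro metric_comp_metric_from_chart c) (auto simp: germ_def C_def)
  have jet: "jet_coords c (chart_inv c y) (metric_from_chart c G) = jet_at G y" if "germ S G" "y \<in> S" for S G y
    unfolding jet_coords_eq pt(2)[OF that]
    by (rule jet_at_cong[symmetric, of S]) (use that comp[OF that(1)] in \<open>auto simp: germ_def\<close>)
  have TG: "jet_at G y \<in> W I" "T (jet2 A p q (chart_inv c y) (metric_from_chart c G)) c I = F I (jet_at G y)"
    if "germ S G" "y \<in> S" "length I = m" for S G y I
    using TF[OF that(3) metric[OF that(1)] pt(3)[OF that(1,2)] pt(1)[OF that(1,2)]] jet[OF that(1,2)] by auto
  interpret divergence_free_components C p q m W F germ
  proof (unfold_locales, unfold germ_def[symmetric])
    show "m \<ge> 3" by (rule m)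
    show "open (W I)" if "length I = m" for I using W[OF that] .
    show "F I differentiable at j" if "length I = m" "j \<in> W I" for I j
      using smooth_on_differentiable[OF F[OF that(1)] that(2)] .
    show "jet_at G y \<in> W I" if "germ S G" "y \<in> S" "length I = m" for S G y I using TG(1)[OF that] .
    show "F I (jet_at G y) = F I' (jet_at G y)"
      if "germ S G" "y \<in> S" "length I = m" "mset I = mset I'" for S G y I I'
    proof -
      have l: "length I' = m" using that(3,4) by (metis mset_eq_length)
      have "T (jet2 A p q (chart_inv c y) (metric_from_chart c G)) \<in> sym_tensors A m (chart_inv c y)"
        by (rule tensor_in_sym_tensors[OF T(1) metric[OF that(1)] pt(3)[OF that(1,2)]])
      from sym_tensorsD(3)[OF this that(4)] show ?thesis
        unfolding TG(2)[OF that(1-3), symmetric] TG(2)[OF that(1,2) l, symmetric] .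
    qed
    show "(\<Sum>l\<in>UNIV. partial l (\<lambda>y. F (J @ [l]) (jet_at G y)) y +
         (\<Sum>a<m. \<Sum>k\<in>UNIV. christoffel (G y) (\<chi> k. partial k G y) $ ((J @ [l]) ! a) $ l $ k *
            F ((J @ [l])[a := k]) (jet_at G y))) = 0"
      if "germ S G" "y \<in> S" "length J = m - 1" for S G y J
    proof -
      let ?g = "metric_from_chart c G"
      have "divergence A p q T ?g c J (coord c (chart_inv c y)) = 0"
        using T(2) metric[OF that(1)] c(1) pt[OF that(1,2)] that(3)
        unfolding divergence_free_def by blast
      then have d: "divergence A p q T ?g c J y = 0" by (simp add: pt(2)[OF that(1,2)])
      have l: "length (J @ [l]) = m" for l using that(3) m by simp
      have tc: "tensor_comp A p q T ?g c I y = F I (jet_at G y)" if "length I = m" "y \<in> S" for I y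
        unfolding tensor_comp_def using TG(2)[OF \<open>germ S G\<close> that(2,1)] .
      have p: "partial l (tensor_comp A p q T ?g c (J @ [l])) y = partial l (\<lambda>y. F (J @ [l]) (jet_at G y)) y" for l
        by (rule partial_cong_open[of S]) (use that tc[OF l] in \<open>auto simp: germ_def\<close>)
      have p': "partial k (metric_comp c ?g) y = partial k G y" for k
        by (rule partial_cong_open[of S]) (use that comp[OF that(1)] in \<open>auto simp: germ_def\<close>)
      have "length ((J @ [l])[a := k]) = m" for l a k using l by simp
      then show ?thesis
        using d l tc[OF _ that(2)] unfolding divergence_def cov_deriv_def Let_def
        by (simp add: p p' comp[OF that(1,2)] del: length_append)
    qed
  qed
  define S where "S = coord c ` (U \<inter> U' \<inter> chart_dom c)"
  have S: "open S" "coord c x \<in> S" "S \<subseteq> C"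
    using open_coord_image[OF c(1), of "U \<inter> U'"] g g' c by (auto simp: S_def C_def metric_on_def)
  have G: "germ S (metric_comp c g)" if "metric_on A p q U1 g" "S \<subseteq> coord c ` (U1 \<inter> chart_dom c)" for g U1
    unfolding germ_def
    using S smooth_on_subset[OF metric_comp_smooth(2)[OF that(1) c(1)] that(2)]
      metric_comp_signature[OF that(1) c(1)] that(2) by blast
  have "F I (jet_at (metric_comp c g') (coord c x)) = F I (jet_at (metric_comp c g) (coord c x))"
  proof (rule F_eq_if_value_eq[OF G[OF g(1)] S(2) G[OF g'(1)] S(2) I])
    show "metric_comp c g' (coord c x) = metric_comp c g (coord c x)"
      using eq c by (simp add: metric_comp_def)
  qed (auto simp: S_def)
  then show ?thesis
    using TF[OF I g c(2)] TF[OF I g' c(2)] by (simp add: jet_coords_eq)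
qed

end

section \<open>Affine diffeomorphisms between charts\<close>

context atlas
begin

definition affine_map ::
  "('x, 'n) chart \<Rightarrow> real^'n \<Rightarrow> ('x, 'n) chart \<Rightarrow> real^'n \<Rightarrow> real^'n^'n \<Rightarrow> 'x \<Rightarrow> 'x" where
  "affine_map c y c' y' L u = chart_inv c' (y' + L *v (coord c u - y))"

text \<open>This largest possible domain makes the affine maps for \<open>L\<close> and for its
  inverse mutually inverse bijections between their domains.\<close>

definition affine_dom ::
  "('x, 'n) chart \<Rightarrow> real^'n \<Rightarrow> ('x, 'n) chart \<Rightarrow> real^'n \<Rightarrow> real^'n^'n \<Rightarrow> 'x set" where
  "affine_dom c y c' y' L =
    chart_dom c \<inter> coord c -` ((\<lambda>z. y' + L *v (z - y)) -` (coord c' ` chart_dom c'))"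

lemma smooth_affine: "open S \<Longrightarrow> smooth_on S (\<lambda>z. y' + L *v (z - y))" for y y' :: "real^'n"
  by (intro smooth_on_add smooth_on_const smooth_on_bounded_linear[OF _ matrix_vector_mul_bounded_linear]
      smooth_on_diff smooth_on_ident)

lemma open_affine_dom:
  assumes "c \<in> A" "c' \<in> A"
  shows "open (affine_dom c y c' y' L)"
proof -
  have "continuous_on UNIV (\<lambda>z. y' + L *v (z - y))"
    by (rule smooth_on_continuous_on[OF smooth_affine[OF open_UNIV]])
  from continuous_open_preimage[OF this open_UNIV chart(2)[OF assms(2)]]
  show ?thesis unfolding affine_dom_def by (intro open_chart_preimage assms(1)) simp
qed

lemma affine_map_in:
  assumes "c' \<in> A" "u \<in> affine_dom c y c' y' L"
  shows "affine_map c y c' y' L u \<in> chart_dom c'"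
    "coord c' (affine_map c y c' y' L u) = y' + L *v (coord c u - y)"
  using assms chart_inv_in[of _ c'] by (auto simp: affine_map_def affine_dom_def)

lemma affine_map_inverse:
  assumes "c \<in> A" "c' \<in> A" "M ** L = mat 1" "u \<in> affine_dom c y c' y' L"
  shows "affine_map c y c' y' L u \<in> affine_dom c' y' c y M"
    "affine_map c' y' c y M (affine_map c y c' y' L u) = u"
proof -
  note v = affine_map_in[OF assms(2,4)]
  have u: "u \<in> chart_dom c" using assms(4) by (simp add: affine_dom_def)
  have e: "y + M *v (coord c' (affine_map c y c' y' L u) - y') = coord c u"
    by (simp add: v(2) matrix_vector_mul_assoc assms(3))
  show "affine_map c y c' y' L u \<in> affine_dom c' y' c y M"
    using v(1) e u by (simp add: affine_dom_def)
  show "affine_map c' y' c y M (affine_map c y c' y' L u) = u"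
    unfolding affine_map_def[of c'] e using assms(1) u by simp
qed

lemma continuous_affine_map:
  assumes "c \<in> A" "c' \<in> A"
  shows "continuous_on (affine_dom c y c' y' L) (affine_map c y c' y' L)"
proof -
  have "continuous_on (affine_dom c y c' y' L) (coord c)"
    using homeomorphism_cont1[OF chart(3)[OF assms(1)]]
    by (rule continuous_on_subset) (auto simp: affine_dom_def)
  then have "continuous_on (affine_dom c y c' y' L) (\<lambda>u. y' + L *v (coord c u - y))"
    by (rule continuous_on_compose2[OF smooth_on_continuous_on[OF smooth_affine[OF open_UNIV]]]) simp
  then show ?thesis
    unfolding affine_map_def[abs_def]
    by (rule continuous_on_compose2[OF homeomorphism_cont2[OF chart(3)[OF assms(2)]]])
      (auto simp: affine_dom_def)
qed

lemma open_map_preimage: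
  assumes "open U" "continuous_on U f" "d \<in> A" "e \<in> A"
  shows "open (coord d ` (U \<inter> chart_dom d \<inter> f -` chart_dom e))"
proof -
  have "open (U \<inter> f -` chart_dom e)"
    by (rule continuous_open_preimage[OF assms(2,1) chart(1)[OF assms(4)]])
  from open_coord_image[OF assms(3) this] show ?thesis
    by (simp add: Int_ac)
qed

text \<open>Between charts \<open>d\<close> and \<open>e\<close> the map is a change of charts,
  followed by the affine map, followed by another change of charts.\<close>

lemma smooth_affine_map:
  assumes "c \<in> A" "c' \<in> A"
  shows "smooth_map_on A (affine_dom c y c' y' L) (affine_map c y c' y' L)"
  unfolding smooth_map_on_def
proof (intro conjI ballI)
  let ?U = "affine_dom c y c' y' L" and ?f = "affine_map c y c' y' L"
  show cont: "continuous_on ?U ?f" by (rule continuous_affine_map[OF assms])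
  fix d e assume de: "d \<in> A" "e \<in> A"
  let ?Z = "coord d ` (?U \<inter> chart_dom d \<inter> ?f -` chart_dom e)"
  let ?a = "\<lambda>z. y' + L *v (z - y)"
  have Z: "open ?Z" by (rule open_map_preimage[OF open_affine_dom[OF assms] cont de])
  have pt: "\<exists>u. u \<in> ?U \<and> u \<in> chart_dom c \<and> u \<in> chart_dom d \<and> ?f u \<in> chart_dom e \<and> z = coord d u \<and>
      chart_inv d z = u \<and> local_rep d c id z = coord c u \<and> ?a (local_rep d c id z) = coord c' (?f u) \<and>
      ?f u \<in> chart_dom c'" if z: "z \<in> ?Z" for z
  proof -
    obtain u where u: "u \<in> ?U" "u \<in> chart_dom d" "?f u \<in> chart_dom e" "z = coord d u"
      using z by blast
    then show ?thesis
      using affine_map_in[OF assms(2) u(1)] de by (auto simp: local_rep_def affine_dom_def)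
  qed
  have s1: "smooth_on ?Z (local_rep d c id)"
    by (rule smooth_on_subset[OF smooth_transition[OF de(1) assms(1)]]) (auto simp: affine_dom_def)
  have s2: "smooth_on ?Z (\<lambda>z. ?a (local_rep d c id z))"
    by (rule smooth_on_compose[OF Z _ s1 smooth_affine[OF open_UNIV]]) simp
  have im: "(\<lambda>z. ?a (local_rep d c id z)) ` ?Z \<subseteq> coord c' ` (chart_dom c' \<inter> chart_dom e)"
  proof (rule image_subsetI)
    fix z assume "z \<in> ?Z"
    from pt[OF this] show "?a (local_rep d c id z) \<in> coord c' ` (chart_dom c' \<inter> chart_dom e)"
      by auto
  qed
  have "smooth_on ?Z (\<lambda>z. local_rep c' e id (?a (local_rep d c id z)))"
    by (rule smooth_on_compose[OF Z im s2 smooth_transition[OF assms(2) de(2)]])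
  then show "smooth_on ?Z (local_rep d e ?f)"
  proof (rule smooth_on_cong[OF _ Z])
    fix z assume "z \<in> ?Z"
    from pt[OF this] show "local_rep c' e id (?a (local_rep d c id z)) = local_rep d e ?f z"
      using assms(2) by (auto simp: local_rep_def)
  qed
qed

text \<open>Serves the inverse of an affine map: \<open>diffeo\<close> speaks of
  \<open>inv_into\<close>, which is identified with an explicit affine map on the domain
  only.\<close>

lemma smooth_map_on_cong:
  assumes "open U" "smooth_map_on A U f" "\<And>x. x \<in> U \<Longrightarrow> f x = g x"
  shows "smooth_map_on A U g"
  unfolding smooth_map_on_def
proof (intro conjI ballI)
  have f: "continuous_on U f" using assms(2) unfolding smooth_map_on_def by blast
  then show "continuous_on U g" using assms(3) by (simp cong: continuous_on_cong)
  fix d e assume de: "d \<in> A" "e \<in> A"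
  have eq: "U \<inter> chart_dom d \<inter> g -` chart_dom e = U \<inter> chart_dom d \<inter> f -` chart_dom e"
    using assms(3) by auto
  have "smooth_on (coord d ` (U \<inter> chart_dom d \<inter> f -` chart_dom e)) (local_rep d e f)"
    using assms(2) de unfolding smooth_map_on_def by blast
  then show "smooth_on (coord d ` (U \<inter> chart_dom d \<inter> g -` chart_dom e)) (local_rep d e g)"
    unfolding eq
  proof (rule smooth_on_cong[OF _ open_map_preimage[OF assms(1) f de]])
    fix z assume "z \<in> coord d ` (U \<inter> chart_dom d \<inter> f -` chart_dom e)"
    then obtain u where "u \<in> U" "u \<in> chart_dom d" "z = coord d u" by blast
    then show "local_rep d e f z = local_rep d e g z" using de assms(3) by (simp add: local_rep_def)
  qed
qed

lemma smooth_map_differentiable: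
  assumes "smooth_map_on A U f" "d \<in> A" "e \<in> A" "x \<in> U" "x \<in> chart_dom d" "f x \<in> chart_dom e"
  shows "local_rep d e f differentiable (at (coord d x))"
proof -
  have "smooth_on (coord d ` (U \<inter> chart_dom d \<inter> f -` chart_dom e)) (local_rep d e f)"
    using assms(1-3) unfolding smooth_map_on_def by blast
  then show ?thesis by (rule smooth_on_differentiable) (use assms(4-6) in blast)
qed

lemma diff_matrix_smooth_comp_id:
  assumes "open U" "smooth_map_on A U f" "d \<in> A" "e \<in> A" "e' \<in> A" "x \<in> U" "x \<in> chart_dom d"
    "f x \<in> chart_dom e" "f x \<in> chart_dom e'"
  shows "diff_matrix d e' f x = diff_matrix e e' id (f x) ** diff_matrix d e f x"
proof -
  have f: "continuous_on U f" using assms(2) unfolding smooth_map_on_def by blast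
  have "diff_matrix d e' (id \<circ> f) x = diff_matrix e e' id (f x) ** diff_matrix d e f x"
  proof (rule diff_matrix_comp[OF assms(3,4,7) open_map_preimage[OF assms(1) f assms(3,4)]])
    show "coord d x \<in> coord d ` (U \<inter> chart_dom d \<inter> f -` chart_dom e)" using assms by blast
    show "f (chart_inv d y) \<in> chart_dom e" if "y \<in> coord d ` (U \<inter> chart_dom d \<inter> f -` chart_dom e)" for y
      using that assms(3) by auto
    show "local_rep d e f differentiable (at (coord d x))"
      by (rule smooth_map_differentiable[OF assms(2,3,4,6,7,8)])
    show "local_rep e e' id differentiable (at (coord e (f x)))"
      by (rule transition_differentiable[OF assms(4,5,8,9)])
  qed
  then show ?thesis by simp
qed

lemma diff_matrix_smooth_id_comp:
  assumes "smooth_map_on A U f" "d \<in> A" "d' \<in> A" "e \<in> A" "x \<in> U" "x \<in> chart_dom d" "x \<in> chart_dom d'"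
    "f x \<in> chart_dom e"
  shows "diff_matrix d e f x = diff_matrix d' e f x ** diff_matrix d d' id x"
proof -
  have "diff_matrix d e (f \<circ> id) x = diff_matrix d' e f (id x) ** diff_matrix d d' id x"
  proof (rule diff_matrix_comp[OF assms(2,3,6) open_overlap[OF assms(2,3)]])
    show "coord d x \<in> coord d ` (chart_dom d \<inter> chart_dom d')" using assms by blast
    show "id (chart_inv d y) \<in> chart_dom d'" if "y \<in> coord d ` (chart_dom d \<inter> chart_dom d')" for y
      using that assms(2) by auto
    show "local_rep d d' id differentiable (at (coord d x))"
      by (rule transition_differentiable[OF assms(2,3,6,7)])
    show "local_rep d' e f differentiable (at (coord d' (id x)))"
      using smooth_map_differentiable[OF assms(1,3,4,5,7,8)] by simp
  qed
  then show ?thesis by simp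
qed

lemma diff_matrix_affine:
  assumes "c \<in> A" "c' \<in> A" "u \<in> affine_dom c y c' y' L"
    and f: "\<And>v. v \<in> affine_dom c y c' y' L \<Longrightarrow> f v = affine_map c y c' y' L v"
  shows "diff_matrix c c' f u = L"
  unfolding diff_matrix_def
proof (rule jacobian_eqI)
  let ?U = "affine_dom c y c' y' L"
  have U: "?U \<subseteq> chart_dom c" by (auto simp: affine_dom_def)
  have o: "open (coord c ` ?U)"
    using open_coord_image[OF assms(1) open_affine_dom[OF assms(1,2)], of y y' L] U by (simp add: Int_absorb2)
  have d: "((\<lambda>z. y' + L *v (z - y)) has_derivative (*v) L) (at (coord c u))"
    by (rule derivative_eq_intros bounded_linear.has_derivative[OF matrix_vector_mul_bounded_linear] refl)+ simp
  show "(local_rep c c' f has_derivative (*v) L) (at (coord c u))"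
  proof (rule has_derivative_transform_within_open[OF d o])
    show "coord c u \<in> coord c ` ?U" using assms(3) by blast
    fix z assume "z \<in> coord c ` ?U"
    then obtain v where v: "v \<in> ?U" "z = coord c v" by blast
    then show "y' + L *v (z - y) = local_rep c c' f z"
      using subsetD[OF U v(1)] assms(1) by (simp add: local_rep_def f affine_map_in(2)[OF assms(2)])
  qed
qed

text \<open>An affine map has constant differential, so it carries a metric constant in
  \<open>c\<close> to one constant in \<open>c'\<close>. With equal charts and points this yields
  invariance under the orthogonal group of \<open>G\<close>; otherwise it links the values at any
  two points.\<close>

theorem natural_tensor_affine:
  assumes T: "smooth_tensor_morphism A p q m T" "natural_tensor A p q m T"
    and c: "c \<in> A" "x \<in> chart_dom c" and c': "c' \<in> A" "x' \<in> chart_dom c'"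
    and G: "has_signature p q G" and L: "M ** L = mat 1" "L ** M = mat 1" and I: "length I = m"
  shows "T (jet2 A p q x' (metric_from_chart c' (\<lambda>_. transpose M ** G ** M))) c' I =
    transform_comps m L (T (jet2 A p q x (metric_from_chart c (\<lambda>_. G))) c) I"
proof -
  define y y' where y: "y = coord c x" and y': "y' = coord c' x'"
  define g where "g = metric_from_chart c (\<lambda>_. G)"
  define h where "h = metric_from_chart c' (\<lambda>_. transpose M ** G ** M)"
  let ?U = "affine_dom c y c' y' L" and ?f = "affine_map c y c' y' L"
  let ?V = "affine_dom c' y' c y M" and ?s = "affine_map c' y' c y M"
  let ?i = "inv_into ?U ?f"
  have x: "x \<in> ?U" "?f x = x'"
    using c c' by (auto simp: affine_dom_def affine_map_def y y')
  have bij: "bij_betw ?f ?U ?V"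
    using affine_map_inverse[OF c(1) c'(1) L(1)] affine_map_inverse[OF c'(1) c(1) L(2)]
    by (intro bij_betw_byWitness[of _ ?s]) auto
  have x': "x' \<in> ?V" using bij x bij_betwE by metis
  have inv: "?i v = ?s v" if "v \<in> ?V" for v
    using affine_map_inverse[OF c'(1) c(1) L(2) that] bij_betw_imp_inj_on[OF bij]
    by (metis inv_into_f_eq)
  have V: "open ?V" by (rule open_affine_dom[OF c'(1) c(1)])
  have smi: "smooth_map_on A ?V ?i"
    by (rule smooth_map_on_cong[OF V smooth_affine_map[OF c'(1) c(1)]]) (simp add: inv)
  have diffeo: "diffeo A ?U ?V ?f"
    unfolding diffeo_def using open_affine_dom[OF c(1) c'(1)] V bij smooth_affine_map[OF c(1) c'(1)] smi
    by blast
  have g: "metric_on A p q (chart_dom c) g"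
    using metric_on_from_chart[OF c(1) open_UNIV smooth_on_const[OF open_UNIV], of p q G] G
    by (simp add: g_def)
  have push: "push_metric A ?U ?f g d v = h d v" if d: "d \<in> A" and v: "v \<in> ?V" "v \<in> chart_dom d" for d v
  proof -
    define u where "u = ?i v"
    \<comment> \<open>\<open>push_metric\<close> uses this arbitrary chart at the preimage; the
      chain rule below trades it for \<open>c\<close>.\<close>
    define e where "e = chart_at A u"
    have e: "e \<in> A" "u \<in> chart_dom e" using chart_at by (auto simp: e_def)
    have vc: "v \<in> chart_dom c'" using v by (simp add: affine_dom_def)
    have uc: "u \<in> chart_dom c"
      using affine_map_in(1)[OF c(1) v(1)] inv[OF v(1)] by (simp add: u_def)
    have 1: "diff_matrix d c ?i v = diff_matrix e c id u ** diff_matrix d e ?i v"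
      unfolding u_def
      by (rule diff_matrix_smooth_comp_id[OF V smi d e(1) c(1) v]) (use e uc in \<open>auto simp: u_def\<close>)
    have 2: "diff_matrix d c ?i v = diff_matrix c' c ?i v ** diff_matrix d c' id v"
      by (rule diff_matrix_smooth_id_comp[OF smi d c'(1) c(1) v vc]) (use uc in \<open>simp add: u_def\<close>)
    have 3: "diff_matrix c' c ?i v = M"
      by (rule diff_matrix_affine[OF c'(1) c(1) v(1) inv])
    have "push_metric A ?U ?f g d v = transpose (diff_matrix d e ?i v) ** g e u ** diff_matrix d e ?i v"
      by (simp add: push_metric_def Let_def u_def e_def)
    also have "\<dots> = transpose (diff_matrix d c ?i v) ** G ** diff_matrix d c ?i v"
      unfolding 1 by (simp add: g_def metric_from_chart_def matrix_transpose_mul matrix_mul_assoc)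
    also have "\<dots> = h d v"
      unfolding 2 3 by (simp add: h_def metric_from_chart_def matrix_transpose_mul matrix_mul_assoc)
    finally show ?thesis .
  qed
  \<comment> \<open>The two metrics are known to agree on the open set \<open>?V\<close>, which
    suffices for their jets at \<open>x'\<close>.\<close>
  have "jet_coords d x' (push_metric A ?U ?f g) = jet_coords d x' h" if d: "d \<in> A" "x' \<in> chart_dom d" for d
  proof -
    have Z: "open (coord d ` (?V \<inter> chart_dom d))" by (rule open_coord_image[OF d(1) V])
    have "jet_at (metric_comp d h) (coord d x') = jet_at (metric_comp d (push_metric A ?U ?f g)) (coord d x')"
    proof (rule jet_at_cong[OF Z])
      fix z assume "z \<in> coord d ` (?V \<inter> chart_dom d)"
      then obtain v where "v \<in> ?V" "v \<in> chart_dom d" "z = coord d v" by blast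
      then show "metric_comp d h z = metric_comp d (push_metric A ?U ?f g) z"
        using push[OF d(1)] d(1) by (simp add: metric_comp_def)
    qed (use d x' in blast)
    then show ?thesis by (simp add: jet_coords_eq)
  qed
  then have jet: "jet2 A p q x' (push_metric A ?U ?f g) = jet2 A p q x' h"
    by (auto simp: jet2_def)
  define e where "e = chart_at A x"
  have e: "e \<in> A" "x \<in> chart_dom e" using chart_at by (auto simp: e_def)
  let ?t = "T (jet2 A p q x g)"
  have t: "?t \<in> sym_tensors A m x" by (rule tensor_in_sym_tensors[OF T(1) g c(2)])
  have "T (jet2 A p q (?f x) (push_metric A ?U ?f g)) = push_tensor A m ?f x ?t"
    using T(2) diffeo g x(1) c(2) unfolding natural_tensor_def by blast
  then have "T (jet2 A p q x' h) c' I = transform_comps m (diff_matrix e c' ?f x) (?t e) I"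
    using c' I by (simp add: x jet push_tensor_def Let_def e_def)
  also have "\<dots> = transform_comps m (diff_matrix e c' ?f x) (transform_comps m (diff_matrix c e id x) (?t c)) I"
    by (intro transform_comps_cong sym_tensorsD(2)[OF t] c e)
  also have "\<dots> = transform_comps m (diff_matrix c c' ?f x) (?t c) I"
    using diff_matrix_smooth_id_comp[OF smooth_affine_map[OF c(1) c'(1)] c(1) e(1) c'(1) x(1) c(2) e(2)]
      x(2) c'(2) by (simp add: transform_comps_mult)
  also have "diff_matrix c c' ?f x = L"
    by (rule diff_matrix_affine[OF c(1) c'(1) x(1)]) simp
  finally show ?thesis by (simp add: g_def h_def)
qed

end

section \<open>Symmetric tensors as polynomials\<close>

text \<open>The homogeneous polynomial on covectors \<open>\<xi>\<close> attached to a contravariant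
  tensor; a change of components by \<open>L\<close> becomes the substitution of
  \<open>transpose L *v \<xi>\<close>.\<close>

definition eval_comps :: "nat \<Rightarrow> ('i::finite list \<Rightarrow> real) \<Rightarrow> real^'i \<Rightarrow> real" where
  "eval_comps m t \<xi> = (\<Sum>I | length I = m. t I * (\<Prod>a<m. \<xi> $ (I ! a)))"

lemma eval_comps_0: "eval_comps 0 t \<xi> = t []"
  by (simp add: eval_comps_def)

lemma eval_comps_Suc:
  "eval_comps (Suc m) t \<xi> = (\<Sum>k\<in>UNIV. \<xi> $ k * eval_comps m (\<lambda>K. t (k # K)) \<xi>)"
  unfolding eval_comps_def sum_lists_Suc prod.lessThan_Suc_shift
  by (simp add: sum_distrib_left mult_ac)

lemma eval_comps_cmult: "eval_comps m (\<lambda>I. r * t I) \<xi> = r * eval_comps m t \<xi>"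
  by (simp add: eval_comps_def sum_distrib_left mult.assoc)

lemma eval_comps_diff: "eval_comps m (\<lambda>I. t I - u I) \<xi> = eval_comps m t \<xi> - eval_comps m u \<xi>"
  by (simp add: eval_comps_def left_diff_distrib sum_subtractf)

lemma eval_comps_scaleR: "eval_comps m t (s *\<^sub>R \<xi>) = s ^ m * eval_comps m t \<xi>"
  by (simp add: eval_comps_def prod.distrib sum_distrib_left mult_ac)

lemma eval_comps_cong:
  "(\<And>I. length I = m \<Longrightarrow> t I = u I) \<Longrightarrow> eval_comps m t \<xi> = eval_comps m u \<xi>"
  unfolding eval_comps_def by (intro sum.cong) auto

lemma eval_transform_comps:
  "eval_comps m (transform_comps m L t) \<xi> = eval_comps m t (transpose L *v \<xi>)"
proof -
  have "eval_comps m (transform_comps m L t) \<xi> =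
    (\<Sum>K | length K = m. \<Sum>I | length I = m. t K * (\<Prod>a<m. L $ (I ! a) $ (K ! a) * \<xi> $ (I ! a)))"
    unfolding eval_comps_def transform_comps_def
    by (subst sum.swap) (simp add: sum_distrib_left sum_distrib_right prod.distrib mult_ac)
  also have "\<dots> = (\<Sum>K | length K = m. t K * (\<Prod>a<m. \<Sum>i\<in>UNIV. L $ i $ (K ! a) * \<xi> $ i))"
    using sum_lists_prod[of "\<lambda>a i. L $ i $ (K ! a) * \<xi> $ i" m for K]
    by (simp add: sum_distrib_left[symmetric])
  also have "\<dots> = eval_comps m t (transpose L *v \<xi>)"
    by (simp add: eval_comps_def matrix_vector_mult_def transpose_def)
  finally show ?thesis .
qed

definition sym_comps :: "nat \<Rightarrow> ('i list \<Rightarrow> real) \<Rightarrow> bool" where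
  "sym_comps m t \<longleftrightarrow> (\<forall>I I'. length I = m \<longrightarrow> mset I = mset I' \<longrightarrow> t I = t I')"

lemma sym_comps_Cons: "sym_comps (Suc m) t \<Longrightarrow> sym_comps m (\<lambda>K. t (k # K))"
  by (simp add: sym_comps_def)

text \<open>By symmetry each of the \<open>Suc m\<close> slots contributes the same derivative as
  the first one, whence the factor.\<close>

lemma has_derivative_eval_comps:
  assumes "sym_comps (Suc m) t"
  shows "(eval_comps (Suc m) t has_derivative
    (\<lambda>v. real (Suc m) * (\<Sum>k\<in>UNIV. v $ k * eval_comps m (\<lambda>K. t (k # K)) \<xi>))) (at \<xi>)"
  using assms
proof (induction m arbitrary: t)
  case 0
  have "((\<lambda>\<xi>. \<Sum>k\<in>UNIV. \<xi> $ k * t [k]) has_derivative (\<lambda>v. \<Sum>k\<in>UNIV. v $ k * t [k])) (at \<xi>)"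
    by (intro has_derivative_sum has_derivative_mult_left bounded_linear.has_derivative[OF bounded_linear_vec_nth]
        has_derivative_ident)
  then show ?case by (simp add: eval_comps_Suc[abs_def] eval_comps_0)
next
  case (Suc m)
  let ?D = "\<lambda>k v. real (Suc m) * (\<Sum>l\<in>UNIV. v $ l * eval_comps m (\<lambda>K. t (k # l # K)) \<xi>)"
  let ?e = "\<lambda>k. eval_comps (Suc m) (\<lambda>K. t (k # K)) \<xi>"
  have IH: "(eval_comps (Suc m) (\<lambda>K. t (k # K)) has_derivative ?D k) (at \<xi>)" for k
    by (rule Suc.IH[OF sym_comps_Cons[OF Suc.prems]])
  have "((\<lambda>\<xi>. \<Sum>k\<in>UNIV. \<xi> $ k * eval_comps (Suc m) (\<lambda>K. t (k # K)) \<xi>) has_derivative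
      (\<lambda>v. \<Sum>k\<in>UNIV. \<xi> $ k * ?D k v + v $ k * ?e k)) (at \<xi>)"
    by (intro has_derivative_sum has_derivative_mult IH has_derivative_ident
        bounded_linear.has_derivative[OF bounded_linear_vec_nth])
  moreover have "(\<Sum>k\<in>UNIV. \<xi> $ k * ?D k v + v $ k * ?e k) = real (Suc (Suc m)) * (\<Sum>k\<in>UNIV. v $ k * ?e k)" for v
  proof -
    have sym: "eval_comps m (\<lambda>K. t (k # l # K)) \<xi> = eval_comps m (\<lambda>K. t (l # k # K)) \<xi>" for k l
      by (rule eval_comps_cong) (use Suc.prems in \<open>simp add: sym_comps_def\<close>)
    have "(\<Sum>k\<in>UNIV. \<xi> $ k * ?D k v) =
      real (Suc m) * (\<Sum>k\<in>UNIV. \<Sum>l\<in>UNIV. v $ l * (\<xi> $ k * eval_comps m (\<lambda>K. t (k # l # K)) \<xi>))"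
      by (simp only: sum_distrib_left mult_ac)
    also have "\<dots> = real (Suc m) * (\<Sum>l\<in>UNIV. v $ l * ?e l)"
      by (subst sum.swap) (simp add: eval_comps_Suc sum_distrib_left sym)
    finally show ?thesis by (simp add: sum.distrib algebra_simps)
  qed
  ultimately show ?case by (simp add: eval_comps_Suc[of "Suc m", abs_def])
qed

text \<open>Differentiating along the axis \<open>k\<close> fixes the first index to
  \<open>k\<close>, up to a nonzero factor; repeating this recovers every component, so vanishing on
  an open set is enough.\<close>

lemma comps_eq_0_if_eval_eq_0:
  assumes "open S" "\<xi> \<in> S" "\<And>\<xi>. \<xi> \<in> S \<Longrightarrow> eval_comps m t \<xi> = 0" "sym_comps m t" "length I = m"
  shows "t I = 0"
  using assms(3-5)
proof (induction m arbitrary: t I)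
  case 0
  then show ?case using assms(2) by (simp add: eval_comps_0)
next
  case (Suc m)
  obtain k K where I: "I = k # K" "length K = m" using Suc.prems(3) by (auto simp: length_Suc_conv)
  have "eval_comps m (\<lambda>K. t (k # K)) \<xi> = 0" if "\<xi> \<in> S" for \<xi>
  proof -
    have "(eval_comps (Suc m) t has_derivative (\<lambda>v. 0)) (at \<xi>)"
      by (rule has_derivative_transform_within_open[OF has_derivative_const[of 0] assms(1) that])
        (simp add: Suc.prems(1))
    from has_derivative_unique[OF this has_derivative_eval_comps[OF Suc.prems(2)]]
    have "(\<Sum>l\<in>UNIV. axis k 1 $ l * eval_comps m (\<lambda>K. t (l # K)) \<xi>) = 0"
      by (simp add: fun_eq_iff del: of_nat_Suc)
    then show ?thesis by (simp add: axis_def if_distrib[of "\<lambda>x. x * _"] cong: if_cong)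
  qed
  from Suc.IH[OF this sym_comps_Cons[OF Suc.prems(2)] I(2)] show ?case by (simp add: I)
qed

lemma comps_eq_if_eval_eq:
  assumes "open S" "\<xi> \<in> S" "\<And>\<xi>. \<xi> \<in> S \<Longrightarrow> eval_comps m t \<xi> = eval_comps m u \<xi>"
    "sym_comps m t" "sym_comps m u" "length I = m"
  shows "t I = u I"
proof -
  have "sym_comps m (\<lambda>I. t I - u I)"
    using assms(4,5) unfolding sym_comps_def by metis
  from comps_eq_0_if_eval_eq_0[OF assms(1,2) _ this assms(6)] show ?thesis
    by (simp add: eval_comps_diff assms(3))
qed

lemma sym_comps_symmetrize: "sym_comps m (symmetrize m t)"
  unfolding sym_comps_def
proof (intro allI impI)
  fix I I' :: "'a list" assume I: "length I = m" "mset I = mset I'"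
  obtain \<pi> where p: "\<pi> permutes {..<length I}" "permute_list \<pi> I = I'"
    using mset_eq_permutation[of I' I] I by metis
  have "(\<Sum>\<sigma> | \<sigma> permutes {..<m}. t (permute_list \<sigma> I')) =
    (\<Sum>\<sigma> | \<sigma> permutes {..<m}. t (permute_list (\<pi> \<circ> \<sigma>) I))"
    using I by (intro sum.cong) (auto simp: permute_list_compose p(2))
  also have "\<dots> = (\<Sum>\<sigma> | \<sigma> permutes {..<m}. t (permute_list \<sigma> I))"
    using p(1) I(1) by (subst setum_permutations_compose_left[of \<pi>]) auto
  finally show "symmetrize m t I = symmetrize m t I'" by (simp add: symmetrize_def)
qed

text \<open>The monomial attached to an index list depends only on the multiset of indices, so every
  permutation contributes the same sum.\<close>

lemma eval_symmetrize: "eval_comps m (symmetrize m t) \<xi> = eval_comps m t \<xi>"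
proof -
  define w where "w I = (\<Prod>a<m. \<xi> $ (I ! a))" for I
  have w: "w I = prod_mset (image_mset (($) \<xi>) (mset I))" if "length I = m" for I
  proof -
    have "w I = prod_list (map (($) \<xi>) I)"
      using that by (simp add: w_def prod.list_conv_set_nth lessThan_atLeast0)
    then show ?thesis by (simp flip: prod_mset_prod_list)
  qed
  have 1: "(\<Sum>I | length I = m. t (permute_list \<sigma> I) * w I) = (\<Sum>I | length I = m. t I * w I)"
    if s: "\<sigma> permutes {..<m}" for \<sigma>
  proof (rule sum.reindex_bij_witness[where i = "permute_list (inv \<sigma>)" and j = "permute_list \<sigma>"])
    note s' = permutes_inv[OF s]
    fix I :: "'a list" assume "I \<in> {I. length I = m}"
    then have I: "length I = m" by simp
    show "permute_list (inv \<sigma>) (permute_list \<sigma> I) = I" "permute_list \<sigma> (permute_list (inv \<sigma>) I) = I"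
      using s s' I by (simp_all add: permute_list_compose[symmetric] permutes_inv_o)
    show "permute_list \<sigma> I \<in> {I. length I = m}" "permute_list (inv \<sigma>) I \<in> {I. length I = m}"
      using I by simp_all
    have "w (permute_list \<sigma> I) = w I" using s I by (simp add: w)
    then show "t (permute_list \<sigma> I) * w (permute_list \<sigma> I) = t (permute_list \<sigma> I) * w I" by simp
  qed
  have "eval_comps m (symmetrize m t) \<xi> =
    (\<Sum>\<sigma> | \<sigma> permutes {..<m}. \<Sum>I | length I = m. t (permute_list \<sigma> I) * w I) / fact m"
    unfolding eval_comps_def symmetrize_def w_def[symmetric]
    by (subst sum.swap) (simp add: sum_distrib_right sum_divide_distrib)
  also have "\<dots> = (\<Sum>I | length I = m. t I * w I)"
    by (simp add: 1 card_permutations[OF refl])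
  finally show ?thesis by (simp add: eval_comps_def w_def)
qed

text \<open>Together with \<open>eval_symmetrize\<close>: in polynomial terms
  \<open>S_tensor\<close> is the \<open>k\<close>-th power of the quadratic form of the dual
  metric.\<close>

lemma eval_tensor_power: "eval_comps (2 * k) (tensor_power k B) \<xi> = (\<xi> \<bullet> (B *v \<xi>)) ^ k"
proof (induction k)
  case 0
  show ?case by (simp add: eval_comps_0 tensor_power_def)
next
  case (Suc k)
  have tp: "tensor_power (Suc k) B (i # j # K) = B $ i $ j * tensor_power k B K" for i j K
    unfolding tensor_power_def prod.lessThan_Suc_shift by simp
  have "eval_comps (2 * Suc k) (tensor_power (Suc k) B) \<xi> =
    (\<Sum>i\<in>UNIV. \<xi> $ i * (\<Sum>j\<in>UNIV. \<xi> $ j * (B $ i $ j * eval_comps (2 * k) (tensor_power k B) \<xi>)))"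
    by (simp add: eval_comps_Suc tp eval_comps_cmult)
  also have "\<dots> = (\<xi> \<bullet> (B *v \<xi>)) * eval_comps (2 * k) (tensor_power k B) \<xi>"
    by (simp add: inner_vec_def matrix_vector_mult_def sum_distrib_left sum_distrib_right mult_ac)
  finally show ?case by (simp add: Suc.IH)
qed

section \<open>Invariant symmetric tensors\<close>

lemma inner_transpose: "(transpose R *v x) \<bullet> y = x \<bullet> (R *v y)" for R :: "real^'n::finite^'m::finite"
  by (simp add: dot_lmul_matrix)

lemma matrix_eqI_inner:
  fixes B C :: "real^'n::finite^'m::finite"
  assumes "\<And>\<xi> \<zeta>. \<xi> \<bullet> (B *v \<zeta>) = \<xi> \<bullet> (C *v \<zeta>)"
  shows "B = C"
proof -
  have "B *v \<zeta> = C *v \<zeta>" for \<zeta> using assms vector_eq_ldot by blast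
  then show ?thesis by (simp add: matrix_eq)
qed

text \<open>By polarisation a symmetric form that vanishes on the diagonal is zero, which
  contradicts invertibility.\<close>

lemma quadratic_form_nonzero:
  fixes B :: "real^'n::finite^'n"
  assumes B: "invertible B" "transpose B = B"
  obtains \<xi> where "\<xi> \<bullet> (B *v \<xi>) \<noteq> 0"
proof (rule ccontr)
  assume "\<not> thesis"
  then have 0: "\<xi> \<bullet> (B *v \<xi>) = 0" for \<xi> using that by blast
  have sym: "\<xi> \<bullet> (B *v \<zeta>) = \<zeta> \<bullet> (B *v \<xi>)" for \<xi> \<zeta>
    using inner_transpose[of B \<xi> \<zeta>] B(2) by (simp add: inner_commute)
  have "B *v \<zeta> = 0" for \<zeta>
  proof -
    have "\<xi> \<bullet> (B *v \<zeta>) = 0" for \<xi>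
      using 0[of "\<xi> + \<zeta>"] 0[of \<xi>] 0[of \<zeta>] sym[of \<zeta> \<xi>]
      by (simp add: matrix_vector_right_distrib inner_add_left inner_add_right)
    from this[of "B *v \<zeta>"] show ?thesis by simp
  qed
  then have "matrix_inv B *v (B *v axis undefined 1) = 0" by simp
  then show False
    by (simp add: matrix_vector_mul_assoc matrix_inv_mult(1)[OF B(1)] axis_eq_0_iff)
qed

text \<open>The orthogonal group acts transitively, up to sign, on each nonempty level set of the quadratic form
  (by reflections), so an invariant polynomial of even degree is a multiple of a power of the form on an
  open set.\<close>

lemma orthogonal_map_to_multiple:
  fixes B :: "real^'n::finite^'n"
  assumes B: "transpose B = B" and eq: "\<zeta> \<bullet> (B *v \<zeta>) = \<xi> \<bullet> (B *v \<xi>)" "\<xi> \<bullet> (B *v \<xi>) \<noteq> 0"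
  obtains R where "transpose R ** B ** R = B" "R *v \<xi> = \<zeta> \<or> R *v \<xi> = - \<zeta>"
proof -
  define b where "b x y = x \<bullet> (B *v y)" for x y
  interpret b: bounded_bilinear b
    unfolding b_def by (rule bounded_bilinear.comp[OF bounded_bilinear_inner bounded_linear_ident matrix_vector_mul_bounded_linear])
  have bsym: "b x y = b y x" for x y
    using inner_transpose[of B x y] B by (simp add: b_def inner_commute)
  \<comment> \<open>\<open>f\<close> is the reflection along \<open>\<eta>\<close>; the second
    condition says that its coefficient at \<open>\<xi>\<close> is 1.\<close>
  have refl: "\<exists>R. transpose R ** B ** R = B \<and> R *v \<xi> = \<xi> - \<eta>"
    if \<eta>: "b \<eta> \<eta> \<noteq> 0" "b \<eta> \<eta> = 2 * b \<eta> \<xi>" for \<eta>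
  proof -
    define f where "f x = x - (2 * b \<eta> x / b \<eta> \<eta>) *\<^sub>R \<eta>" for x
    have "linear f"
      by (rule linearI) (simp_all add: f_def b.add_right b.scaleR_right algebra_simps add_divide_distrib)
    then have R: "matrix f *v x = f x" for x by (simp add: matrix_works)
    have inv: "b (f x) (f y) = b x y" for x y
      using \<eta>(1) bsym[of x \<eta>]
      by (simp add: f_def b.diff_left b.diff_right b.scaleR_left b.scaleR_right field_simps)
    have "transpose (matrix f) ** B ** matrix f = B"
    proof (rule matrix_eqI_inner)
      fix x y
      have "x \<bullet> (transpose (matrix f) ** B ** matrix f *v y) = (transpose (matrix f) *v (B *v (matrix f *v y))) \<bullet> x"
        unfolding matrix_vector_mul_assoc matrix_mul_assoc by (rule inner_commute)
      also have "\<dots> = b (f x) (f y)"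
        unfolding inner_transpose R b_def by (rule inner_commute)
      finally show "x \<bullet> (transpose (matrix f) ** B ** matrix f *v y) = x \<bullet> (B *v y)"
        unfolding inv unfolding b_def .
    qed
    moreover have "matrix f *v \<xi> = \<xi> - \<eta>" using \<eta> by (simp add: R f_def)
    ultimately show ?thesis by blast
  qed
  show ?thesis
  \<comment> \<open>By the parallelogram identity \<open>\<xi> - \<zeta>\<close> and
    \<open>\<xi> + \<zeta>\<close> are not both isotropic. The reflection along the first sends
    \<open>\<xi>\<close> to \<open>\<zeta>\<close>, along the second to
    \<open>- \<zeta>\<close>.\<close>
  proof (cases "b (\<xi> - \<zeta>) (\<xi> - \<zeta>) = 0")
    case False
    have "b (\<xi> - \<zeta>) (\<xi> - \<zeta>) = 2 * b (\<xi> - \<zeta>) \<xi>"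
      using eq bsym[of \<xi> \<zeta>] by (simp add: b.diff_left b.diff_right) (simp add: b_def)
    from refl[OF False this] show ?thesis using that by auto
  next
    case True
    have 2: "b (\<xi> + \<zeta>) (\<xi> + \<zeta>) = 2 * b (\<xi> + \<zeta>) \<xi>"
      using eq bsym[of \<xi> \<zeta>] by (simp add: b.add_left b.add_right) (simp add: b_def)
    have "b (\<xi> + \<zeta>) (\<xi> + \<zeta>) = 4 * b \<xi> \<xi>"
      using True eq bsym[of \<xi> \<zeta>] by (simp add: b.add_left b.add_right b.diff_left b.diff_right) (simp add: b_def)
    with eq(2) have "b (\<xi> + \<zeta>) (\<xi> + \<zeta>) \<noteq> 0" by (simp add: b_def)
    from refl[OF this 2] show ?thesis using that by auto
  qed
qed

lemma invariant_symmetric_tensor: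
  fixes B :: "real^'n::finite^'n"
  assumes B: "invertible B" "transpose B = B" and t: "sym_comps (2 * k) t"
    and inv: "\<And>R \<xi>. transpose R ** B ** R = B \<Longrightarrow> eval_comps (2 * k) t (R *v \<xi>) = eval_comps (2 * k) t \<xi>"
  obtains r where "\<And>I. length I = 2 * k \<Longrightarrow> t I = r * symmetrize (2 * k) (tensor_power k B) I"
proof -
  define Q where "Q \<xi> = \<xi> \<bullet> (B *v \<xi>)" for \<xi>
  let ?P = "eval_comps (2 * k) t"
  obtain \<xi>0 where \<xi>0: "Q \<xi>0 \<noteq> 0" using quadratic_form_nonzero[OF B] unfolding Q_def by blast
  define r where "r = ?P \<xi>0 / Q \<xi>0 ^ k"
  \<comment> \<open>The vectors at which the form has the same sign as at \<open>\<xi>0\<close>: an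
    open set, and every level of the form on it is reached by a real multiple of
    \<open>\<xi>0\<close>.\<close>
  define S where "S = {\<xi>. Q \<xi> * Q \<xi>0 > 0}"
  have "continuous_on UNIV Q" unfolding Q_def
    by (intro continuous_intros)
  then have "open S" unfolding S_def by (intro open_Collect_less continuous_intros)
  moreover have "\<xi>0 \<in> S" using \<xi>0 by (simp add: S_def zero_less_mult_iff) (metis linorder_neqE)
  moreover have "?P \<xi> = eval_comps (2 * k) (\<lambda>I. r * symmetrize (2 * k) (tensor_power k B) I) \<xi>" if "\<xi> \<in> S" for \<xi>
  proof -
    define s where "s = sqrt (Q \<xi> / Q \<xi>0)"
    have pos: "Q \<xi> / Q \<xi>0 > 0" using that by (simp add: S_def zero_less_divide_iff zero_less_mult_iff)
    have s2: "s * s = Q \<xi> / Q \<xi>0" unfolding s_def using pos by (metis less_imp_le power2_eq_square real_sqrt_pow2)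
    have "Q (s *\<^sub>R \<xi>0) = s * s * Q \<xi>0" by (simp add: Q_def matrix_vector_mult_scaleR)
    then have "Q (s *\<^sub>R \<xi>0) = Q \<xi>" using \<xi>0 s2 by simp
    moreover have "Q \<xi> \<noteq> 0" using that by (auto simp: S_def)
    ultimately obtain R where R: "transpose R ** B ** R = B" "R *v \<xi> = s *\<^sub>R \<xi>0 \<or> R *v \<xi> = - (s *\<^sub>R \<xi>0)"
      using orthogonal_map_to_multiple[OF B(2)] unfolding Q_def by blast
    have "?P \<xi> = ?P (R *v \<xi>)" by (simp add: inv[OF R(1)])
    \<comment> \<open>The even degree absorbs the sign left open by \<open>R\<close>.\<close>
    also have "\<dots> = s ^ (2 * k) * ?P \<xi>0"
      using R(2) eval_comps_scaleR[of "2 * k" t s \<xi>0] eval_comps_scaleR[of "2 * k" t "- s" \<xi>0] by auto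
    also have "s ^ (2 * k) = (Q \<xi> / Q \<xi>0) ^ k" by (simp add: power_mult power2_eq_square s2)
    also have "\<dots> * ?P \<xi>0 = r * Q \<xi> ^ k" by (simp add: r_def power_divide)
    finally show ?thesis
      by (simp add: eval_comps_cmult eval_symmetrize eval_tensor_power Q_def)
  qed
  moreover have "sym_comps (2 * k) (\<lambda>I. r * symmetrize (2 * k) (tensor_power k B) I)"
    using sym_comps_symmetrize[of "2 * k" "tensor_power k B"] unfolding sym_comps_def by metis
  ultimately show ?thesis
    using comps_eq_if_eval_eq[of S \<xi>0 "2 * k" t "\<lambda>I. r * symmetrize (2 * k) (tensor_power k B) I"] t that
    by blast
qed

section \<open>One factor for all metrics of the signature\<close>

text \<open>In suitable bases both forms are diagonal with equally many entries 1 and equally many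
  entries -1; permuting one basis matches them.\<close>

lemma same_signature_congruent:
  fixes G0 G :: "real^'n::finite^'n"
  assumes "has_signature p q G0" "has_signature p q G"
  obtains M where "invertible M" "G = transpose M ** G0 ** M"
proof -
  define diag where "diag e = (\<chi> i j. if i = j then e i else 0)" for e :: "'n \<Rightarrow> real"
  obtain P0 :: "real^'n^'n" and e0 where P0: "invertible P0" "transpose P0 ** G0 ** P0 = diag e0"
    and e0: "\<And>i. e0 i = 1 \<or> e0 i = -1" "card {i. e0 i = 1} = p" "card {i. e0 i = -1} = q"
    using assms(1) unfolding has_signature_def diag_def by blast
  obtain P :: "real^'n^'n" and e where P: "invertible P" "transpose P ** G ** P = diag e"
    and e: "\<And>i. e i = 1 \<or> e i = -1" "card {i. e i = 1} = p" "card {i. e i = -1} = q"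
    using assms(2) unfolding has_signature_def diag_def by blast
  obtain f1 where f1: "bij_betw f1 {i. e i = 1} {i. e0 i = 1}"
    using finite_same_card_bij[of "{i. e i = 1}" "{i. e0 i = 1}"] e e0 by auto
  obtain f2 where f2: "bij_betw f2 {i. e i = -1} {i. e0 i = -1}"
    using finite_same_card_bij[of "{i. e i = -1}" "{i. e0 i = -1}"] e e0 by auto
  define \<pi> where "\<pi> i = (if e i = 1 then f1 i else f2 i)" for i
  have \<pi>e: "e0 (\<pi> i) = e i" for i
    using bij_betwE[OF f1] bij_betwE[OF f2] e(1)[of i] by (auto simp: \<pi>_def)
  have "inj \<pi>"
  proof (rule injI)
    fix i j assume ij: "\<pi> i = \<pi> j"
    then have "e i = e j" using \<pi>e by metis
    then show "i = j"
      using ij e(1)[of i] inj_onD[OF bij_betw_imp_inj_on[OF f1], of i j] inj_onD[OF bij_betw_imp_inj_on[OF f2], of i j]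
      by (auto simp: \<pi>_def)
  qed
  \<comment> \<open>The permutation matrix of \<open>\<pi>\<close>; the case of a diagonal with all
    entries 1 then shows that it is orthogonal.\<close>
  define E where "E = ((\<chi> a i. delta a (\<pi> i)) :: real^'n^'n)"
  have E: "transpose E ** diag f ** E = diag (f \<circ> \<pi>)" for f
  proof -
    have "diag f ** E = (\<chi> a i. f a * delta a (\<pi> i))"
      by (simp add: matrix_matrix_mult_def diag_def E_def vec_eq_iff if_distrib[of "\<lambda>x. x * _"] cong: if_cong)
    moreover have "f (\<pi> i) * delta (\<pi> i) (\<pi> j) = (if i = j then f (\<pi> i) else 0)" for i j
      using injD[OF \<open>inj \<pi>\<close>] by (auto simp: delta_def)
    ultimately show ?thesis
      by (simp add: matrix_mul_assoc[symmetric])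
        (simp add: matrix_matrix_mult_def transpose_def E_def vec_eq_iff diag_def)
  qed
  have "diag (\<lambda>_. 1) = mat 1" by (simp add: diag_def mat_def)
  then have "transpose E ** E = mat 1" using E[of "\<lambda>_. 1"] by (simp add: comp_def)
  then have Ei: "invertible E" using invertible_left_inverse by blast
  let ?M = "P0 ** E ** matrix_inv P"
  have Pi: "P ** matrix_inv P = mat 1" using matrix_inv_mult[OF P(1)] by simp
  have "transpose ?M ** G0 ** ?M =
    transpose (matrix_inv P) ** (transpose E ** (transpose P0 ** G0 ** P0) ** E) ** matrix_inv P"
    by (simp add: matrix_transpose_mul matrix_mul_assoc)
  also have "\<dots> = transpose (matrix_inv P) ** (transpose P ** G ** P) ** matrix_inv P"
    unfolding P0 E P by (simp add: comp_def \<pi>e)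
  also have "\<dots> = transpose (P ** matrix_inv P) ** G ** (P ** matrix_inv P)"
    by (simp add: matrix_transpose_mul matrix_mul_assoc)
  also have "\<dots> = G" by (simp add: Pi transpose_mat)
  finally have "G = transpose ?M ** G0 ** ?M" by simp
  moreover have "invertible ?M"
    by (intro invertible_mult P0 Ei invertible_matrix_inv P)
  ultimately show ?thesis using that by blast
qed

lemma matrix_inv_congruent:
  fixes G M :: "real^'n::finite^'n"
  assumes "invertible G" "L ** M = mat 1" "M ** L = mat 1"
  shows "matrix_inv (transpose M ** G ** M) = L ** matrix_inv G ** transpose L"
proof (rule matrix_inv_unique)
  have "transpose M ** G ** M ** (L ** matrix_inv G ** transpose L) =
    transpose M ** G ** (M ** L) ** matrix_inv G ** transpose L"
    by (simp add: matrix_mul_assoc)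
  also have "\<dots> = transpose M ** (G ** matrix_inv G) ** transpose L"
    by (simp add: assms(3) matrix_mul_assoc)
  also have "\<dots> = transpose (L ** M)"
    by (simp add: matrix_inv_mult[OF assms(1)] matrix_transpose_mul)
  also have "\<dots> = mat 1" by (simp add: assms(2) transpose_mat)
  finally show "transpose M ** G ** M ** (L ** matrix_inv G ** transpose L) = mat 1" .
qed

context atlas
begin

lemma sym_comps_tensor: "t \<in> sym_tensors A m x \<Longrightarrow> sym_comps m (t c)"
  unfolding sym_comps_def by (intro allI impI) (rule sym_tensorsD(3))

lemma metric_on_constant:
  assumes "c \<in> A" "has_signature p q G"
  shows "metric_on A p q (chart_dom c) (metric_from_chart c (\<lambda>_. G))"
  using metric_on_from_chart[OF assms(1) open_UNIV smooth_on_const[OF open_UNIV], of p q G] assms(2)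
  by simp

text \<open>Naturality with equal source and target point and chart, for affine maps whose linear
  part preserves \<open>G\<close>, makes the polynomial of the tensor invariant under the orthogonal
  group of the dual form.\<close>

lemma constant_metric_multiple:
  assumes T: "smooth_tensor_morphism A p q (2 * k) T" "natural_tensor A p q (2 * k) T"
    and c: "c \<in> A" "x \<in> chart_dom c" and G: "has_signature p q G"
  obtains r where "\<And>I. length I = 2 * k \<Longrightarrow>
    T (jet2 A p q x (metric_from_chart c (\<lambda>_. G))) c I = r * symmetrize (2 * k) (tensor_power k (matrix_inv G)) I"
proof (rule invariant_symmetric_tensor)
  let ?t = "T (jet2 A p q x (metric_from_chart c (\<lambda>_. G))) c" and ?B = "matrix_inv G"
  note GB = has_signature_imp[OF G]
  show B: "invertible ?B" "transpose ?B = ?B"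
    using GB by (simp_all add: invertible_matrix_inv transpose_matrix_inv)
  show "sym_comps (2 * k) ?t"
    by (rule sym_comps_tensor[OF tensor_in_sym_tensors[OF T(1) metric_on_constant[OF c(1) G] c(2)]])
  fix R :: "real^'n^'n" and \<xi> assume R: "transpose R ** ?B ** R = ?B"
  note Gi = matrix_inv_mult[OF GB(1)]
  \<comment> \<open>Substituting \<open>R\<close> into the polynomial is the action of
    \<open>transpose R\<close> on components, which dictates \<open>L\<close>. \<open>M\<close> is
    its inverse and preserves \<open>G\<close>, because \<open>R\<close> preserves the inverse of
    \<open>G\<close>.\<close>
  define L M where "L = transpose R" and "M = ?B ** R ** G"
  have "L ** M = (transpose R ** ?B ** R) ** G" by (simp add: L_def M_def matrix_mul_assoc)
  then have inv_right: "L ** M = mat 1" by (simp add: R Gi)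
  then have inv_left: "M ** L = mat 1" by (simp add: matrix_left_right_inverse)
  have "transpose M ** G ** M = G"
  proof -
    have "transpose M = G ** transpose R ** ?B"
      by (simp add: M_def matrix_transpose_mul GB(2) B(2) matrix_mul_assoc)
    then have "transpose M ** G ** M = G ** transpose R ** (?B ** G) ** ?B ** R ** G"
      by (simp add: M_def matrix_mul_assoc)
    also have "\<dots> = G ** (transpose R ** ?B ** R) ** G" by (simp add: Gi matrix_mul_assoc)
    finally show ?thesis by (simp add: R Gi)
  qed
  then have "?t I = transform_comps (2 * k) L ?t I" if "length I = 2 * k" for I
    using natural_tensor_affine[OF T c c G inv_left inv_right that] by simp
  then have "eval_comps (2 * k) ?t \<xi> = eval_comps (2 * k) (transform_comps (2 * k) L ?t) \<xi>"
    by (rule eval_comps_cong)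
  then show "eval_comps (2 * k) ?t (R *v \<xi>) = eval_comps (2 * k) ?t \<xi>"
    by (simp add: eval_transform_comps L_def)
qed (rule that)

text \<open>A congruence from \<open>G\<close> to \<open>G'\<close> provides the linear part of an
  affine map between the charts. On polynomials it acts by substitution, which takes the power of
  one dual form to that of the other and leaves the factor \<open>r\<close> alone.\<close>

lemma constant_metric_same_multiple:
  assumes T: "smooth_tensor_morphism A p q (2 * k) T" "natural_tensor A p q (2 * k) T"
    and c: "c \<in> A" "x \<in> chart_dom c" and G: "has_signature p q G"
    and c': "c' \<in> A" "x' \<in> chart_dom c'" and G': "has_signature p q G'"
    and r: "\<And>I. length I = 2 * k \<Longrightarrow> T (jet2 A p q x (metric_from_chart c (\<lambda>_. G))) c I =
      r * symmetrize (2 * k) (tensor_power k (matrix_inv G)) I"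
    and I: "length I = 2 * k"
  shows "T (jet2 A p q x' (metric_from_chart c' (\<lambda>_. G'))) c' I =
      r * symmetrize (2 * k) (tensor_power k (matrix_inv G')) I"
proof -
  let ?t = "T (jet2 A p q x (metric_from_chart c (\<lambda>_. G))) c"
  let ?t' = "T (jet2 A p q x' (metric_from_chart c' (\<lambda>_. G'))) c'"
  obtain M where M: "invertible M" "G' = transpose M ** G ** M"
    using same_signature_congruent[OF G G'] .
  define L where "L = matrix_inv M"
  have inv_right: "L ** M = mat 1" "M ** L = mat 1" using matrix_inv_mult[OF M(1)] by (simp_all add: L_def)
  have G'i: "matrix_inv G' = L ** matrix_inv G ** transpose L"
    unfolding M(2) by (rule matrix_inv_congruent[OF has_signature_imp(1)[OF G] inv_right])
  have "eval_comps (2 * k) ?t' \<xi> =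
    eval_comps (2 * k) (\<lambda>I. r * symmetrize (2 * k) (tensor_power k (matrix_inv G')) I) \<xi>" for \<xi>
  proof -
    have "eval_comps (2 * k) ?t' \<xi> = eval_comps (2 * k) (transform_comps (2 * k) L ?t) \<xi>"
      unfolding M(2) by (rule eval_comps_cong, rule natural_tensor_affine[OF T c c' G inv_right(2,1)])
    also have "\<dots> = eval_comps (2 * k) (\<lambda>I. r * symmetrize (2 * k) (tensor_power k (matrix_inv G)) I) (transpose L *v \<xi>)"
      unfolding eval_transform_comps by (rule eval_comps_cong) (rule r)
    also have "\<dots> = r * (\<xi> \<bullet> (matrix_inv G' *v \<xi>)) ^ k"
      by (simp add: eval_comps_cmult eval_symmetrize eval_tensor_power dot_lmul_matrix G'i
          flip: matrix_vector_mul_assoc)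
    finally show ?thesis by (simp add: eval_comps_cmult eval_symmetrize eval_tensor_power)
  qed
  moreover have "sym_comps (2 * k) ?t'"
    by (rule sym_comps_tensor[OF tensor_in_sym_tensors[OF T(1) metric_on_constant[OF c'(1) G'] c'(2)]])
  moreover have "sym_comps (2 * k) (\<lambda>I. r * symmetrize (2 * k) (tensor_power k (matrix_inv G')) I)"
    using sym_comps_symmetrize[of "2 * k" "tensor_power k (matrix_inv G')"] unfolding sym_comps_def by metis
  ultimately show ?thesis
    using comps_eq_if_eval_eq[OF open_UNIV UNIV_I] I by blast
qed

end

theorem theorem6p2:
  fixes A :: "('x::{t2_space, second_countable_topology}, 'n::finite) chart set"
    and p q k :: nat
    and T :: "('x, 'n) jet \<Rightarrow> ('x, 'n) tensor"
  assumes "smooth_manifold A"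
    and "p + q = CARD('n)"
    and "k \<ge> 2"
    and "smooth_tensor_morphism A p q (2 * k) T"
    and "natural_tensor A p q (2 * k) T"
    and "divergence_free A p q (2 * k) T"
  shows "\<exists>r::real. \<forall>x W g. x \<in> W \<and> metric_on A p q W g \<longrightarrow>
           T (jet2 A p q x g) = (\<lambda>c I. r * S_tensor A k g x c I)"
\<comment> \<open>If there is no metric of this signature on any open set containing a point, every
  \<open>r\<close> works; otherwise a single metric at a single point determines a factor.\<close>
proof (cases "\<exists>x W g. x \<in> W \<and> metric_on A p q W g")
  case False
  then show ?thesis by blast
next
  case True
  interpret atlas A using assms(1) by unfold_locales
  note T = assms(4,5)
  have sig: "has_signature p q (g c x)" if "metric_on A p q W g" "x \<in> W" "c \<in> A" "x \<in> chart_dom c" for W g c x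
    using that unfolding metric_on_def by blast
  obtain x0 W0 g0 where g0: "x0 \<in> W0" "metric_on A p q W0 g0" using True by blast
  define c0 where "c0 = chart_at A x0"
  have c0: "c0 \<in> A" "x0 \<in> chart_dom c0" using chart_at by (auto simp: c0_def)
  note G0 = sig[OF g0(2,1) c0]
  obtain r where r: "\<And>I. length I = 2 * k \<Longrightarrow> T (jet2 A p q x0 (metric_from_chart c0 (\<lambda>_. g0 c0 x0))) c0 I =
      r * symmetrize (2 * k) (tensor_power k (matrix_inv (g0 c0 x0))) I"
    using constant_metric_multiple[OF T c0 G0] by blast
  have "T (jet2 A p q x g) c I = r * S_tensor A k g x c I" if g: "x \<in> W" "metric_on A p q W g" for x W g c I
  proof (cases "c \<in> A \<and> x \<in> chart_dom c \<and> length I = 2 * k")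
    case False
    \<comment> \<open>For such arguments both sides are 0 by convention.\<close>
    then show ?thesis
      using sym_tensorsD(1)[OF tensor_in_sym_tensors[OF T(1) g(2,1)], of c I] by (auto simp: S_tensor_def)
  next
    case c: True
    then have c': "c \<in> A" "x \<in> chart_dom c" "length I = 2 * k" by auto
    note G = sig[OF g(2,1) c'(1,2)]
    \<comment> \<open>\<open>g\<close> is replaced by the metric constant in \<open>c\<close> with
      the same value at \<open>x\<close>; \<open>k \<ge> 2\<close> provides the three indices
      required.\<close>
    have "T (jet2 A p q x g) c I = T (jet2 A p q x (metric_from_chart c (\<lambda>_. g c x))) c I"
      by (rule tensor_eq_if_value_eq[OF T(1) assms(6) _ c'(1,2) metric_on_constant[OF c'(1) G] c'(2) g(2,1) _ c'(3)])
        (use assms(3) c' in \<open>simp_all add: metric_from_chart_apply\<close>)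
    \<comment> \<open>Affine maps join charts around arbitrary points, so the factor found at
      \<open>x0\<close> applies at \<open>x\<close>, also on another component of the
      manifold.\<close>
    also have "\<dots> = r * symmetrize (2 * k) (tensor_power k (matrix_inv (g c x))) I"
      by (rule constant_metric_same_multiple[OF T c0 G0 c'(1,2) G r c'(3)])
    finally show ?thesis using c by (simp add: S_tensor_def)
  qed
  then show ?thesis by (intro exI[of _ r]) (auto simp: fun_eq_iff)
qed

end
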